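(* There is $\omega_0\in(0,1]$ such that for every fixed $\omega\in(-\omega_0,\omega_0)$, the Lyapunov functional $\Lambda_\omega=R+(1-\omega^2)Q$ is strictly convex at $(u,v)=(U_\omega,\overline U_\omega)$ in the orthogonal complement in $H^1(\mathbb{R},\mathbb{C}^2)$ of the complex-valued constraints, i.e. on the set of perturbations $(u,v)\in H^1(\mathbb{R},\mathbb{C}^2)$ satisfying $$\int_{\mathbb{R}}\big(\overline U_\omega u+U_\omega v\big)\,dx=0\qquad\text{and}\qquad\int_{\mathbb{R}}\big(\overline U_\omega'u+U_\omega'v\big)\,dx=0,$$ where the prime denotes the derivative in $x$.
   Context: For $\omega\in(-1,1)$, $$U_\omega(x)=\frac{\sqrt{1-\omega^2}}{\sqrt{1+\omega}\cosh(\sqrt{1-\omega^2}\,x)+i\sqrt{1-\omega}\sinh(\sqrt{1-\omega^2}\,x)} .$$ For $(u,v)\in H^1(\mathbb{R},\mathbb{C}^2)$ (regarded as a real Hilbert space), $$Q=\int_{\mathbb{R}}(|u|^2+|v|^2)\,dx,$$ $$R=\int_{\mathbb{R}}\Big[|u_x|^2+|v_x|^2-\tfrac{i}{2}(u_x\bar u-\bar u_xu)(|u|^2+2|v|^2)+\tfrac{i}{2}(v_x\bar v-\bar v_xv)(2|u|^2+|v|^2)-(u\bar v+\bar uv)(|u|^2+|v|^2)+2|u|^2|v|^2(|u|^2+|v|^2)\Big]dx .$$ The point $(U_\omega,\overline U_\omega)$ is a critical point of $\Lambda_\omega$. "Strictly convex at $(U_\omega,\overline U_\omega)$" on a closed real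 subspace $X$ of $H^1(\mathbb{R},\mathbb{C}^2)$ means that the second variation there is strictly positive on $X$: there is $C>0$ (depending on $\omega$) such that $$\frac{d^2}{ds^2}\Big|_{s=0}\Lambda_\omega\big(U_\omega+su,\overline U_\omega+sv\big)\ge C\big(\|u\|_{H^1}^2+\|v\|_{H^1}^2\big)\quad\text{for all }(u,v)\in X .$$ *)

theory Defs
  imports "HOL-Analysis.Analysis"
begin

section \<open>The Sobolev space \<open>H\<^sup>1(\<real>, \<complex>)\<close>\<close>

definition L2 :: "(real \<Rightarrow> complex) set" where
  "L2 = {f. f \<in> borel_measurable lborel \<and> integrable lborel (\<lambda>x. (cmod (f x))\<^sup>2)}"

text \<open>
  On the line one may take test functions in \<open>C\<^sub>c\<^sup>1\<close> (as in Brezis, Functional Analysis,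
  Sobolev Spaces and PDEs, Section 8.2). Real-valued ones suffice for complex-valued \<open>u\<close>.
\<close>
definition test_function :: "(real \<Rightarrow> real) \<Rightarrow> bool" where
  "test_function \<phi> \<longleftrightarrow>
     \<phi> differentiable_on UNIV \<and> continuous_on UNIV (deriv \<phi>) \<and> compact (closure {x. \<phi> x \<noteq> 0})"

definition has_weak_deriv :: "(real \<Rightarrow> complex) \<Rightarrow> (real \<Rightarrow> complex) \<Rightarrow> bool" where
  "has_weak_deriv u g \<longleftrightarrow>
     (\<forall>\<phi>. test_function \<phi> \<longrightarrow>
        (LINT x|lborel. deriv \<phi> x *\<^sub>R u x) = - (LINT x|lborel. \<phi> x *\<^sub>R g x))"

text \<open>
  Elements are Borel representatives of the almost-everywhere classes; all functionals below
  depend only on the classes.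
\<close>
definition H1 :: "(real \<Rightarrow> complex) set" where
  "H1 = {u \<in> L2. \<exists>g \<in> L2. has_weak_deriv u g}"

text \<open>For \<open>u \<in> H1\<close> the weak derivative is unique up to null sets, so the choice is harmless.\<close>
definition weak_deriv :: "(real \<Rightarrow> complex) \<Rightarrow> real \<Rightarrow> complex" where
  "weak_deriv u = (SOME g. g \<in> L2 \<and> has_weak_deriv u g)"

definition H1_norm :: "(real \<Rightarrow> complex) \<Rightarrow> real" where
  "H1_norm u = sqrt ((LINT x|lborel. (cmod (u x))\<^sup>2) + (LINT x|lborel. (cmod (weak_deriv u x))\<^sup>2))"

section \<open>The soliton and the conserved quantities\<close>

definition U :: "real \<Rightarrow> real \<Rightarrow> complex" where
  "U \<omega> x = of_real (sqrt (1 - \<omega>\<^sup>2)) /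
     (of_real (sqrt (1 + \<omega>) * cosh (sqrt (1 - \<omega>\<^sup>2) * x))
      + \<i> * of_real (sqrt (1 - \<omega>) * sinh (sqrt (1 - \<omega>\<^sup>2) * x)))"

definition Q :: "(real \<Rightarrow> complex) \<Rightarrow> (real \<Rightarrow> complex) \<Rightarrow> real" where
  "Q u v = (LINT x|lborel. (cmod (u x))\<^sup>2 + (cmod (v x))\<^sup>2)"

definition R_density :: "complex \<Rightarrow> complex \<Rightarrow> complex \<Rightarrow> complex \<Rightarrow> complex" where
  "R_density u ux v vx =
     of_real ((cmod ux)\<^sup>2 + (cmod vx)\<^sup>2)
     - \<i> / 2 * (ux * cnj u - cnj ux * u) * of_real ((cmod u)\<^sup>2 + 2 * (cmod v)\<^sup>2)
     + \<i> / 2 * (vx * cnj v - cnj vx * v) * of_real (2 * (cmod u)\<^sup>2 + (cmod v)\<^sup>2)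
     - (u * cnj v + cnj u * v) * of_real ((cmod u)\<^sup>2 + (cmod v)\<^sup>2)
     + of_real (2 * (cmod u)\<^sup>2 * (cmod v)\<^sup>2 * ((cmod u)\<^sup>2 + (cmod v)\<^sup>2))"

text \<open>The density is real-valued; \<open>Re\<close> only adjusts the type.\<close>
definition R :: "(real \<Rightarrow> complex) \<Rightarrow> (real \<Rightarrow> complex) \<Rightarrow> real" where
  "R u v = (LINT x|lborel. Re (R_density (u x) (weak_deriv u x) (v x) (weak_deriv v x)))"

definition Lyapunov :: "real \<Rightarrow> (real \<Rightarrow> complex) \<Rightarrow> (real \<Rightarrow> complex) \<Rightarrow> real" where
  "Lyapunov \<omega> u v = R u v + (1 - \<omega>\<^sup>2) * Q u v"

section \<open>Strict convexity on a space of perturbations\<close>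

text \<open>
  \<open>D\<close> is the second derivative at \<open>s = 0\<close> of \<open>s \<mapsto> F (p + s u) (q + s v)\<close>; the existence of this
  derivative is part of the predicate.
\<close>
definition has_second_variation ::
  "((real \<Rightarrow> complex) \<Rightarrow> (real \<Rightarrow> complex) \<Rightarrow> real) \<Rightarrow> (real \<Rightarrow> complex) \<Rightarrow> (real \<Rightarrow> complex)
    \<Rightarrow> (real \<Rightarrow> complex) \<Rightarrow> (real \<Rightarrow> complex) \<Rightarrow> real \<Rightarrow> bool" where
  "has_second_variation F p q u v D \<longleftrightarrow>
     (\<exists>G. (\<forall>\<^sub>F s in nhds 0.
             ((\<lambda>t. F (\<lambda>x. p x + t *\<^sub>R u x) (\<lambda>x. q x + t *\<^sub>R v x)) has_real_derivative G s) (at s))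
          \<and> (G has_real_derivative D) (at 0))"

definition strictly_convex_at ::
  "((real \<Rightarrow> complex) \<Rightarrow> (real \<Rightarrow> complex) \<Rightarrow> real) \<Rightarrow> (real \<Rightarrow> complex) \<Rightarrow> (real \<Rightarrow> complex)
    \<Rightarrow> ((real \<Rightarrow> complex) \<times> (real \<Rightarrow> complex)) set \<Rightarrow> bool" where
  "strictly_convex_at F p q X \<longleftrightarrow>
     (\<exists>C>0. \<forall>(u, v) \<in> X. \<exists>D. has_second_variation F p q u v D
        \<and> D \<ge> C * ((H1_norm u)\<^sup>2 + (H1_norm v)\<^sup>2))"

definition constrained_perturbations :: "real \<Rightarrow> ((real \<Rightarrow> complex) \<times> (real \<Rightarrow> complex)) set" where
  "constrained_perturbations \<omega> =
     {(u, v). u \<in> H1 \<and> v \<in> H1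
        \<and> (LINT x|lborel. cnj (U \<omega> x) * u x + U \<omega> x * v x) = 0
        \<and> (LINT x|lborel. cnj (vector_derivative (U \<omega>) (at x)) * u x
                        + vector_derivative (U \<omega>) (at x) * v x) = 0}"

end

theory Submission
  imports Defs "HOL-Probability.Sinc_Integral"
begin

text \<open>
  In the variables \<open>u\<close> and \<open>w = cnj v\<close> the Lyapunov density is invariant under the swap of its two
  arguments and the soliton lies on the diagonal, so the second variation splits into one form acting on
  \<open>u + w\<close> and one acting on \<open>u - w\<close>. With the polar form \<open>U = r E\<close>, \<open>\<rho> = r\<^sup>2\<close>, \<open>s = r' / r\<close> and
  \<open>m\<^sup>2 = 1 - \<omega>\<^sup>2\<close>, a rotation by a power of the phase \<open>E\<close> turns each of them into
  \<open>\<integral> \<bar>\<zeta>' - s \<zeta>\<bar>\<^sup>2\<close> plus a potential of size \<open>O(\<omega>)\<close>, up to a total derivative. The operator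
  \<open>\<zeta> \<mapsto> \<zeta>' - s \<zeta>\<close> has kernel \<open>\<complex> r\<close>, and a Hardy-type inequality shows that it is bounded below modulo
  this kernel. In each block the two constraints determine both components of the projection onto \<open>\<complex> r\<close>,
  with constants that are uniform for small \<open>\<omega>\<close>; hence both forms are coercive once \<open>\<bar>\<omega>\<bar>\<close> is small.

  The calculus is done with absolutely continuous representatives of the elements of \<open>H1\<close>, and along a ray
  the functional is a polynomial in the parameter, whose quadratic coefficient is half the second variation.
\<close>

section \<open>Absolutely continuous functions\<close>

text \<open>At \<omega> = 0 the potentials vanish and the two forms reduce to the squared norms of
  \<open>e_plus\<close> and \<open>e_minus\<close>, each with a kernel of two real dimensions. Gauge
  and translation invariance explain only two of these four directions, so conditions for the
  symmetries alone could not suffice even at \<omega> = 0; the two complex constraints supply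
  exactly four real ones. For other \<omega> the potentials need not be nonnegative, and no spectrum
  is computed: they are absorbed into the squares. This sets the threshold. The potential costs at
  most 16 |\<omega>| times the squared norm, coercivity on the constrained space has the constant
  14000000, and the product has to stay below 1; |\<omega>| \<le> 1/10^9 makes it 0.224. Every
  constant is explicit and generous, because only positivity matters. The splitting into two forms
  is an identity between integrands, total derivatives included; integration by parts removes those
  afterwards.\<close>

definition primitive :: "(real \<Rightarrow> complex) \<Rightarrow> (real \<Rightarrow> complex) \<Rightarrow> bool" where
  "primitive F f \<longleftrightarrow> (\<forall>a b. a \<le> b \<longrightarrow>
     set_integrable lborel {a..b} f \<and> (LINT x:{a..b}|lborel. f x) = F b - F a)"

lemma primitive_set_integrable: "primitive F f \<Longrightarrow> set_integrable lborel {a..b} f"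
  by (cases "a \<le> b") (auto simp: primitive_def)

lemma primitive_eq: "primitive F f \<Longrightarrow> a \<le> b \<Longrightarrow> (LINT x:{a..b}|lborel. f x) = F b - F a"
  by (auto simp: primitive_def)

lemma primitive_continuous:
  assumes "primitive F f" shows "continuous_on UNIV F"
proof -
  have "isCont F x" for x
  proof -
    let ?a = "x - 1" and ?b = "x + 1"
    have "continuous_on {?a..?b} (\<lambda>y. F ?a + integral {?a..y} f)"
      by (intro continuous_intros indefinite_integral_continuous_1
          set_borel_integral_eq_integral(1) primitive_set_integrable[OF assms])
    also have "?this \<longleftrightarrow> continuous_on {?a..?b} F"
      using primitive_eq[OF assms] set_borel_integral_eq_integral(2)[OF primitive_set_integrable[OF assms]]
      by (intro continuous_on_cong) auto
    finally have "continuous_on {?a<..<?b} F" by (rule continuous_on_subset) auto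
    thus ?thesis by (simp add: continuous_on_eq_continuous_at)
  qed
  thus ?thesis by (simp add: continuous_at_imp_continuous_on)
qed

lemma primitive_measurable:
  assumes "primitive F f" shows "F \<in> borel_measurable borel"
  using primitive_continuous[OF assms] by (rule borel_measurable_continuous_onI)

lemma measurable_of_locally_integrable:
  fixes f :: "real \<Rightarrow> complex"
  assumes "\<And>a b. set_integrable lborel {a..b} f" shows "f \<in> borel_measurable borel"
proof -
  have "(\<lambda>x. indicator {- real n..real n} x *\<^sub>R f x) \<in> borel_measurable borel" for n
    using assms[of "- real n" "real n"] by (auto simp: set_integrable_def dest: borel_measurable_integrable)
  moreover have "(\<lambda>n. indicator {- real n..real n} x *\<^sub>R f x) \<longlonglongrightarrow> f x" for x
  proof (rule tendsto_eventually)
    have "eventually (\<lambda>n. real n \<ge> \<bar>x\<bar>) sequentially"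
      using eventually_ge_at_top[of "nat \<lceil>\<bar>x\<bar>\<rceil>"] by eventually_elim linarith
    thus "eventually (\<lambda>n. indicator {- real n..real n} x *\<^sub>R f x = f x) sequentially"
      by eventually_elim (auto simp: indicator_def)
  qed
  ultimately show ?thesis by (rule borel_measurable_LIMSEQ_metric)
qed

lemma primitive_measurable': "primitive F f \<Longrightarrow> f \<in> borel_measurable borel"
  by (rule measurable_of_locally_integrable) (rule primitive_set_integrable)

lemma primitive_of_deriv:
  assumes "\<And>x. (F has_vector_derivative f x) (at x)" "continuous_on UNIV f"
  shows "primitive F f"
  unfolding primitive_def set_lebesgue_integral_def
  by (auto intro!: integral_FTC_atLeastAtMost borel_integrable_atLeastAtMost'
      has_vector_derivative_at_within assms continuous_on_subset[OF assms(2)])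

lemma primitive_add: "primitive F f \<Longrightarrow> primitive G g \<Longrightarrow> primitive (\<lambda>x. F x + G x) (\<lambda>x. f x + g x)"
  by (auto simp: primitive_def set_integral_add)

lemma primitive_cmult: "primitive F f \<Longrightarrow> primitive (\<lambda>x. c * F x) (\<lambda>x. c * f x)"
  by (auto simp: primitive_def right_diff_distrib)

lemma primitive_diff: "primitive F f \<Longrightarrow> primitive G g \<Longrightarrow> primitive (\<lambda>x. F x - G x) (\<lambda>x. f x - g x)"
  by (auto simp: primitive_def set_integral_diff)

lemma primitive_const: "primitive (\<lambda>x. c) (\<lambda>x. 0)"
  by (auto simp: primitive_def set_integrable_def set_lebesgue_integral_def)

lemma primitive_cnj: "primitive F f \<Longrightarrow> primitive (\<lambda>x. cnj (F x)) (\<lambda>x. cnj (f x))"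
proof -
  assume *: "primitive F f"
  have "set_integrable lborel {a..b} (\<lambda>x. cnj (f x))" for a b
    using primitive_set_integrable[OF *, of a b] integrable_cnj[of lborel "\<lambda>x. indicator {a..b} x *\<^sub>R f x"]
    by (simp add: set_integrable_def scaleR_conv_of_real)
  moreover have "(LINT x:{a..b}|lborel. cnj (f x)) = cnj (LINT x:{a..b}|lborel. f x)" for a b
    using Bochner_Integration.integral_cnj[of lborel "\<lambda>x. indicator {a..b} x *\<^sub>R f x"]
    by (simp add: set_lebesgue_integral_def scaleR_conv_of_real)
  ultimately show ?thesis using * by (auto simp: primitive_def)
qed

lemma set_integrable_mult_continuous:
  fixes p q :: "real \<Rightarrow> complex"
  assumes p: "\<And>a b. set_integrable lborel {a..b} p" and q: "continuous_on UNIV q"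
  shows "set_integrable lborel {a..b} (\<lambda>x. p x * q x)"
proof -
  have "bounded (q ` {a..b})"
    by (intro compact_imp_bounded compact_continuous_image continuous_on_subset[OF q]) auto
  then obtain B where B: "\<And>x. x \<in> {a..b} \<Longrightarrow> norm (q x) \<le> B" unfolding bounded_iff by blast
  have [measurable]: "q \<in> borel_measurable borel" "p \<in> borel_measurable borel"
    using p q by (auto intro: borel_measurable_continuous_onI measurable_of_locally_integrable)
  have "integrable lborel (\<lambda>x. B * norm (indicator {a..b} x *\<^sub>R p x))"
    using p[of a b] unfolding set_integrable_def by (intro integrable_mult_right integrable_norm)
  thus ?thesis unfolding set_integrable_def
  proof (rule Bochner_Integration.integrable_bound)
    show "AE x in lborel. norm (indicator {a..b} x *\<^sub>R (p x * q x)) \<le> norm (B * norm (indicator {a..b} x *\<^sub>R p x))"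
    proof (intro AE_I2)
      fix x :: real
      have "norm (p x) * norm (q x) \<le> \<bar>B * norm (p x)\<bar>" if "x \<in> {a..b}"
        using mult_left_mono[OF B[OF that] norm_ge_zero[of "p x"]] by (simp add: mult.commute abs_le_iff)
      thus "norm (indicator {a..b} x *\<^sub>R (p x * q x)) \<le> norm (B * norm (indicator {a..b} x *\<^sub>R p x))"
        by (auto simp: indicator_def norm_mult)
    qed
  qed measurable
qed

text \<open>Since \<open>primitive\<close> records only integrals over intervals, the product rule
  comes from Fubini instead of pointwise differentiation: the integral of f(x) g(y) over the square
  with side [a, b] is cut along the diagonal, and the two triangles yield the two terms of the
  rule.\<close>

lemma primitive_mult:
  assumes F: "primitive F f" and G: "primitive G g"
  shows "primitive (\<lambda>x. F x * G x) (\<lambda>x. f x * G x + F x * g x)"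
proof -
  have int1: "set_integrable lborel {a..b} (\<lambda>x. f x * G x)" for a b
    by (rule set_integrable_mult_continuous[OF primitive_set_integrable[OF F] primitive_continuous[OF G]])
  have int2: "set_integrable lborel {a..b} (\<lambda>x. F x * g x)" for a b
    using set_integrable_mult_continuous[OF primitive_set_integrable[OF G] primitive_continuous[OF F]] by (simp add: mult.commute)
  have "(LINT x:{a..b}|lborel. f x * G x + F x * g x) = F b * G b - F a * G a" if ab: "a \<le> b" for a b
  proof -
    define i where "i = (indicator {a..b} :: real \<Rightarrow> real)"
    have [measurable]: "f \<in> borel_measurable borel" "g \<in> borel_measurable borel"
       "F \<in> borel_measurable borel" "G \<in> borel_measurable borel" "i \<in> borel_measurable borel"
      using F G by (auto intro: primitive_measurable primitive_measurable' simp: i_def)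
    define f1 where "f1 x = i x *\<^sub>R f x" for x
    define g1 where "g1 x = i x *\<^sub>R g x" for x
    have [measurable]: "f1 \<in> borel_measurable borel" "g1 \<in> borel_measurable borel"
      by (auto simp: f1_def[abs_def] g1_def[abs_def])
    have f1: "integrable lborel f1" and g1: "integrable lborel g1"
      using primitive_set_integrable[OF F] primitive_set_integrable[OF G]
      by (auto simp: f1_def[abs_def] g1_def[abs_def] set_integrable_def i_def)
    define h where "h x y = (if y \<le> x then f1 x * g1 y else 0)" for x y
    define k where "k x y = (if y > x then f1 x * g1 y else 0)" for x y
    have meas: "case_prod h \<in> borel_measurable (lborel \<Otimes>\<^sub>M lborel)" "case_prod k \<in> borel_measurable (lborel \<Otimes>\<^sub>M lborel)"
      unfolding h_def k_def by measurable
    have intprod: "integrable (lborel \<Otimes>\<^sub>M lborel) (\<lambda>(x, y). f1 x * g1 y)"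
    proof (rule lborel_pair.Fubini_integrable)
      show "integrable lborel (\<lambda>x. LINT y|lborel. norm (case (x, y) of (x, y) \<Rightarrow> f1 x * g1 y))"
        using f1 by (simp add: norm_mult)
    qed (use g1 in auto)
    have inth: "integrable (lborel \<Otimes>\<^sub>M lborel) (case_prod h)"
      by (rule Bochner_Integration.integrable_bound[OF intprod meas(1)]) (auto simp: h_def)
    have intk: "integrable (lborel \<Otimes>\<^sub>M lborel) (case_prod k)"
      by (rule Bochner_Integration.integrable_bound[OF intprod meas(2)]) (auto simp: k_def)
    have hx: "(LINT y|lborel. h x y) = f1 x * (G x - G a)" for x
    proof (cases "x \<in> {a..b}")
      case True
      have "(LINT y|lborel. h x y) = (LINT y|lborel. f1 x * (indicator {a..x} y *\<^sub>R g y))"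
        using True by (intro Bochner_Integration.integral_cong) (auto simp: h_def g1_def i_def indicator_def)
      also have "\<dots> = f1 x * (LINT y|lborel. indicator {a..x} y *\<^sub>R g y)"
        by (rule integral_mult_right_zero)
      also have "\<dots> = f1 x * (G x - G a)"
        using primitive_eq[OF G, of a x] True by (simp add: set_lebesgue_integral_def)
      finally show ?thesis .
    next
      case False
      hence "f1 x = 0" by (auto simp: f1_def i_def)
      thus ?thesis by (simp add: h_def cong: if_cong)
    qed
    have ky: "(LINT x|lborel. k x y) = (F y - F a) * g1 y" for y
    proof (cases "y \<in> {a..b}")
      case True
      \<comment> \<open>The diagonal belongs to \<open>h\<close>, so \<open>k\<close> omits x = y
        and the integrands agree only off a null set.\<close>
      have "(LINT x|lborel. k x y) = (LINT x|lborel. (indicator {a..y} x *\<^sub>R f x) * g1 y)"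
        using True AE_lborel_singleton[of y]
        by (intro integral_cong_AE) (auto simp: k_def f1_def i_def indicator_def)
      also have "\<dots> = (LINT x|lborel. indicator {a..y} x *\<^sub>R f x) * g1 y"
        by (rule integral_mult_left_zero)
      also have "\<dots> = (F y - F a) * g1 y"
        using primitive_eq[OF F, of a y] True by (simp add: set_lebesgue_integral_def)
      finally show ?thesis .
    next
      case False
      hence "g1 y = 0" by (auto simp: g1_def i_def)
      thus ?thesis by (simp add: k_def cong: if_cong)
    qed
    have "(LINT x:{a..b}|lborel. f x * (G x - G a)) = (LINT x|lborel. LINT y|lborel. h x y)"
      unfolding hx by (auto simp: set_lebesgue_integral_def f1_def i_def)
    also have "\<dots> = integral\<^sup>L (lborel \<Otimes>\<^sub>M lborel) (case_prod h)"
      by (rule lborel_pair.integral_fst[OF inth])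
    finally have e1: "(LINT x:{a..b}|lborel. f x * (G x - G a)) = \<dots>" .
    have "(LINT x:{a..b}|lborel. (F x - F a) * g x) = (LINT y|lborel. LINT x|lborel. k x y)"
      unfolding ky by (auto simp: set_lebesgue_integral_def g1_def i_def)
    also have "\<dots> = integral\<^sup>L (lborel \<Otimes>\<^sub>M lborel) (case_prod k)"
      by (rule lborel_pair.integral_snd[OF intk])
    finally have e2: "(LINT x:{a..b}|lborel. (F x - F a) * g x) = \<dots>" .
    have "integral\<^sup>L (lborel \<Otimes>\<^sub>M lborel) (case_prod h) + integral\<^sup>L (lborel \<Otimes>\<^sub>M lborel) (case_prod k)
       = (LINT (x,y)|(lborel \<Otimes>\<^sub>M lborel). f1 x * g1 y)"
      unfolding Bochner_Integration.integral_add[OF inth intk, symmetric]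
      by (intro Bochner_Integration.integral_cong) (auto simp: h_def k_def)
    also have "\<dots> = (LINT x|lborel. LINT y|lborel. f1 x * g1 y)"
      by (rule lborel_pair.integral_fst[OF intprod, symmetric])
    also have "\<dots> = integral\<^sup>L lborel f1 * integral\<^sup>L lborel g1" by simp
    also have "\<dots> = (F b - F a) * (G b - G a)"
      using primitive_eq[OF F ab] primitive_eq[OF G ab]
      by (simp add: f1_def[abs_def] g1_def[abs_def] i_def set_lebesgue_integral_def)
    finally have e3: "(LINT x:{a..b}|lborel. f x * (G x - G a)) + (LINT x:{a..b}|lborel. (F x - F a) * g x)
       = (F b - F a) * (G b - G a)" using e1 e2 by simp
    have "(LINT x:{a..b}|lborel. f x * (G x - G a)) = (LINT x:{a..b}|lborel. f x * G x) - (F b - F a) * G a"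
      using primitive_eq[OF F ab] int1[of a b] primitive_set_integrable[OF F]
      by (simp add: right_diff_distrib set_integral_diff)
    moreover have "(LINT x:{a..b}|lborel. (F x - F a) * g x) = (LINT x:{a..b}|lborel. F x * g x) - F a * (G b - G a)"
      using primitive_eq[OF G ab] int2[of a b] primitive_set_integrable[OF G]
      by (simp add: left_diff_distrib set_integral_diff)
    ultimately have "(LINT x:{a..b}|lborel. f x * G x) + (LINT x:{a..b}|lborel. F x * g x) = F b * G b - F a * G a"
      using e3 by algebra
    thus ?thesis using int1[of a b] int2[of a b] by (simp add: set_integral_add)
  qed
  thus ?thesis using int1 int2 by (auto simp: primitive_def set_integral_add)
qed

section \<open>Integrals of derivatives over half lines and over the line\<close>

lemma integrable_limit_zero:
  fixes F :: "real \<Rightarrow> complex"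
  assumes F: "integrable lborel F" and L: "(F \<longlongrightarrow> L) at_top"
  shows "L = 0"
proof (rule ccontr)
  assume "L \<noteq> 0"
  hence "eventually (\<lambda>x. norm (F x) > norm L / 2) at_top"
    by (intro order_tendstoD(1)[OF tendsto_norm[OF L]]) auto
  then obtain B where B: "\<And>x. x \<ge> B \<Longrightarrow> norm (F x) > norm L / 2"
    by (auto simp: eventually_at_top_linorder)
  have "integrable lborel (\<lambda>x. (norm L / 2) * indicator {B..} x)"
    by (rule Bochner_Integration.integrable_bound[OF F]) (use B in \<open>auto simp: indicator_def intro!: AE_I2 less_imp_le\<close>)
  hence "integrable lborel (\<lambda>x. (2 / norm L) * ((norm L / 2) * indicator {B..} x))"
    by (rule integrable_mult_right)
  hence "integrable lborel (indicator {B..} :: real \<Rightarrow> real)"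
    using \<open>L \<noteq> 0\<close> by (simp flip: mult.assoc)
  hence "emeasure lborel {B..} < \<infinity>" by (simp add: integrable_indicator_iff)
  moreover have "emeasure lborel {B..} \<ge> ennreal (real n)" for n
  proof -
    have "emeasure lborel {B..B + real n} \<le> emeasure lborel {B..}" by (intro emeasure_mono) auto
    thus ?thesis by simp
  qed
  ultimately show False
    by (metis ennreal_Ex_less_of_nat ennreal_of_nat_eq_real_of_nat infinity_ennreal_def leD)
qed

text \<open>Integrability of \<open>f\<close> gives \<open>F\<close> a limit at infinity, and
  integrability of \<open>F\<close> forces this limit to be 0.\<close>

lemma integral_primitive_atLeast:
  assumes p: "primitive F f" and F: "integrable lborel F" and f: "integrable lborel f"
  shows "(LINT x:{0..}|lborel. f x) = - F 0"
proof -
  have "((\<lambda>b. LINT x:{0..b}|lborel. f x) \<longlongrightarrow> (LINT x:{0..}|lborel. f x)) at_top"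
    using f by (intro tendsto_set_lebesgue_integral_at_top) (auto simp: set_integrable_def integrable_mult_indicator)
  hence "((\<lambda>b. F 0 + (LINT x:{0..b}|lborel. f x)) \<longlongrightarrow> F 0 + (LINT x:{0..}|lborel. f x)) at_top"
    by (intro tendsto_intros)
  moreover have "eventually (\<lambda>b. F 0 + (LINT x:{0..b}|lborel. f x) = F b) at_top"
    using eventually_ge_at_top[of 0] by eventually_elim (simp add: primitive_eq[OF p])
  ultimately have "(F \<longlongrightarrow> F 0 + (LINT x:{0..}|lborel. f x)) at_top"
    using Lim_transform_eventually by blast
  from integrable_limit_zero[OF F this] show ?thesis by (simp add: add_eq_0_iff)
qed

text \<open>Carries the half-line formula from the right to the left; the outer minus sign accounts
  for the reversed orientation.\<close>

lemma primitive_reflect: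
  assumes "primitive F f" shows "primitive (\<lambda>x. - F (- x)) (\<lambda>x. f (- x))"
proof -
  have *: "indicator {a..b} x *\<^sub>R f (- x) = (\<lambda>x. indicator {- b..- a} x *\<^sub>R f x) (0 + (- 1) * x)" for a b x :: real
    by (auto simp: indicator_def)
  show ?thesis
    unfolding primitive_def set_integrable_def set_lebesgue_integral_def *
  proof (intro allI impI conjI)
    fix a b :: real assume "a \<le> b"
    show "integrable lborel (\<lambda>x. indicator {- b..- a} (0 + - 1 * x) *\<^sub>R f (0 + - 1 * x))"
      using primitive_set_integrable[OF assms, of "-b" "-a"]
      by (intro lborel_integrable_real_affine[where f="\<lambda>x. indicator {- b..- a} x *\<^sub>R f x"]) (auto simp: set_integrable_def)
    show "(LINT x|lborel. indicator {- b..- a} (0 + - 1 * x) *\<^sub>R f (0 + - 1 * x)) = - F (- b) - - F (- a)"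
      using primitive_eq[OF assms, of "-b" "-a"] \<open>a \<le> b\<close>
        lborel_integral_real_affine[of "- 1" "\<lambda>x. indicator {- b..- a} x *\<^sub>R f x" 0]
      by (simp add: set_lebesgue_integral_def)
  qed
qed

lemma integral_primitive_lessThan:
  assumes p: "primitive F f" and F: "integrable lborel F" and f: "integrable lborel f"
  shows "(LINT x:{..<0}|lborel. f x) = F 0"
proof -
  have "(LINT x:{0..}|lborel. f (- x)) = F 0"
    using integral_primitive_atLeast[OF primitive_reflect[OF p]]
      lborel_integrable_real_affine[OF F, of "- 1" 0] lborel_integrable_real_affine[OF f, of "- 1" 0]
    by simp
  moreover have "(LINT x:{0..}|lborel. f (- x)) = (LINT x:{..0}|lborel. f x)"
    using lborel_integral_real_affine[of "- 1" "\<lambda>x. indicator {..0} x *\<^sub>R f x" 0]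
    by (simp add: set_lebesgue_integral_def indicator_def)
  moreover have "(LINT x:{..0}|lborel. f x) = (LINT x:{..<0}|lborel. f x)"
    using AE_lborel_singleton[of "0::real"] borel_measurable_integrable[OF f]
    unfolding set_lebesgue_integral_def by (intro integral_cong_AE) (auto simp: indicator_def)
  ultimately show ?thesis by simp
qed

lemma integral_split_at_0:
  fixes f :: "real \<Rightarrow> 'a :: {banach, second_countable_topology}"
  assumes f: "integrable lborel f"
  shows "(LINT x|lborel. f x) = (LINT x:{..<0}|lborel. f x) + (LINT x:{0..}|lborel. f x)"
proof -
  have "(LINT x:{..<0}\<union>{0..}|lborel. f x) = (LINT x:{..<0}|lborel. f x) + (LINT x:{0..}|lborel. f x)"
    using f by (intro set_integral_Un) (auto simp: set_integrable_def integrable_mult_indicator)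
  moreover have "{..<0}\<union>{0..} = (UNIV :: real set)" by auto
  ultimately show ?thesis by (simp add: set_lebesgue_integral_def)
qed

lemma integral_primitive_eq_0:
  assumes "primitive F f" "integrable lborel F" "integrable lborel f"
  shows "(LINT x|lborel. f x) = 0"
  using integral_primitive_atLeast[OF assms] integral_primitive_lessThan[OF assms] integral_split_at_0[OF assms(3)]
  by simp

section \<open>Functions with vanishing interval integrals\<close>

lemma zero_AE_of_interval_integrals_real:
  fixes f :: "real \<Rightarrow> real"
  assumes f: "\<And>a b. set_integrable lborel {a..b} f" and 0: "\<And>a b. a \<le> b \<Longrightarrow> (LINT x:{a..b}|lborel. f x) = 0"
  shows "AE x in lborel. f x = 0"
proof -
  have [measurable]: "f \<in> borel_measurable borel"
  proof -
    have "set_integrable lborel {a..b} (\<lambda>x. complex_of_real (f x))" for a b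
      using f[of a b] unfolding set_integrable_def by (simp add: scaleR_conv_of_real flip: of_real_mult)
    from measurable_of_locally_integrable[OF this]
    have "(\<lambda>x. Re (complex_of_real (f x))) \<in> borel_measurable borel" by measurable
    thus ?thesis by simp
  qed
  have "AE x in lborel. x \<in> {- real n..real n} \<longrightarrow> f x = 0" for n
  proof -
    let ?I = "{- real n..real n}"
    have si: "set_integrable lborel (A \<inter> ?I) f" if "A \<in> sets borel" for A
      by (rule set_integrable_subset[OF f]) (use that in auto)
    \<comment> \<open>Dynkin's argument: closed intervals are an intersection-stable generator of
      the Borel sets, and inside the window \<open>?I\<close> the sets of zero integral are closed
      under complements and countable disjoint unions.\<close>
    have zero: "(LINT x:(A \<inter> ?I)|lborel. f x) = 0" if "A \<in> sets borel" for A
    proof -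
      have stable: "Int_stable (range (\<lambda>(a, b). {a..b::real}))"
        by (force simp: Int_stable_def)
      have sub: "range (\<lambda>(a, b). {a..b::real}) \<subseteq> Pow UNIV" by auto
      have mem: "A \<in> sigma_sets UNIV (range (\<lambda>(a, b). {a..b::real}))"
        using that unfolding borel_eq_atLeastAtMost by (subst (asm) sets_measure_of) auto
      show ?thesis
        using stable sub mem
      proof (induction rule: sigma_sets_induct_disjoint)
        case (basic A)
        then obtain a b where A: "A = {a..b}" by auto
        have "A \<inter> ?I = {max a (- real n)..min b (real n)}" by (auto simp: A)
        moreover have "(LINT x:{c..d}|lborel. f x) = 0" for c d
          using 0[of c d] by (cases "c \<le> d") (auto simp: set_lebesgue_integral_def)
        ultimately show ?case by simp
      next
        case empty
        show ?case by (simp add: set_lebesgue_integral_def)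
      next
        case (compl A)
        have A: "A \<in> sets borel"
          using compl(1) unfolding borel_eq_atLeastAtMost by (subst sets_measure_of) auto
        have "(LINT x:(A \<inter> ?I)\<union>((UNIV - A) \<inter> ?I)|lborel. f x) = (LINT x:(A \<inter> ?I)|lborel. f x) + (LINT x:((UNIV - A) \<inter> ?I)|lborel. f x)"
          using A by (intro set_integral_Un si) auto
        also have "(A \<inter> ?I)\<union>((UNIV - A) \<inter> ?I) = ?I" by auto
        finally show ?case using compl(2) 0[of "- real n" "real n"] by simp
      next
        case (union A)
        have A: "A i \<in> sets borel" for i
          using union(1,2) unfolding borel_eq_atLeastAtMost by (subst sets_measure_of) auto
        have "(LINT x:(\<Union>i. A i \<inter> ?I)|lborel. f x) = (\<Sum>i. LINT x:(A i \<inter> ?I)|lborel. f x)"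
        proof (rule lebesgue_integral_countable_add)
          show "set_integrable lborel (\<Union>i. A i \<inter> ?I) f"
            by (rule set_integrable_subset[OF f[of "- real n" "real n"]]) (use A in auto)
          show "A i \<inter> ?I \<inter> (A j \<inter> ?I) = {}" if "i \<noteq> j" for i j
            using union(1,2) that by (auto simp: disjoint_family_on_def)
        qed (use A in auto)
        also have "(\<Union>i. A i \<inter> ?I) = (\<Union>i. A i) \<inter> ?I" by auto
        finally show ?case using union(3) by simp
      qed
    qed
    \<comment> \<open>Testing with the sets where \<open>f\<close> is positive and negative makes
      the integral of the absolute value vanish.\<close>
    have "{x. f x > 0} \<in> sets borel" "{x. f x < 0} \<in> sets borel" by measurable
    note z = zero[OF this(1)] zero[OF this(2)] si[OF this(1)] si[OF this(2)]
    have "(LINT x|lborel. \<bar>indicator ?I x * f x\<bar>) =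
          (LINT x:({x. f x > 0} \<inter> ?I)|lborel. f x) - (LINT x:({x. f x < 0} \<inter> ?I)|lborel. f x)"
    proof -
      have "\<bar>indicator ?I x * f x\<bar> = indicator ({x. f x > 0} \<inter> ?I) x *\<^sub>R f x - indicator ({x. f x < 0} \<inter> ?I) x *\<^sub>R f x" for x
        by (auto simp: indicator_def)
      thus ?thesis
        using Bochner_Integration.integral_diff[OF z(3)[unfolded set_integrable_def] z(4)[unfolded set_integrable_def]]
        by (simp add: set_lebesgue_integral_def)
    qed
    hence "(LINT x|lborel. \<bar>indicator ?I x * f x\<bar>) = 0" using z by simp
    moreover have "integrable lborel (\<lambda>x. \<bar>indicator ?I x * f x\<bar>)"
      using f[of "- real n" "real n"] by (auto simp: set_integrable_def)
    ultimately have "AE x in lborel. \<bar>indicator ?I x * f x\<bar> = 0"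
      by (subst (asm) integral_nonneg_eq_0_iff_AE) auto
    thus ?thesis by eventually_elim (auto simp: indicator_def)
  qed
  hence "AE x in lborel. \<forall>n. x \<in> {- real n..real n} \<longrightarrow> f x = 0" by (subst AE_all_countable) blast
  thus ?thesis
  proof eventually_elim
    case (elim x)
    show ?case using elim[rule_format, of "nat \<lceil>\<bar>x\<bar>\<rceil>"] by (simp, linarith)
  qed
qed

lemma zero_AE_of_interval_integrals:
  fixes f :: "real \<Rightarrow> complex"
  assumes f: "\<And>a b. set_integrable lborel {a..b} f" and 0: "\<And>a b. a \<le> b \<Longrightarrow> (LINT x:{a..b}|lborel. f x) = 0"
  shows "AE x in lborel. f x = 0"
proof -
  have *: "(LINT x:{a..b}|lborel. Re (f x)) = Re (LINT x:{a..b}|lborel. f x)"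
     "(LINT x:{a..b}|lborel. Im (f x)) = Im (LINT x:{a..b}|lborel. f x)" for a b
    using integral_Re[OF f[of a b, unfolded set_integrable_def]] integral_Im[OF f[of a b, unfolded set_integrable_def]]
    by (auto simp: set_lebesgue_integral_def)
  have "AE x in lborel. Re (f x) = 0" "AE x in lborel. Im (f x) = 0"
    using integrable_Re[OF f[unfolded set_integrable_def]] integrable_Im[OF f[unfolded set_integrable_def]]
    by (auto intro!: zero_AE_of_interval_integrals_real simp: set_integrable_def * 0)
  thus ?thesis by eventually_elim (simp add: complex_eq_iff)
qed

section \<open>Continuous representatives of Sobolev functions\<close>

lemma L2_set_integrable:
  assumes "f \<in> L2" shows "set_integrable lborel {a..b} f"
proof -
  have [measurable]: "f \<in> borel_measurable borel" using assms by (simp add: L2_def)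
  have "integrable lborel (\<lambda>x. indicator {a..b} x + (cmod (f x))\<^sup>2)"
    using assms by (intro Bochner_Integration.integrable_add integrable_real_indicator) (auto simp: L2_def emeasure_lborel_Icc_eq)
  thus ?thesis unfolding set_integrable_def
  proof (rule Bochner_Integration.integrable_bound)
    have "cmod (f x) \<le> 1 + (cmod (f x))\<^sup>2" for x
      using zero_le_power2[of "cmod (f x) - 1"] zero_le_power2[of "cmod (f x)"]
      unfolding power2_diff by (simp, linarith)
    thus "AE x in lborel. norm (indicator {a..b} x *\<^sub>R f x) \<le> norm (indicator {a..b} x + (cmod (f x))\<^sup>2)"
      by (auto simp: indicator_def)
  qed measurable
qed

text \<open>As \<open>I a b\<close> is 0 for reversed bounds, \<open>I 0 x - I x 0\<close> is the
  signed integral from 0 to x.\<close>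

lemma primitive_exists:
  fixes f :: "real \<Rightarrow> complex"
  assumes f: "\<And>a b. set_integrable lborel {a..b} f"
  obtains F where "primitive F f"
proof
  define I where "I a b = (LINT x:{a..b}|lborel. f x)" for a b
  have add: "I a b + I b c = I a c" if "a \<le> b" "b \<le> c" for a b c
    using that Henstock_Kurzweil_Integration.integral_combine[of a b c f] f
    by (auto simp: I_def set_borel_integral_eq_integral)
  have zero: "I a b = 0" if "a \<ge> b" for a b
    using add[of a a a] that by (cases "a = b") (auto simp: I_def set_lebesgue_integral_def)
  have "I a b = I 0 b - I b 0 - (I 0 a - I a 0)" if "a \<le> b" for a b
    using that add[of a 0 b] add[of 0 a b] add[of a b 0] zero[of b 0] zero[of a 0] zero[of 0 a] zero[of 0 b]
    by (cases "a \<le> 0"; cases "b \<le> 0") (auto simp: algebra_simps)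
  thus "primitive (\<lambda>x. I 0 x - I x 0) f" using f by (auto simp: primitive_def I_def)
qed

lemma integrable_of_set_integrable_support:
  fixes f :: "real \<Rightarrow> 'a :: {banach, second_countable_topology}"
  assumes "set_integrable lborel {a..b} f" "\<And>x. x \<notin> {a..b} \<Longrightarrow> f x = 0"
  shows "integrable lborel f"
proof -
  have "indicator {a..b} x *\<^sub>R f x = f x" for x using assms(2)[of x] by (auto simp: indicator_def)
  thus ?thesis using assms(1) by (simp add: set_integrable_def)
qed

lemma test_functionD:
  assumes "test_function \<phi>"
  shows "\<And>x. (\<phi> has_real_derivative deriv \<phi> x) (at x)" "continuous_on UNIV \<phi>" "continuous_on UNIV (deriv \<phi>)"
    "\<exists>B. \<forall>x. x \<notin> {-B..B} \<longrightarrow> \<phi> x = 0 \<and> deriv \<phi> x = 0"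
proof -
  have "\<phi> differentiable (at x)" for x
    using assms by (auto simp: test_function_def differentiable_on_def)
  thus d: "(\<phi> has_real_derivative deriv \<phi> x) (at x)" for x
    using DERIV_deriv_iff_real_differentiable by blast
  show "continuous_on UNIV \<phi>" using DERIV_isCont[OF d] by (simp add: continuous_at_imp_continuous_on)
  show "continuous_on UNIV (deriv \<phi>)" using assms by (simp add: test_function_def)
  have "bounded (closure {x. \<phi> x \<noteq> 0})" using assms by (auto simp: test_function_def compact_imp_bounded)
  then obtain B where B: "\<And>x. x \<in> closure {x. \<phi> x \<noteq> 0} \<Longrightarrow> \<bar>x\<bar> \<le> B"
    unfolding bounded_iff by auto
  show "\<exists>B. \<forall>x. x \<notin> {-B..B} \<longrightarrow> \<phi> x = 0 \<and> deriv \<phi> x = 0"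
  proof (intro exI allI impI)
    fix x assume "x \<notin> {-B..B}"
    hence x: "x \<in> - {-B..B}" by simp
    have z: "\<phi> y = 0" if "y \<in> - {-B..B}" for y
      using B[of y] closure_subset[of "{x. \<phi> x \<noteq> 0}"] that by force
    have "open (- {-B..B})" by auto
    from has_field_derivative_transform_within_open[OF d this x, of "\<lambda>_. 0"] z
    have "((\<lambda>_. 0) has_real_derivative deriv \<phi> x) (at x)" by auto
    hence "deriv \<phi> x = 0" using DERIV_unique DERIV_const by blast
    with z[OF x] show "\<phi> x = 0 \<and> deriv \<phi> x = 0" by simp
  qed
qed

text \<open>The product of \<open>V\<close> with a test function is absolutely continuous with
  compact support, so its derivative integrates to 0; that is the defining identity of a weak
  derivative.\<close>

lemma primitive_imp_weak_deriv:
  assumes p: "primitive V g"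
  shows "has_weak_deriv V g"
  unfolding has_weak_deriv_def
proof (intro allI impI)
  fix \<phi> assume "test_function \<phi>"
  note t = test_functionD[OF this]
  obtain B where B: "\<And>x. x \<notin> {-B..B} \<Longrightarrow> \<phi> x = 0 \<and> deriv \<phi> x = 0" using t(4) by blast
  have c: "continuous_on UNIV (\<lambda>x. complex_of_real (\<phi> x))" "continuous_on UNIV (\<lambda>x. complex_of_real (deriv \<phi> x))"
    using t(2,3) by (intro continuous_on_of_real; simp)+
  have V: "set_integrable lborel {a..b} V" for a b
    using primitive_continuous[OF p] borel_integrable_atLeastAtMost' continuous_on_subset by blast
  have pphi: "primitive (\<lambda>x. complex_of_real (\<phi> x)) (\<lambda>x. complex_of_real (deriv \<phi> x))"
    by (rule primitive_of_deriv[OF _ c(2)], rule has_vector_derivative_of_real)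
      (use t(1) in \<open>simp add: has_real_derivative_iff_has_vector_derivative\<close>)
  have i1: "integrable lborel (\<lambda>x. \<phi> x *\<^sub>R g x)"
    by (rule integrable_of_set_integrable_support[of "-B" B])
      (use set_integrable_mult_continuous[OF primitive_set_integrable[OF p] c(1)] B in \<open>auto simp: scaleR_conv_of_real mult.commute\<close>)
  have i2: "integrable lborel (\<lambda>x. deriv \<phi> x *\<^sub>R V x)"
    by (rule integrable_of_set_integrable_support[of "-B" B])
      (use set_integrable_mult_continuous[OF V c(2)] B in \<open>auto simp: scaleR_conv_of_real mult.commute\<close>)
  have i3: "integrable lborel (\<lambda>x. \<phi> x *\<^sub>R V x)"
    by (rule integrable_of_set_integrable_support[of "-B" B])
      (use set_integrable_mult_continuous[OF V c(1)] B in \<open>auto simp: scaleR_conv_of_real mult.commute\<close>)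
  have "(LINT x|lborel. deriv \<phi> x *\<^sub>R V x + \<phi> x *\<^sub>R g x) = 0"
    using integral_primitive_eq_0[OF primitive_mult[OF pphi p]] i1 i2 i3
    by (simp add: scaleR_conv_of_real)
  thus "(LINT x|lborel. deriv \<phi> x *\<^sub>R V x) = - (LINT x|lborel. \<phi> x *\<^sub>R g x)"
    using i1 i2 by (simp add: add_eq_0_iff)
qed

section \<open>The du Bois-Reymond lemma\<close>

definition trapezoid :: "real \<Rightarrow> real \<Rightarrow> nat \<Rightarrow> real \<Rightarrow> real" where
  "trapezoid a b n x = max 0 (1 - real n * max 0 (max (a - x) (x - b)))"

lemma trapezoid_continuous: "continuous_on UNIV (trapezoid a b n)"
  unfolding trapezoid_def by (intro continuous_intros)

lemma trapezoid_bounds: "0 \<le> trapezoid a b n x" "trapezoid a b n x \<le> 1"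
  by (auto simp: trapezoid_def)

lemma trapezoid_eq_1: "x \<in> {a..b} \<Longrightarrow> trapezoid a b n x = 1"
  by (auto simp: trapezoid_def)

lemma trapezoid_eq_0:
  assumes "x \<notin> {a-1..b+1}" "n \<ge> 1" shows "trapezoid a b n x = 0"
proof -
  have "1 * 1 \<le> real n * max 0 (max (a - x) (x - b))"
    using assms by (intro mult_mono) auto
  thus ?thesis by (simp add: trapezoid_def)
qed

lemma trapezoid_tendsto: "(\<lambda>n. trapezoid a b n x) \<longlonglongrightarrow> indicator {a..b} x"
proof (cases "x \<in> {a..b}")
  case True thus ?thesis by (simp add: trapezoid_eq_1)
next
  case False
  define d where "d = max 0 (max (a - x) (x - b))"
  have d: "d > 0" using False by (auto simp: d_def)
  have "eventually (\<lambda>n. real n \<ge> 1 / d) sequentially"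
    using eventually_ge_at_top[of "nat \<lceil>1/d\<rceil>"] by eventually_elim linarith
  hence "eventually (\<lambda>n. trapezoid a b n x = indicator {a..b} x) sequentially"
    by eventually_elim (use d False in \<open>auto simp: trapezoid_def d_def[symmetric] field_simps\<close>)
  thus ?thesis by (rule tendsto_eventually)
qed

text \<open>The antiderivative vanishing at -B is 0 to the left of the support of \<psi> and equals
  the full integral of \<psi> to its right, so mean zero is what makes it compactly
  supported.\<close>

lemma test_function_of_mean_zero:
  assumes c: "continuous_on UNIV \<psi>" and B: "\<And>x. x \<notin> {-B..B} \<Longrightarrow> \<psi> x = 0" "0 \<le> B"
    and 0: "(LINT x|lborel. \<psi> x) = 0"
  obtains \<phi> where "test_function \<phi>" "deriv \<phi> = \<psi>"
proof -
  have "\<exists>F. \<forall>x::real. -\<infinity> < ereal x \<longrightarrow> ereal x < \<infinity> \<longrightarrow> (F has_vector_derivative \<psi> x) (at x)"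
    by (rule einterval_antiderivative) (use c in \<open>auto simp: continuous_on_eq_continuous_at\<close>)
  then obtain F where F: "\<And>x. (F has_vector_derivative \<psi> x) (at x)" by auto
  have FTC: "(LINT x:{a..b}|lborel. \<psi> x) = F b - F a" if "a \<le> b" for a b
    unfolding set_lebesgue_integral_def
    by (rule integral_FTC_atLeastAtMost[OF that has_vector_derivative_at_within[OF F] continuous_on_subset[OF c]]) auto
  define \<phi> where "\<phi> x = F x - F (- B)" for x
  have d: "(\<phi> has_real_derivative \<psi> x) (at x)" for x
    unfolding \<phi>_def has_real_derivative_iff_has_vector_derivative
    using has_vector_derivative_diff_const F by fastforce
  hence dphi: "deriv \<phi> = \<psi>" by (intro ext DERIV_imp_deriv)
  have "\<phi> x = 0" if out: "x \<notin> {-B..B}" for x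
  proof -
    have zint: "(LINT y:{x..-B}|lborel. \<psi> y) = 0"
    proof -
      have "AE y in lborel. indicator {x..- B} y *\<^sub>R \<psi> y = 0"
        using AE_lborel_singleton[of "-B"] by eventually_elim (auto simp: indicator_def B)
      thus ?thesis unfolding set_lebesgue_integral_def by (rule integral_eq_zero_AE)
    qed
    consider "x < - B" | "x > B" using out by fastforce
    thus ?thesis
    proof cases
      case 1
      thus ?thesis using FTC[of x "-B"] zint by (simp add: \<phi>_def)
    next
      case 2
      have "(LINT y:{-B..x}|lborel. \<psi> y) = (LINT y|lborel. \<psi> y)"
        unfolding set_lebesgue_integral_def
      proof (rule Bochner_Integration.integral_cong)
        show "indicator {-B..x} y *\<^sub>R \<psi> y = \<psi> y" for y
          using B(1)[of y] 2 by (cases "y \<in> {-B..B}") (auto simp: indicator_def)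
      qed simp
      thus ?thesis using FTC[of "-B" x] 2 B(2) 0 by (simp add: \<phi>_def)
    qed
  qed
  hence "{x. \<phi> x \<noteq> 0} \<subseteq> {-B..B}" by fastforce
  hence "compact (closure {x. \<phi> x \<noteq> 0})"
    by (meson bounded_closed_interval bounded_subset compact_closure)
  moreover have "\<phi> differentiable_on UNIV"
    using d by (auto simp: differentiable_on_def real_differentiable_def)
  ultimately have "test_function \<phi>" using c dphi by (simp add: test_function_def)
  from that[OF this dphi] show ?thesis .
qed

text \<open>Derivatives of test functions have mean zero, so a general cut-off is first corrected by
  a multiple of a fixed bump \<eta>. The correction identifies the constant as the \<eta>-weighted
  average of \<open>d\<close>; continuous cut-offs then approximate indicators of intervals.\<close>

lemma du_Bois_Reymond:
  assumes d: "\<And>a b. set_integrable lborel {a..b} d"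
    and 0: "\<And>\<phi>. test_function \<phi> \<Longrightarrow> (LINT x|lborel. deriv \<phi> x *\<^sub>R d x) = 0"
  obtains c :: complex where "AE x in lborel. d x = c"
proof -
  have int: "integrable lborel (\<lambda>x. \<psi> x *\<^sub>R p x)" 
    if "continuous_on UNIV \<psi>" "\<And>x. x \<notin> {-B..B} \<Longrightarrow> \<psi> x = 0" "\<And>a b. set_integrable lborel {a..b} p"
    for \<psi> and B :: real and p :: "real \<Rightarrow> complex"
  proof (rule integrable_of_set_integrable_support[of "-B" B])
    have "continuous_on UNIV (\<lambda>x. complex_of_real (\<psi> x))" using that by (intro continuous_intros)
    from set_integrable_mult_continuous[OF that(3) this]
    show "set_integrable lborel {-B..B} (\<lambda>x. \<psi> x *\<^sub>R p x)" by (simp add: scaleR_conv_of_real mult.commute)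
  qed (use that in auto)
  have intr: "integrable lborel \<psi>" if "continuous_on UNIV \<psi>" "\<And>x. x \<notin> {-B..B} \<Longrightarrow> \<psi> x = 0" for \<psi> :: "real \<Rightarrow> real" and B :: real
    by (rule integrable_of_set_integrable_support[of "-B" B])
      (use that borel_integrable_atLeastAtMost' continuous_on_subset in blast)+
  define \<eta> where "\<eta> = trapezoid 0 1 1"
  have \<eta>: "continuous_on UNIV \<eta>" "\<And>x. x \<notin> {-2..2} \<Longrightarrow> \<eta> x = 0"
    unfolding \<eta>_def by (auto intro!: trapezoid_continuous trapezoid_eq_0)
  define J where "J = (LINT x|lborel. \<eta> x)"
  have "(LINT x|lborel. indicator {0..1::real} x) \<le> J"
    unfolding J_def using intr[of \<eta> 2] \<eta>
    by (intro integral_mono integrable_real_indicator)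
      (auto simp: indicator_def \<eta>_def trapezoid_eq_1 trapezoid_bounds emeasure_lborel_Icc_eq)
  hence J: "J \<ge> 1" by simp
  define c where "c = (LINT x|lborel. \<eta> x *\<^sub>R d x) /\<^sub>R J"
  have key: "(LINT x|lborel. \<psi> x *\<^sub>R (d x - c)) = 0"
    if \<psi>: "continuous_on UNIV \<psi>" "\<And>x. x \<notin> {-B..B} \<Longrightarrow> \<psi> x = 0" "B \<ge> 2" for \<psi> and B :: real
  proof -
    define m where "m = (LINT x|lborel. \<psi> x) / J"
    define \<theta> where "\<theta> x = \<psi> x - m * \<eta> x" for x
    have \<eta>B: "\<And>x. x \<notin> {-B..B} \<Longrightarrow> \<eta> x = 0" using \<eta>(2) \<psi>(3) by auto
    have \<theta>c: "continuous_on UNIV \<theta>" unfolding \<theta>_def[abs_def] by (intro continuous_intros \<psi> \<eta>)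
    have \<theta>B: "\<And>x. x \<notin> {-B..B} \<Longrightarrow> \<theta> x = 0" using \<eta>B \<psi> by (auto simp: \<theta>_def)
    have "(LINT x|lborel. \<theta> x) = 0"
      unfolding \<theta>_def using intr[OF \<psi>(1,2)] intr[OF \<eta>] J by (simp add: m_def J_def)
    then obtain \<phi> where "test_function \<phi>" "deriv \<phi> = \<theta>"
      using test_function_of_mean_zero[OF \<theta>c \<theta>B] \<psi>(3) by (metis order_trans zero_le_numeral)
    hence "(LINT x|lborel. \<theta> x *\<^sub>R d x) = 0" using 0 by metis
    hence "(LINT x|lborel. \<psi> x *\<^sub>R d x) = m *\<^sub>R (LINT x|lborel. \<eta> x *\<^sub>R d x)"
      using int[OF \<psi>(1,2) d] int[OF \<eta> d] by (simp add: \<theta>_def scaleR_left_diff_distrib flip: scaleR_scaleR)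
    also have "\<dots> = (LINT x|lborel. \<psi> x) *\<^sub>R c" using J by (simp add: m_def c_def divide_inverse)
    finally show ?thesis
      using int[OF \<psi>(1,2) d] intr[OF \<psi>(1,2)] by (simp add: scaleR_right_diff_distrib)
  qed
  have dc: "set_integrable lborel {a..b} (\<lambda>x. d x - c)" for a b
    by (intro set_integral_diff d primitive_set_integrable[OF primitive_of_deriv[of "\<lambda>x. x *\<^sub>R c"]])
      (auto intro!: derivative_eq_intros)
  have "AE x in lborel. d x - c = 0"
  proof (rule zero_AE_of_interval_integrals[OF dc])
    fix a b :: real assume "a \<le> b"
    have [measurable]: "(\<lambda>x. d x - c) \<in> borel_measurable borel"
       "trapezoid a b n \<in> borel_measurable borel" for n
      by (rule measurable_of_locally_integrable[OF dc], rule borel_measurable_continuous_onI[OF trapezoid_continuous])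
    \<comment> \<open>The slopes start at 1: \<open>trapezoid a b 0\<close> is constantly 1, hence
      not compactly supported.\<close>
    have "(\<lambda>n. LINT x|lborel. trapezoid a b (Suc n) x *\<^sub>R (d x - c)) \<longlonglongrightarrow> (LINT x|lborel. indicator {a..b} x *\<^sub>R (d x - c))"
    proof (rule integral_dominated_convergence)
      show "integrable lborel (\<lambda>x. norm (indicator {a-1..b+1} x *\<^sub>R (d x - c)))"
        using dc[of "a-1" "b+1"] unfolding set_integrable_def by (rule integrable_norm)
      show "AE x in lborel. norm (trapezoid a b (Suc n) x *\<^sub>R (d x - c)) \<le> norm (indicator {a-1..b+1} x *\<^sub>R (d x - c))" for n
      proof (rule AE_I2)
        fix x :: real
        have "\<bar>trapezoid a b (Suc n) x\<bar> \<le> \<bar>indicator {a-1..b+1} x\<bar>"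
          using trapezoid_eq_0[of x a b "Suc n"] trapezoid_bounds[of a b "Suc n" x] by (auto simp: indicator_def)
        thus "norm (trapezoid a b (Suc n) x *\<^sub>R (d x - c)) \<le> norm (indicator {a-1..b+1} x *\<^sub>R (d x - c))"
          unfolding norm_scaleR by (intro mult_right_mono) auto
      qed
      show "AE x in lborel. (\<lambda>n. trapezoid a b (Suc n) x *\<^sub>R (d x - c)) \<longlonglongrightarrow> indicator {a..b} x *\<^sub>R (d x - c)"
        by (intro AE_I2 tendsto_intros LIMSEQ_Suc trapezoid_tendsto)
    qed measurable
    \<comment> \<open>The radius is at least 2, as \<open>key\<close> demands, and covers the
      interval [a - 1, b + 1].\<close>
    moreover have "(LINT x|lborel. trapezoid a b (Suc n) x *\<^sub>R (d x - c)) = 0" for n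
      by (rule key[of _ "2 + \<bar>a\<bar> + \<bar>b\<bar>"]) (auto intro!: trapezoid_continuous trapezoid_eq_0)
    ultimately show "(LINT x:{a..b}|lborel. d x - c) = 0"
      by (simp add: set_lebesgue_integral_def LIMSEQ_const_iff)
  qed
  thus ?thesis by (intro that[of c]) simp
qed

text \<open>An antiderivative \<open>G\<close> of \<open>g\<close> has the same weak derivative as
  \<open>u\<close>, so the two differ by a constant almost everywhere; a shift of \<open>G\<close>
  is the representative.\<close>

lemma primitive_of_weak_deriv:
  assumes u: "u \<in> L2" and g: "g \<in> L2" and w: "has_weak_deriv u g"
  obtains V where "primitive V g" "AE x in lborel. u x = V x"
proof -
  obtain G where G: "primitive G g" using primitive_exists[OF L2_set_integrable[OF g]] by blast
  have Gi: "set_integrable lborel {a..b} G" for a b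
    using primitive_continuous[OF G] borel_integrable_atLeastAtMost' continuous_on_subset by blast
  have "(LINT x|lborel. deriv \<phi> x *\<^sub>R (u x - G x)) = 0" if t: "test_function \<phi>" for \<phi>
  proof -
    note t' = test_functionD[OF t]
    obtain B where B: "\<And>x. x \<notin> {-B..B} \<Longrightarrow> \<phi> x = 0 \<and> deriv \<phi> x = 0" using t'(4) by blast
    have c: "continuous_on UNIV (\<lambda>x. complex_of_real (deriv \<phi> x))"
      using t'(3) by (intro continuous_on_of_real)
    have i: "integrable lborel (\<lambda>x. deriv \<phi> x *\<^sub>R p x)" if "\<And>a b. set_integrable lborel {a..b} p" for p :: "real \<Rightarrow> complex"
      by (rule integrable_of_set_integrable_support[of "-B" B])
        (use set_integrable_mult_continuous[OF that c] B in \<open>auto simp: scaleR_conv_of_real mult.commute\<close>)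
    show ?thesis
      using w t primitive_imp_weak_deriv[OF G] i[OF Gi] i[OF L2_set_integrable[OF u]]
      by (simp add: has_weak_deriv_def scaleR_right_diff_distrib)
  qed
  moreover have "set_integrable lborel {a..b} (\<lambda>x. u x - G x)" for a b
    by (intro set_integral_diff L2_set_integrable u Gi)
  ultimately obtain c where "AE x in lborel. u x - G x = c"
    using du_Bois_Reymond[of "\<lambda>x. u x - G x"] by blast
  moreover have "primitive (\<lambda>x. G x + c) g"
    using primitive_add[OF G primitive_const[of c]] by simp
  ultimately show ?thesis by (intro that[of "\<lambda>x. G x + c"]) (auto simp: algebra_simps)
qed

text \<open>The coincidence set is closed, and a closed set of full Lebesgue measure is the whole
  line.\<close>

lemma AE_eq_continuous:
  fixes f g :: "real \<Rightarrow> complex"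
  assumes "continuous_on UNIV f" "continuous_on UNIV g" "AE x in lborel. f x = g x"
  shows "f = g"
proof
  fix x
  have "closed {x. f x = g x}" using assms by (intro closed_Collect_eq)
  from mem_closed_if_AE_lebesgue[OF this, of x] assms(3) show "f x = g x"
    by (simp add: AE_completion)
qed

lemma H1D:
  assumes "u \<in> H1"
  shows "u \<in> L2" "weak_deriv u \<in> L2" "has_weak_deriv u (weak_deriv u)"
  using assms someI_ex[of "\<lambda>g. g \<in> L2 \<and> has_weak_deriv u g"]
  unfolding H1_def weak_deriv_def by auto

lemma L2_cong_AE:
  assumes "u \<in> L2" "AE x in lborel. u x = v x" "v \<in> borel_measurable borel" shows "v \<in> L2"
proof -
  have [measurable]: "u \<in> borel_measurable borel" "v \<in> borel_measurable borel" using assms by (auto simp: L2_def)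
  have "integrable lborel (\<lambda>x. (cmod (u x))\<^sup>2) \<longleftrightarrow> integrable lborel (\<lambda>x. (cmod (v x))\<^sup>2)"
    by (intro integrable_cong_AE) (use assms(2) in auto)
  thus ?thesis using assms by (simp add: L2_def)
qed

lemma H1_representative:
  assumes "u \<in> H1"
  obtains V where "primitive V (weak_deriv u)" "AE x in lborel. u x = V x" "V \<in> L2"
proof -
  obtain V where V: "primitive V (weak_deriv u)" "AE x in lborel. u x = V x"
    using primitive_of_weak_deriv[OF H1D[OF assms]] .
  with L2_cong_AE[OF H1D(1)[OF assms] V(2) primitive_measurable[OF V(1)]] that show ?thesis by blast
qed

text \<open>Because \<open>weak_deriv\<close> is a choice, any explicit derivative has to be
  identified with it almost everywhere. The two continuous representatives of \<open>u\<close> agree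
  everywhere, so both derivatives have the same interval integrals. This is applied to the perturbed
  soliton at each value of the ray parameter.\<close>

lemma weak_deriv_AE_eq:
  assumes p: "primitive V g" and V: "V \<in> L2" and g: "g \<in> L2"
    and [measurable]: "u \<in> borel_measurable borel" and uV: "AE x in lborel. u x = V x"
  shows "u \<in> H1" "AE x in lborel. weak_deriv u x = g x"
proof -
  have [measurable]: "V \<in> borel_measurable borel" using V by (simp add: L2_def)
  have u: "u \<in> L2" by (rule L2_cong_AE[OF V]) (use uV in auto)
  have "(LINT x|lborel. deriv \<phi> x *\<^sub>R u x) = (LINT x|lborel. deriv \<phi> x *\<^sub>R V x)" if "test_function \<phi>" for \<phi>
  proof -
    have [measurable]: "deriv \<phi> \<in> borel_measurable borel"
      using test_functionD[OF that] by (intro borel_measurable_continuous_onI)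
    show ?thesis by (intro integral_cong_AE) (use uV in auto)
  qed
  hence "has_weak_deriv u g" using primitive_imp_weak_deriv[OF p] by (simp add: has_weak_deriv_def)
  thus "u \<in> H1" using u g by (auto simp: H1_def)
  then obtain W where W: "primitive W (weak_deriv u)" "AE x in lborel. u x = W x"
    using H1_representative by blast
  have "AE x in lborel. V x = W x" using uV W(2) by eventually_elim simp
  hence "V = W" by (intro AE_eq_continuous primitive_continuous[OF p] primitive_continuous[OF W(1)])
  hence "primitive (\<lambda>x. 0) (\<lambda>x. weak_deriv u x - g x)"
    using primitive_diff[OF W(1) p] by simp
  hence "AE x in lborel. weak_deriv u x - g x = 0"
    by (intro zero_AE_of_interval_integrals primitive_set_integrable) (auto simp: primitive_def)
  thus "AE x in lborel. weak_deriv u x = g x" by simp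
qed

section \<open>Square-integrable functions\<close>

lemma borel_measurable_cnj [measurable]:
  fixes f :: "'a \<Rightarrow> complex"
  assumes "f \<in> borel_measurable M" shows "(\<lambda>x. cnj (f x)) \<in> borel_measurable M"
  by (rule borel_measurable_continuous_on[OF _ assms]) (intro continuous_intros)

definition L2sq :: "(real \<Rightarrow> complex) \<Rightarrow> real" where
  "L2sq f = (LINT x|lborel. (cmod (f x))\<^sup>2)"

lemma L2sq_nonneg: "0 \<le> L2sq f"
  unfolding L2sq_def by simp

lemma L2D: "f \<in> L2 \<Longrightarrow> f \<in> borel_measurable borel" "f \<in> L2 \<Longrightarrow> integrable lborel (\<lambda>x. (cmod (f x))\<^sup>2)"
  by (auto simp: L2_def)

lemma L2_dominated:
  assumes f: "f \<in> L2" and [measurable]: "g \<in> borel_measurable borel" and "\<And>x. cmod (g x) \<le> K * cmod (f x)"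
  shows "g \<in> L2" "L2sq g \<le> K\<^sup>2 * L2sq f"
proof -
  have le: "(cmod (g x))\<^sup>2 \<le> K\<^sup>2 * (cmod (f x))\<^sup>2" for x
    using power_mono[OF assms(3) norm_ge_zero, of x 2] by (simp add: power_mult_distrib)
  have i: "integrable lborel (\<lambda>x. K\<^sup>2 * (cmod (f x))\<^sup>2)" using L2D(2)[OF f] by simp
  have "integrable lborel (\<lambda>x. (cmod (g x))\<^sup>2)"
    by (rule Bochner_Integration.integrable_bound[OF i]) (use le in auto)
  thus g: "g \<in> L2" by (simp add: L2_def)
  have "L2sq g \<le> (LINT x|lborel. K\<^sup>2 * (cmod (f x))\<^sup>2)"
    unfolding L2sq_def using le i L2D(2)[OF g] by (intro integral_mono) auto
  thus "L2sq g \<le> K\<^sup>2 * L2sq f" by (simp add: L2sq_def)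
qed

lemma L2_add:
  assumes f: "f \<in> L2" and g: "g \<in> L2"
  shows "(\<lambda>x. f x + g x) \<in> L2" "L2sq (\<lambda>x. f x + g x) \<le> 2 * L2sq f + 2 * L2sq g"
proof -
  have [measurable]: "f \<in> borel_measurable borel" "g \<in> borel_measurable borel" using f g by (auto simp: L2D)
  have le: "(cmod (f x + g x))\<^sup>2 \<le> 2 * (cmod (f x))\<^sup>2 + 2 * (cmod (g x))\<^sup>2" for x
  proof -
    have "(cmod (f x + g x))\<^sup>2 \<le> (cmod (f x) + cmod (g x))\<^sup>2" by (intro power_mono norm_triangle_ineq) auto
    also have "\<dots> \<le> 2 * (cmod (f x))\<^sup>2 + 2 * (cmod (g x))\<^sup>2"
      using zero_le_power2[of "cmod (f x) - cmod (g x)"] by (simp add: power2_eq_square algebra_simps)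
    finally show ?thesis .
  qed
  have i: "integrable lborel (\<lambda>x. 2 * (cmod (f x))\<^sup>2 + 2 * (cmod (g x))\<^sup>2)"
    using L2D(2)[OF f] L2D(2)[OF g] by simp
  have j: "integrable lborel (\<lambda>x. (cmod (f x + g x))\<^sup>2)"
    by (rule Bochner_Integration.integrable_bound[OF i]) (use le in auto)
  thus fg: "(\<lambda>x. f x + g x) \<in> L2" by (simp add: L2_def)
  show "L2sq (\<lambda>x. f x + g x) \<le> 2 * L2sq f + 2 * L2sq g"
    unfolding L2sq_def using integral_mono[OF j i le] L2D(2)[OF f] L2D(2)[OF g] by simp
qed

lemma L2_cmult: "f \<in> L2 \<Longrightarrow> (\<lambda>x. c * f x) \<in> L2"
  by (rule L2_dominated(1)[where K="cmod c" and f=f]) (auto simp: norm_mult dest: L2D(1) intro!: borel_measurable_times)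

lemma L2_diff: "f \<in> L2 \<Longrightarrow> g \<in> L2 \<Longrightarrow> (\<lambda>x. f x - g x) \<in> L2"
  using L2_add(1)[of f "\<lambda>x. - 1 * g x"] L2_cmult[of g "-1"] by simp

lemma L2_cnj: "f \<in> L2 \<Longrightarrow> (\<lambda>x. cnj (f x)) \<in> L2"
  by (rule L2_dominated(1)[where K=1 and f=f])
    (auto dest!: L2D(1) intro!: borel_measurable_continuous_on[where f=cnj] continuous_intros)

lemma L2_mult_integrable:
  assumes f: "f \<in> L2" and g: "g \<in> L2" shows "integrable lborel (\<lambda>x. f x * g x)"
proof -
  have [measurable]: "f \<in> borel_measurable borel" "g \<in> borel_measurable borel" using f g by (auto simp: L2D)
  have i: "integrable lborel (\<lambda>x. (cmod (f x))\<^sup>2 + (cmod (g x))\<^sup>2)"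
    using L2D(2)[OF f] L2D(2)[OF g] by simp
  show ?thesis
  proof (rule Bochner_Integration.integrable_bound[OF i])
    have "cmod (f x * g x) \<le> (cmod (f x))\<^sup>2 + (cmod (g x))\<^sup>2" for x
      using zero_le_power2[of "cmod (f x) - cmod (g x)"] zero_le_power2[of "cmod (f x)"] zero_le_power2[of "cmod (g x)"]
      unfolding power2_diff norm_mult by linarith
    thus "AE x in lborel. norm (f x * g x) \<le> norm ((cmod (f x))\<^sup>2 + (cmod (g x))\<^sup>2)" by auto
  qed measurable
qed

lemma L2_Cauchy_Schwarz:
  assumes f: "f \<in> L2" and g: "g \<in> L2"
  shows "(LINT x|lborel. cmod (f x) * cmod (g x))\<^sup>2 \<le> L2sq f * L2sq g"
proof -
  define a b c where "a = L2sq f" and "b = L2sq g" and "c = (LINT x|lborel. cmod (f x) * cmod (g x))"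
  have i: "integrable lborel (\<lambda>x. cmod (f x) * cmod (g x))"
    using integrable_norm[OF L2_mult_integrable[OF f g]] by (simp add: norm_mult)
  have ab: "a \<ge> 0" "b \<ge> 0" by (auto simp: a_def b_def L2sq_nonneg)
  have q: "0 \<le> a - 2 * t * c + t\<^sup>2 * b" for t
  proof -
    have "0 \<le> (LINT x|lborel. (cmod (f x) - t * cmod (g x))\<^sup>2)" by simp
    also have "\<dots> = (LINT x|lborel. (cmod (f x))\<^sup>2 - 2 * t * (cmod (f x) * cmod (g x)) + t\<^sup>2 * (cmod (g x))\<^sup>2)"
      by (intro Bochner_Integration.integral_cong) (auto simp: power2_eq_square algebra_simps)
    also have "\<dots> = a - 2 * t * c + t\<^sup>2 * b"
      using i L2D(2)[OF f] L2D(2)[OF g] by (simp add: a_def b_def c_def L2sq_def)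
    finally show ?thesis .
  qed
  have "c\<^sup>2 \<le> a * b"
  proof (cases "b = 0")
    case True
    have "c = 0"
    proof (rule ccontr)
      assume "c \<noteq> 0"
      \<comment> \<open>For b = 0 the quadratic is affine in t, and this t gives it the value
        -1.\<close>
      with q[of "(a + 1) / (2 * c)"] True show False by simp
    qed
    thus ?thesis using ab by simp
  next
    case False
    hence "b > 0" using ab by simp
    with q[of "c / b"] show ?thesis by (simp add: field_simps power2_eq_square)
  qed
  thus ?thesis by (simp add: a_def b_def c_def)
qed

section \<open>Sobolev pairs and bounded multipliers\<close>

definition sobolev :: "(real \<Rightarrow> complex) \<Rightarrow> (real \<Rightarrow> complex) \<Rightarrow> bool" where
  "sobolev F f \<longleftrightarrow> primitive F f \<and> F \<in> L2 \<and> f \<in> L2"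

text \<open>Factors that map Sobolev pairs to Sobolev pairs; \<open>s\<close>, \<rho>, the phase
  \<open>E\<close> and its conjugate are of this kind. As in \<open>sobolev\<close>, the derivative
  is an explicit argument, which keeps chosen representatives out of the calculations.\<close>

definition multiplier :: "(real \<Rightarrow> complex) \<Rightarrow> (real \<Rightarrow> complex) \<Rightarrow> bool" where
  "multiplier B b \<longleftrightarrow> primitive B b \<and> bounded (range B) \<and> bounded (range b)"

lemma L2_bounded_mult:
  assumes f: "f \<in> L2" and [measurable]: "B \<in> borel_measurable borel" and b: "bounded (range B)"
  shows "(\<lambda>x. B x * f x) \<in> L2"
proof -
  have [measurable]: "f \<in> borel_measurable borel" using f by (auto simp: L2D)
  obtain K where "\<And>x. cmod (B x) \<le> K" using b by (auto simp: bounded_iff)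
  thus ?thesis
    by (intro L2_dominated(1)[OF f, of _ K]) (auto simp: norm_mult intro!: mult_right_mono)
qed

lemma sobolev_mult:
  assumes B: "multiplier B b" and F: "sobolev F f"
  shows "sobolev (\<lambda>x. B x * F x) (\<lambda>x. b x * F x + B x * f x)"
proof -
  have "primitive B b" using B by (simp add: multiplier_def)
  note [measurable] = primitive_measurable[OF this] primitive_measurable'[OF this]
  show ?thesis
    using assms unfolding sobolev_def multiplier_def
    by (auto intro!: primitive_mult L2_add L2_bounded_mult)
qed

lemma sobolev_add: "sobolev F f \<Longrightarrow> sobolev G g \<Longrightarrow> sobolev (\<lambda>x. F x + G x) (\<lambda>x. f x + g x)"
  by (auto simp: sobolev_def intro!: primitive_add L2_add)

lemma sobolev_diff: "sobolev F f \<Longrightarrow> sobolev G g \<Longrightarrow> sobolev (\<lambda>x. F x - G x) (\<lambda>x. f x - g x)"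
  by (auto simp: sobolev_def intro!: primitive_diff L2_diff)

lemma sobolev_cmult: "sobolev F f \<Longrightarrow> sobolev (\<lambda>x. c * F x) (\<lambda>x. c * f x)"
  by (auto simp: sobolev_def intro!: primitive_cmult L2_cmult)

lemma sobolev_cnj: "sobolev F f \<Longrightarrow> sobolev (\<lambda>x. cnj (F x)) (\<lambda>x. cnj (f x))"
  by (auto simp: sobolev_def intro!: primitive_cnj L2_cnj)

lemma sobolev_product:
  assumes F: "sobolev F f" and G: "sobolev G g"
  shows "primitive (\<lambda>x. F x * G x) (\<lambda>x. f x * G x + F x * g x)"
    "integrable lborel (\<lambda>x. F x * G x)" "integrable lborel (\<lambda>x. f x * G x + F x * g x)"
  using assms unfolding sobolev_def
  by (auto intro!: primitive_mult L2_mult_integrable Bochner_Integration.integrable_add)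

lemma sobolev_integral_0:
  assumes F: "sobolev F f" and G: "sobolev G g"
  shows "(LINT x|lborel. f x * G x + F x * g x) = 0"
  using sobolev_product[OF assms] by (rule integral_primitive_eq_0)

text \<open>The squared modulus has the integrable derivative \<open>g\<close>, so it varies by at
  most the L1 norm of \<open>g\<close>. Boundedness is what later makes the quartic and sextic terms
  of the density integrable.\<close>

lemma sobolev_bounded:
  assumes F: "sobolev F f" shows "bounded (range F)"
proof -
  define g where "g x = f x * cnj (F x) + F x * cnj (f x)" for x
  note p = sobolev_product[OF F sobolev_cnj[OF F], folded g_def]
  define I where "I = (LINT x|lborel. norm (g x))"
  have "(cmod (F x))\<^sup>2 \<le> (cmod (F 0))\<^sup>2 + I" for x
  proof -
    have *: "cmod (F b * cnj (F b) - F a * cnj (F a)) \<le> I" if "a \<le> b" for a b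
    proof -
      have "F b * cnj (F b) - F a * cnj (F a) = (LINT x|lborel. indicator {a..b} x *\<^sub>R g x)"
        using primitive_eq[OF p(1) that] by (simp add: set_lebesgue_integral_def)
      also have "norm \<dots> \<le> (LINT x|lborel. norm (indicator {a..b} x *\<^sub>R g x))" by (rule integral_norm_bound)
      also have "\<dots> \<le> I" unfolding I_def
        using primitive_set_integrable[OF p(1), of a b] p(3)
        by (intro integral_mono integrable_norm) (auto simp: set_integrable_def indicator_def)
      finally show ?thesis .
    qed
    have e: "F y * cnj (F y) = of_real ((cmod (F y))\<^sup>2)" for y by (rule complex_norm_square[symmetric])
    have "\<bar>(cmod (F x))\<^sup>2 - (cmod (F 0))\<^sup>2\<bar> \<le> I"
    proof (cases "x \<ge> 0")
      case True
      from *[OF this] show ?thesis unfolding e of_real_diff[symmetric] norm_of_real .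
    next
      case False
      hence "x \<le> 0" by simp
      from *[OF this] show ?thesis unfolding e of_real_diff[symmetric] norm_of_real by linarith
    qed
    thus ?thesis by linarith
  qed
  hence "cmod (F x) \<le> sqrt ((cmod (F 0))\<^sup>2 + I)" for x by (intro real_le_rsqrt)
  thus ?thesis by (auto simp: bounded_iff)
qed

lemma multiplierI:
  assumes "\<And>x. (B has_vector_derivative b x) (at x)" "continuous_on UNIV b"
    "\<And>x. cmod (B x) \<le> K" "\<And>x. cmod (b x) \<le> K'"
  shows "multiplier B b"
  using assms by (auto simp: multiplier_def bounded_iff intro!: primitive_of_deriv)

section \<open>The soliton in polar form\<close>

locale soliton =
  fixes \<omega> :: real
  assumes \<omega>: "-1 < \<omega>" "\<omega> < 1"
begin

text \<open>If \<open>\<theta>\<close> is the argument of \<open>U\<close>, then \<open>\<rho> = \<bar>U\<bar>\<^sup>2 = - \<theta>'\<close>, \<open>s = sin 2\<theta>\<close> and \<open>\<omega> + \<rho> = cos 2\<theta>\<close>.\<close>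
definition m :: real where "m = sqrt (1 - \<omega>\<^sup>2)"
text \<open>The squared modulus of the denominator of \<open>U\<close>, namely (1 + \<omega>) cosh^2
  + (1 - \<omega>) sinh^2 at m x, rewritten with cosh^2 - sinh^2 = 1.\<close>

definition den :: "real \<Rightarrow> real" where "den x = \<omega> + (cosh (m * x))\<^sup>2 + (sinh (m * x))\<^sup>2"
definition \<rho> :: "real \<Rightarrow> real" where "\<rho> x = m\<^sup>2 / den x"
definition s :: "real \<Rightarrow> real" where "s x = - 2 * m * sinh (m * x) * cosh (m * x) / den x"
definition r :: "real \<Rightarrow> real" where "r x = sqrt (\<rho> x)"
definition U_re :: "real \<Rightarrow> real" where "U_re x = m * sqrt (1 + \<omega>) * cosh (m * x) / den x"
definition U_im :: "real \<Rightarrow> real" where "U_im x = - m * sqrt (1 - \<omega>) * sinh (m * x) / den x"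

lemma m_sq: "m\<^sup>2 = 1 - \<omega>\<^sup>2" and m_pos: "m > 0"
proof -
  have "\<omega>\<^sup>2 < 1" using \<omega> by (simp add: abs_square_less_1)
  thus "m\<^sup>2 = 1 - \<omega>\<^sup>2" "m > 0" by (auto simp: m_def)
qed

lemma m_eq: "m = sqrt (1 + \<omega>) * sqrt (1 - \<omega>)"
  by (simp add: m_def real_sqrt_mult[symmetric] power2_eq_square algebra_simps)

lemma den_eq: "den x = 1 + \<omega> + 2 * (sinh (m * x))\<^sup>2" "den x = \<omega> - 1 + 2 * (cosh (m * x))\<^sup>2"
  by (auto simp: den_def cosh_square_eq)

lemma den_pos: "den x > 0"
  using \<omega> den_eq(1)[of x] zero_le_power2[of "sinh (m*x)"] by linarith

lemma \<rho>_pos: "\<rho> x > 0" using den_pos m_pos by (simp add: \<rho>_def)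

lemma r_pos: "r x > 0" and r_sq: "(r x)\<^sup>2 = \<rho> x"
  using \<rho>_pos[of x] by (auto simp: r_def)

lemma \<rho>_le: "\<rho> x \<le> 1 - \<omega>"
proof -
  have "(1 - \<omega>) * (1 + \<omega>) \<le> (1 - \<omega>) * den x"
    using \<omega> den_eq(1)[of x] zero_le_power2[of "sinh (m*x)"] by (intro mult_left_mono) auto
  thus ?thesis using den_pos[of x] m_sq by (simp add: \<rho>_def field_simps power2_eq_square)
qed

lemma \<rho>_le_2: "\<rho> x \<le> 2" using \<rho>_le[of x] \<omega> by linarith

text \<open>The Pythagorean identity for the doubled argument of \<open>U\<close>. Checking it on
  the hyperbolic expressions avoids constructing an argument function.\<close>

lemma s_c: "(s x)\<^sup>2 + (\<omega> + \<rho> x)\<^sup>2 = 1"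
proof -
  define S where "S = (sinh (m * x))\<^sup>2"
  have d: "den x = 1 + \<omega> + 2 * S" "den x \<noteq> 0" using den_pos[of x] by (auto simp: den_eq S_def)
  have "(s x)\<^sup>2 = 4 * m\<^sup>2 * S * (1 + S) / (den x)\<^sup>2"
    by (simp add: s_def power_divide power_mult_distrib S_def cosh_square_eq algebra_simps)
  moreover have "(\<omega> + \<rho> x)\<^sup>2 = (\<omega> * den x + m\<^sup>2)\<^sup>2 / (den x)\<^sup>2"
    using d(2) by (simp add: \<rho>_def field_simps power2_eq_square)
  moreover have "4 * m\<^sup>2 * S * (1 + S) + (\<omega> * den x + m\<^sup>2)\<^sup>2 = (den x)\<^sup>2"
    unfolding d(1) m_sq by algebra
  ultimately show ?thesis using d(2) by (simp add: add_divide_distrib[symmetric])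
qed

lemma s_abs_le: "\<bar>s x\<bar> \<le> 1" and c_abs_le: "\<bar>\<omega> + \<rho> x\<bar> \<le> 1"
proof -
  have "(s x)\<^sup>2 \<le> 1" "(\<omega> + \<rho> x)\<^sup>2 \<le> 1"
    using s_c[of x] zero_le_power2[of "s x"] zero_le_power2[of "\<omega> + \<rho> x"] by linarith+
  thus "\<bar>s x\<bar> \<le> 1" "\<bar>\<omega> + \<rho> x\<bar> \<le> 1" by (auto simp: abs_square_le_1)
qed

lemma s_nonpos: "x \<ge> 0 \<Longrightarrow> s x \<le> 0" and s_nonneg: "x \<le> 0 \<Longrightarrow> s x \<ge> 0"
proof -
  define k where "k = 2 * m * cosh (m * x) / den x"
  have "s x = - k * sinh (m * x)" by (simp add: s_def k_def)
  moreover have "k > 0"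
    unfolding k_def using m_pos den_pos[of x] cosh_real_pos[of "m*x"] by (intro divide_pos_pos mult_pos_pos) auto
  moreover have "x \<ge> 0 \<Longrightarrow> sinh (m * x) \<ge> 0" "x \<le> 0 \<Longrightarrow> sinh (m * x) \<le> 0"
    using m_pos by (auto simp: mult_nonneg_nonpos)
  ultimately show "x \<ge> 0 \<Longrightarrow> s x \<le> 0" "x \<le> 0 \<Longrightarrow> s x \<ge> 0"
    by (auto simp: mult_le_0_iff zero_le_mult_iff)
qed

lemma den_deriv: "(den has_real_derivative 4 * m * sinh (m * x) * cosh (m * x)) (at x)"
  unfolding den_def[abs_def] by (auto intro!: derivative_eq_intros)

lemma \<rho>_deriv: "(\<rho> has_real_derivative 2 * s x * \<rho> x) (at x)"
  unfolding \<rho>_def[abs_def] s_def using den_pos[of x]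
  by (auto intro!: derivative_eq_intros den_deriv simp: field_simps power2_eq_square)

lemma r_deriv: "(r has_real_derivative s x * r x) (at x)"
proof -
  have "(r has_real_derivative (2 * s x * \<rho> x) * (inverse (sqrt (\<rho> x)) / 2)) (at x)"
    unfolding r_def[abs_def] using \<rho>_deriv \<rho>_pos[of x]
    by (auto intro!: derivative_eq_intros simp: field_simps)
  also have "(2 * s x * \<rho> x) * (inverse (sqrt (\<rho> x)) / 2) = s x * r x"
    using r_pos[of x] r_sq[of x] by (simp add: r_def[symmetric] field_simps power2_eq_square)
  finally show ?thesis .
qed

text \<open>In terms of the argument: (sin 2\<theta>)' = 2 \<theta>' cos 2\<theta> with \<theta>' =
  -\<rho>.\<close>

lemma s_deriv: "(s has_real_derivative - 2 * (\<omega> + \<rho> x) * \<rho> x) (at x)"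
proof -
  define S C where "S = sinh (m * x)" and "C = cosh (m * x)"
  have CS: "C\<^sup>2 = 1 + S\<^sup>2" by (simp add: S_def C_def cosh_square_eq)
  have d: "den x = 1 + \<omega> + 2 * S\<^sup>2" "den x \<noteq> 0" using den_pos[of x] by (auto simp: den_eq S_def)
  have "(s has_real_derivative (- 2 * m * (m * C\<^sup>2 + m * S\<^sup>2) * den x + 2 * m * S * C * (4 * m * S * C)) / (den x)\<^sup>2) (at x)"
    unfolding s_def[abs_def] using d(2)
    by (auto intro!: derivative_eq_intros den_deriv simp: S_def C_def field_simps power2_eq_square)
  also have "- 2 * m * (m * C\<^sup>2 + m * S\<^sup>2) * den x + 2 * m * S * C * (4 * m * S * C)
     = - 2 * m\<^sup>2 * (\<omega> * den x + m\<^sup>2)"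
    unfolding d(1) using CS m_sq by algebra
  also have "\<dots> / (den x)\<^sup>2 = - 2 * (\<omega> + \<rho> x) * \<rho> x"
    using d(2) by (simp add: \<rho>_def field_simps power2_eq_square)
  finally show ?thesis .
qed

lemma U_re_deriv: "(U_re has_real_derivative s x * U_re x + \<rho> x * U_im x) (at x)"
  and U_im_deriv: "(U_im has_real_derivative s x * U_im x - \<rho> x * U_re x) (at x)"
proof -
  define S C A B where "S = sinh (m * x)" and "C = cosh (m * x)" and "A = sqrt (1 + \<omega>)" and "B = sqrt (1 - \<omega>)"
  have CS: "C\<^sup>2 = 1 + S\<^sup>2" by (simp add: S_def C_def cosh_square_eq)
  have AB: "A\<^sup>2 = 1 + \<omega>" "B\<^sup>2 = 1 - \<omega>" "m = A * B" using \<omega> m_eq by (auto simp: A_def B_def)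
  have d: "den x = 1 + \<omega> + 2 * S\<^sup>2" "den x \<noteq> 0" using den_pos[of x] by (auto simp: den_eq S_def)
  have "(U_re has_real_derivative (m * A * m * S * den x - m * A * C * (4 * m * S * C)) / (den x)\<^sup>2) (at x)"
    unfolding U_re_def[abs_def] using d(2)
    by (auto intro!: derivative_eq_intros den_deriv simp: S_def C_def A_def field_simps power2_eq_square)
  also have "m * A * m * S * den x - m * A * C * (4 * m * S * C) = - 2 * m * S * C * (m * A * C) - m\<^sup>2 * (m * B * S)"
    unfolding d(1) using CS m_sq AB by algebra
  also have "\<dots> / (den x)\<^sup>2 = s x * U_re x + \<rho> x * U_im x"
    using d(2) by (simp add: \<rho>_def s_def U_re_def U_im_def S_def C_def A_def B_def field_simps power2_eq_square)
  finally show "(U_re has_real_derivative s x * U_re x + \<rho> x * U_im x) (at x)" .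
  have "(U_im has_real_derivative (- m * B * m * C * den x + m * B * S * (4 * m * S * C)) / (den x)\<^sup>2) (at x)"
    unfolding U_im_def[abs_def] using d(2)
    by (auto intro!: derivative_eq_intros den_deriv simp: S_def C_def B_def field_simps power2_eq_square)
  also have "- m * B * m * C * den x + m * B * S * (4 * m * S * C) = 2 * m * S * C * (m * B * S) - m\<^sup>2 * (m * A * C)"
    unfolding d(1) using CS m_sq AB by algebra
  also have "\<dots> / (den x)\<^sup>2 = s x * U_im x - \<rho> x * U_re x"
    using d(2) by (simp add: \<rho>_def s_def U_re_def U_im_def S_def C_def A_def B_def field_simps power2_eq_square)
  finally show "(U_im has_real_derivative s x * U_im x - \<rho> x * U_re x) (at x)" .
qed

lemma U_re_im:
  "(U_re x)\<^sup>2 + (U_im x)\<^sup>2 = \<rho> x" "(U_re x)\<^sup>2 - (U_im x)\<^sup>2 = \<rho> x * (\<omega> + \<rho> x)" "2 * U_re x * U_im x = \<rho> x * s x"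
proof -
  define S C A B where "S = sinh (m * x)" and "C = cosh (m * x)" and "A = sqrt (1 + \<omega>)" and "B = sqrt (1 - \<omega>)"
  have CS: "C\<^sup>2 = 1 + S\<^sup>2" by (simp add: S_def C_def cosh_square_eq)
  have AB: "A\<^sup>2 = 1 + \<omega>" "B\<^sup>2 = 1 - \<omega>" "m = A * B" using \<omega> m_eq by (auto simp: A_def B_def)
  have d: "den x = 1 + \<omega> + 2 * S\<^sup>2" "den x \<noteq> 0" using den_pos[of x] by (auto simp: den_eq S_def)
  have Re_Im_eq: "U_re x = m * A * C / den x" "U_im x = - m * B * S / den x" by (auto simp: U_re_def U_im_def S_def C_def A_def B_def)
  have "(m * A * C)\<^sup>2 + (m * B * S)\<^sup>2 = m\<^sup>2 * den x" unfolding d(1) using CS AB by algebra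
  thus "(U_re x)\<^sup>2 + (U_im x)\<^sup>2 = \<rho> x"
    using d(2) by (simp add: Re_Im_eq \<rho>_def power_divide add_divide_distrib[symmetric]) (simp add: power2_eq_square)
  have "(m * A * C)\<^sup>2 - (m * B * S)\<^sup>2 = m\<^sup>2 * (\<omega> * den x + m\<^sup>2)" unfolding d(1) using CS AB m_sq by algebra
  thus "(U_re x)\<^sup>2 - (U_im x)\<^sup>2 = \<rho> x * (\<omega> + \<rho> x)"
    using d(2) by (simp add: Re_Im_eq \<rho>_def power_divide diff_divide_distrib[symmetric]) (simp add: field_simps power2_eq_square)
  have "2 * (m * A * C) * (- m * B * S) = m\<^sup>2 * (- 2 * m * S * C)" using AB(3) by algebra
  thus "2 * U_re x * U_im x = \<rho> x * s x"
    unfolding Re_Im_eq \<rho>_def s_def S_def[symmetric] C_def[symmetric]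
    using d(2) by (simp add: divide_simps power2_eq_square)
qed

lemma U_eq: "U \<omega> x = Complex (U_re x) (U_im x)"
proof -
  define S C A B where "S = sinh (m * x)" and "C = cosh (m * x)" and "A = sqrt (1 + \<omega>)" and "B = sqrt (1 - \<omega>)"
  have CS: "C\<^sup>2 = 1 + S\<^sup>2" by (simp add: S_def C_def cosh_square_eq)
  have AB: "A\<^sup>2 = 1 + \<omega>" "B\<^sup>2 = 1 - \<omega>" using \<omega> by (auto simp: A_def B_def)
  have d: "den x = 1 + \<omega> + 2 * S\<^sup>2" "den x \<noteq> 0" using den_pos[of x] by (auto simp: den_eq S_def)
  have D: "(A * C)\<^sup>2 + (B * S)\<^sup>2 = den x" unfolding d(1) using CS AB by algebra
  have "U \<omega> x = of_real m / Complex (A * C) (B * S)"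
    by (simp add: U_def m_def[symmetric] A_def B_def S_def C_def complex_eq_iff Complex_eq)
  also have "\<dots> = Complex (m * A * C / den x) (- m * B * S / den x)"
    by (simp add: complex_eq_iff Re_divide Im_divide D)
  finally show ?thesis by (simp add: U_re_def U_im_def S_def C_def A_def B_def)
qed

text \<open>The phase of \<open>U\<close>, taken as a quotient: \<open>r\<close> never vanishes, so
  it is differentiable without a choice of branch of the argument.\<close>

definition E :: "real \<Rightarrow> complex" where "E x = (1 / r x) *\<^sub>R U \<omega> x"

lemma U_E: "U \<omega> x = of_real (r x) * E x"
  using r_pos[of x] by (simp add: E_def scaleR_conv_of_real)

text \<open>The logarithmic derivative of \<open>U\<close> is r'/r + i \<theta>', with r'/r = s and
  \<theta>' = -\<rho>.\<close>

lemma U_deriv: "(U \<omega> has_vector_derivative Complex (s x) (- \<rho> x) * U \<omega> x) (at x)"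
  unfolding has_vector_derivative_complex_iff U_eq[abs_def] using U_re_deriv[of x] U_im_deriv[of x]
  by (simp add: algebra_simps)

lemma E_norm: "cmod (E x) = 1"
proof -
  have "(cmod (U \<omega> x))\<^sup>2 = (r x)\<^sup>2" by (simp add: U_eq cmod_power2 U_re_im r_sq)
  hence "cmod (U \<omega> x) = r x" using r_pos[of x] by (simp add: power2_eq_iff_nonneg)
  thus ?thesis using r_pos[of x] by (simp add: E_def)
qed

text \<open>This is cos 2\<theta> + i sin 2\<theta>. Apart from the modulus of the phase, only its
  square enters the rotated density.\<close>

lemma E_sq: "(E x)\<^sup>2 = Complex (\<omega> + \<rho> x) (s x)"
proof -
  have "(U \<omega> x)\<^sup>2 = of_real (\<rho> x) * Complex (\<omega> + \<rho> x) (s x)"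
    using U_re_im(2,3)[of x] by (simp add: U_eq complex_eq_iff power2_eq_square mult_ac)
  moreover have "(U \<omega> x)\<^sup>2 = of_real (\<rho> x) * (E x)\<^sup>2"
    by (simp add: U_E power_mult_distrib r_sq flip: of_real_power)
  ultimately show ?thesis using \<rho>_pos[of x] by simp
qed

lemma E_deriv: "(E has_vector_derivative - \<i> * of_real (\<rho> x) * E x) (at x)"
proof -
  have "((\<lambda>x. 1 / r x) has_real_derivative - s x / r x) (at x)"
    using r_pos[of x] by (auto intro!: derivative_eq_intros r_deriv simp: field_simps power2_eq_square)
  from has_vector_derivative_scaleR[OF this U_deriv]
  have "(E has_vector_derivative (1 / r x) *\<^sub>R (Complex (s x) (- \<rho> x) * U \<omega> x) + (- s x / r x) *\<^sub>R U \<omega> x) (at x)"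
    by (simp add: E_def[abs_def])
  also have "(1 / r x) *\<^sub>R (Complex (s x) (- \<rho> x) * U \<omega> x) + (- s x / r x) *\<^sub>R U \<omega> x = - \<i> * of_real (\<rho> x) * E x"
    using r_pos[of x] by (simp add: E_def complex_eq_iff field_simps)
  finally show ?thesis .
qed

lemma continuous_soliton: "continuous_on A \<rho>" "continuous_on A s" "continuous_on A r" "continuous_on A E" "continuous_on A (U \<omega>)"
  using DERIV_isCont[OF \<rho>_deriv] DERIV_isCont[OF s_deriv] DERIV_isCont[OF r_deriv]
    has_vector_derivative_continuous[OF E_deriv] has_vector_derivative_continuous[OF U_deriv]
  by (auto intro!: continuous_at_imp_continuous_on)

section \<open>Decay and integrals of the soliton density\<close>

lemma den_lower: "den x \<ge> (1 + \<omega>) * (1 + m\<^sup>2 * x\<^sup>2)"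
proof -
  have "\<bar>m * x\<bar> \<le> \<bar>sinh (m * x)\<bar>"
  proof -
    have "y \<le> sinh y" if "y \<ge> 0" for y :: real
    proof -
      have "sinh 0 - 0 \<le> sinh y - y"
        by (rule DERIV_nonneg_imp_nondecreasing[OF that])
          (auto intro!: derivative_eq_intros exI simp: cosh_real_ge_1)
      thus ?thesis by simp
    qed
    from this[of "m*x"] this[of "-(m*x)"] show ?thesis by (cases "m * x \<ge> 0") auto
  qed
  hence "(m * x)\<^sup>2 \<le> (sinh (m*x))\<^sup>2" by (simp add: abs_le_square_iff)
  moreover have "(1 + \<omega>) * (m * x)\<^sup>2 \<le> 2 * (m * x)\<^sup>2" using \<omega> by (intro mult_right_mono) auto
  ultimately show ?thesis unfolding den_eq by (simp add: algebra_simps power_mult_distrib)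
qed

text \<open>The decay is in fact exponential, but a Cauchy profile suffices: its integral is
  explicit, and the factor is uniform in \<omega> away from -1. The bound uses m \<le> 1.\<close>

lemma \<rho>_upper: "\<rho> x \<le> inverse (1 + x\<^sup>2) / (1 + \<omega>)"
proof -
  have "(1 + \<omega>) * (m\<^sup>2 * (1 + x\<^sup>2)) \<le> (1 + \<omega>) * (1 + m\<^sup>2 * x\<^sup>2)"
    using \<omega> m_sq zero_le_power2[of \<omega>] by (intro mult_left_mono) (simp add: distrib_left, linarith)
  also have "\<dots> \<le> den x" by (rule den_lower)
  finally have *: "(1 + \<omega>) * (m\<^sup>2 * (1 + x\<^sup>2)) \<le> den x" .
  have "1 + x\<^sup>2 > 0" by (simp add: add_pos_nonneg)
  hence "(1 + \<omega>) * (1 + x\<^sup>2) > 0" using \<omega> by simp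
  hence "m\<^sup>2 / den x \<le> 1 / ((1 + \<omega>) * (1 + x\<^sup>2))"
    using * den_pos[of x] by (simp add: divide_le_eq le_divide_eq mult.commute mult.left_commute)
  thus ?thesis by (simp add: \<rho>_def divide_inverse mult.commute)
qed

lemma \<rho>_integrable: "integrable lborel \<rho>"
proof -
  have [measurable]: "\<rho> \<in> borel_measurable borel"
    by (rule borel_measurable_continuous_onI[OF continuous_soliton(1)])
  have "integrable lborel (\<lambda>x::real. inverse (1 + x\<^sup>2) / (1 + \<omega>))"
    using integrable_inverse_1_plus_square by (auto simp: set_integrable_def)
  thus ?thesis
  proof (rule Bochner_Integration.integrable_bound)
    show "AE x in lborel. norm (\<rho> x) \<le> norm (inverse (1 + x\<^sup>2) / (1 + \<omega>))"
    proof (rule AE_I2)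
      fix x show "norm (\<rho> x) \<le> norm (inverse (1 + x\<^sup>2) / (1 + \<omega>))"
        using \<rho>_upper[of x] \<rho>_pos[of x] \<omega> by simp
    qed
  qed measurable
qed

definition N :: real where "N = (LINT x|lborel. \<rho> x)"

text \<open>For these \<omega> the factor 1/(1 + \<omega>) is at most 2 and the Cauchy profile
  integrates to pi; 8 is a round bound for 2 pi.\<close>

lemma N_le: "\<omega> \<ge> -1/2 \<Longrightarrow> N \<le> 8"
proof -
  assume w: "\<omega> \<ge> -1/2"
  have i: "integrable lborel (\<lambda>x::real. inverse (1 + x\<^sup>2))"
    using integrable_inverse_1_plus_square by (auto simp: set_integrable_def)
  have "N \<le> (LINT x|lborel. 2 * inverse (1 + x\<^sup>2))"
    unfolding N_def
  proof (rule integral_mono)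
    fix x :: real
    have "\<rho> x \<le> inverse (1 + x\<^sup>2) / (1 + \<omega>)" by (rule \<rho>_upper)
    also have "\<dots> \<le> inverse (1 + x\<^sup>2) / (1 / 2)"
      using w by (intro divide_left_mono) auto
    finally show "\<rho> x \<le> 2 * inverse (1 + x\<^sup>2)" by simp
  qed (use i \<rho>_integrable in auto)
  also have "\<dots> = 2 * pi"
    using LBINT_inverse_1_plus_square by (simp add: interval_lebesgue_integral_def set_lebesgue_integral_def)
  also have "\<dots> \<le> 8" using pi_less_4 by simp
  finally show ?thesis .
qed

lemma \<rho>2_integrable: "integrable lborel (\<lambda>x. (\<rho> x)\<^sup>2)"
proof -
  have [measurable]: "\<rho> \<in> borel_measurable borel"
    by (rule borel_measurable_continuous_onI[OF continuous_soliton(1)])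
  have "integrable lborel (\<lambda>x. 2 * \<rho> x)" using \<rho>_integrable by simp
  thus ?thesis
  proof (rule Bochner_Integration.integrable_bound)
    show "AE x in lborel. norm ((\<rho> x)\<^sup>2) \<le> norm (2 * \<rho> x)"
    proof (rule AE_I2)
      fix x show "norm ((\<rho> x)\<^sup>2) \<le> norm (2 * \<rho> x)"
        using \<rho>_pos[of x] \<rho>_le_2[of x] by (simp add: power2_eq_square)
    qed
  qed measurable
qed

text \<open>On [-1/2, 1/2], an interval of length 1, |2 m x| \<le> 1 and cosh 1 \<le> 2 give
  \<open>den\<close> \<le> 5/2, hence \<rho> \<ge> (3/4) / (5/2) = 3/10.\<close>

lemma \<rho>2_lower: "\<bar>\<omega>\<bar> \<le> 1/2 \<Longrightarrow> (LINT x|lborel. (\<rho> x)\<^sup>2) \<ge> 9 / 100"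
proof -
  assume w: "\<bar>\<omega>\<bar> \<le> 1/2"
  have m34: "m\<^sup>2 \<ge> 3 / 4"
  proof -
    have "\<bar>\<omega>\<bar>\<^sup>2 \<le> (1/2)\<^sup>2" using w by (intro power_mono) auto
    thus ?thesis unfolding m_sq by (simp add: power2_eq_square)
  qed
  have *: "\<rho> x \<ge> 3 / 10" if "x \<in> {-1/2..1/2}" for x
  proof -
    have "\<bar>2 * (m * x)\<bar> \<le> 1"
    proof -
      have "m \<le> 1" using m_pos m_sq by (auto simp: m_def)
      thus ?thesis using that m_pos mult_mono[of m 1 "2 * \<bar>x\<bar>" 1]
        by (simp add: abs_mult) linarith
    qed
    hence "cosh (2 * (m * x)) \<le> cosh 1"
      using cosh_real_nonneg_le_iff[of "\<bar>2 * (m * x)\<bar>" 1] by simp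
    also have "\<dots> \<le> 2" 
    proof -
      have "exp (- 1 :: real) \<le> 1" by simp
      from add_mono[OF exp_le this] show ?thesis by (simp add: cosh_field_def)
    qed
    finally have "den x \<le> 5 / 2" using w by (simp add: den_def cosh_double)
    hence "(3/4) / (5/2) \<le> m\<^sup>2 / den x" using m34 den_pos[of x] by (intro frac_le) auto
    thus ?thesis by (simp add: \<rho>_def)
  qed
  have "(LINT x|lborel. (9/100) * indicator {-1/2..1/2::real} x) \<le> (LINT x|lborel. (\<rho> x)\<^sup>2)"
  proof (rule integral_mono[OF _ \<rho>2_integrable])
    fix x :: real
    show "9 / 100 * indicator {- 1 / 2..1 / 2} x \<le> (\<rho> x)\<^sup>2"
      using power_mono[OF *[of x], of 2] by (auto simp: indicator_def power2_eq_square)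
  qed (auto intro!: integrable_real_indicator simp: emeasure_lborel_Icc_eq)
  thus ?thesis by simp
qed

end

section \<open>The Hardy inequality\<close>

lemma has_vector_derivative_complex_of_real:
  "(f has_real_derivative d) (at x) \<Longrightarrow> ((\<lambda>x. complex_of_real (f x)) has_vector_derivative complex_of_real d) (at x)"
  by (intro has_vector_derivative_of_real) (simp add: has_real_derivative_iff_has_vector_derivative)

context soliton
begin

lemma multiplier_s: "multiplier (\<lambda>x. of_real (s x)) (\<lambda>x. of_real (- 2 * (\<omega> + \<rho> x) * \<rho> x))"
proof (rule multiplierI[of _ _ 1 4])
  show "((\<lambda>x. complex_of_real (s x)) has_vector_derivative of_real (- 2 * (\<omega> + \<rho> x) * \<rho> x)) (at x)" for x
    by (rule has_vector_derivative_complex_of_real[OF s_deriv])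
  show "cmod (of_real (- 2 * (\<omega> + \<rho> x) * \<rho> x)) \<le> 4" for x
  proof -
    have "\<bar>\<omega> + \<rho> x\<bar> * \<bar>\<rho> x\<bar> \<le> 1 * 2"
      using c_abs_le[of x] \<rho>_le_2[of x] \<rho>_pos[of x] by (intro mult_mono) auto
    thus ?thesis unfolding norm_of_real abs_mult by (simp add: mult_ac)
  qed
qed (use s_abs_le in \<open>auto intro!: continuous_intros continuous_soliton\<close>)

lemma multiplier_\<rho>: "multiplier (\<lambda>x. of_real (\<rho> x)) (\<lambda>x. of_real (2 * s x * \<rho> x))"
proof (rule multiplierI[of _ _ 2 4])
  show "((\<lambda>x. complex_of_real (\<rho> x)) has_vector_derivative of_real (2 * s x * \<rho> x)) (at x)" for x
    by (rule has_vector_derivative_complex_of_real[OF \<rho>_deriv])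
  show "cmod (of_real (2 * s x * \<rho> x)) \<le> 4" for x
  proof -
    have "\<bar>s x\<bar> * \<bar>\<rho> x\<bar> \<le> 1 * 2"
      using s_abs_le[of x] \<rho>_le_2[of x] \<rho>_pos[of x] by (intro mult_mono) auto
    thus ?thesis unfolding norm_of_real abs_mult by (simp add: mult_ac)
  qed
  show "cmod (of_real (\<rho> x)) \<le> 2" for x using \<rho>_le_2[of x] \<rho>_pos[of x] by simp
qed (auto intro!: continuous_intros continuous_soliton)

lemma multiplier_E: "multiplier E (\<lambda>x. - \<i> * of_real (\<rho> x) * E x)"
proof (rule multiplierI[OF E_deriv, of 1 2])
  show "cmod (- \<i> * of_real (\<rho> x) * E x) \<le> 2" for x
    using \<rho>_le_2[of x] \<rho>_pos[of x] by (simp add: norm_mult E_norm)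
qed (auto intro!: continuous_intros continuous_soliton simp: E_norm)

lemma multiplier_cnj: "multiplier B b \<Longrightarrow> multiplier (\<lambda>x. cnj (B x)) (\<lambda>x. cnj (b x))"
  by (auto simp: multiplier_def bounded_iff intro: primitive_cnj)

lemma r_L2: "(\<lambda>x. of_real (r x)) \<in> L2"
  using \<rho>_integrable continuous_soliton(3)[of UNIV]
  by (auto simp: L2_def r_sq intro!: borel_measurable_continuous_onI continuous_intros)

lemma L2sq_r: "L2sq (\<lambda>x. of_real (r x)) = N"
  by (simp add: L2sq_def r_sq N_def)

lemma sobolev_r: "sobolev (\<lambda>x. of_real (r x)) (\<lambda>x. of_real (s x * r x))"
proof -
  have "primitive (\<lambda>x. complex_of_real (r x)) (\<lambda>x. of_real (s x * r x))"
    by (rule primitive_of_deriv[OF has_vector_derivative_complex_of_real[OF r_deriv]])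
      (intro continuous_intros continuous_soliton)
  moreover have "(\<lambda>x. of_real (s x) * of_real (r x)) \<in> L2"
    using multiplier_s
    by (intro L2_bounded_mult r_L2) (auto simp: multiplier_def intro: primitive_measurable)
  ultimately show ?thesis by (simp add: sobolev_def r_L2)
qed

text \<open>The derivative of r^2 = \<rho> is 2 s \<rho>. This makes the off-diagonal entries vanish
  in the linear systems that the constraints impose on the zero-mode coefficient.\<close>

lemma integral_\<rho>_s: "(LINT x|lborel. \<rho> x * s x) = 0"
proof -
  have "(LINT x|lborel. complex_of_real (2 * (\<rho> x * s x))) = 0"
    using sobolev_integral_0[OF sobolev_r sobolev_r]
    by (simp add: r_sq[symmetric] power2_eq_square algebra_simps flip: mult_2)
  hence "complex_of_real (LINT x|lborel. 2 * (\<rho> x * s x)) = 0"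
    unfolding integral_complex_of_real .
  thus ?thesis by simp
qed

text \<open>Subtracting a multiple of the zero mode \<open>r\<close> makes the function vanish at \<open>0\<close>. On the half
  line \<open>\<sigma> x \<ge> 0\<close> the weight \<open>w = s + 2 \<sigma>\<close> satisfies \<open>\<bar>w\<bar> \<le> 2\<close> and \<open>w' + 2 s w \<le> -1\<close>;
  integrating \<open>(w \<bar>h\<bar>\<^sup>2)'\<close> over it gives the estimate.\<close>
lemma hardy:
  assumes w: "\<bar>\<omega>\<bar> \<le> 1/2" and Z: "sobolev Z Z'"
  obtains k h where "\<And>x. Z x = h x + k * of_real (r x)" "h \<in> L2"
    "L2sq h \<le> 16 * L2sq (\<lambda>x. Z' x - of_real (s x) * Z x)"
proof -
  define k where "k = Z 0 / of_real (r 0)"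
  define h where "h x = Z x - k * of_real (r x)" for x
  define h' where "h' x = Z' x - k * of_real (s x * r x)" for x
  define e where "e x = Z' x - of_real (s x) * Z x" for x
  have h: "sobolev h h'"
    unfolding h_def[abs_def] h'_def[abs_def] by (intro sobolev_diff Z sobolev_cmult sobolev_r)
  have hL2: "h \<in> L2" using h by (simp add: sobolev_def)
  have eL2: "e \<in> L2"
    unfolding e_def[abs_def] using Z multiplier_s
    by (intro L2_diff L2_bounded_mult) (auto simp: sobolev_def multiplier_def intro: primitive_measurable)
  have h0: "h 0 = 0" using r_pos[of 0] by (simp add: h_def k_def)
  have he: "h' x = e x + of_real (s x) * h x" for x
    by (simp add: h_def h'_def e_def algebra_simps)
  define g where "g x = - (cmod (h x))\<^sup>2 + 4 * (cmod (e x) * cmod (h x))" for x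
  have eh: "integrable lborel (\<lambda>x. cmod (e x) * cmod (h x))"
    using integrable_norm[OF L2_mult_integrable[OF eL2 hL2]] by (simp add: norm_mult)
  have gi: "integrable lborel g"
    unfolding g_def[abs_def] using eh L2D(2)[OF hL2] by simp
  define F f where "F \<sigma> x = (of_real (s x) * h x + 2 * of_real \<sigma> * h x) * cnj (h x)"
    and "f \<sigma> x = (of_real (- 2 * (\<omega> + \<rho> x) * \<rho> x) * h x + of_real (s x) * h' x + 2 * of_real \<sigma> * h' x) * cnj (h x)
       + (of_real (s x) * h x + 2 * of_real \<sigma> * h x) * cnj (h' x)" for \<sigma> x
  have F: "primitive (F \<sigma>) (f \<sigma>)" "integrable lborel (F \<sigma>)" "integrable lborel (f \<sigma>)" for \<sigma>
    unfolding F_def[abs_def] f_def[abs_def]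
    by (rule sobolev_product[OF sobolev_add[OF sobolev_mult[OF multiplier_s h] sobolev_cmult[OF h]] sobolev_cnj[OF h]])+
  \<comment> \<open>With w = s + 2 \<sigma> this is (w' + 2 s w) |h|^2 + 2 w Re (e
    \<open>cnj\<close> h), by h' = e + s h.\<close>
  have Ref: "Re (f \<sigma> x) = (- 2 * (\<omega> + \<rho> x) * \<rho> x + 2 * (s x)\<^sup>2 + 4 * \<sigma> * s x) * (cmod (h x))\<^sup>2
      + 2 * (s x + 2 * \<sigma>) * Re (e x * cnj (h x))" for \<sigma> x
    unfolding f_def he cmod_power2 by (simp add: algebra_simps power2_eq_square)
  have bound: "Re (f \<sigma> x) \<le> g x" if "\<sigma> * s x \<le> 0" "\<sigma> = 1 \<or> \<sigma> = -1" for \<sigma> x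
  proof -
    \<comment> \<open>The signs give \<sigma> s = -|s|, and |s| \<le> 1 gives -|s| \<le>
      -s^2.\<close>
    have sq: "\<sigma> * s x \<le> - (s x)\<^sup>2"
    proof -
      have "\<bar>s x\<bar> * \<bar>s x\<bar> \<le> 1 * \<bar>s x\<bar>" using s_abs_le[of x] by (intro mult_right_mono) auto
      thus ?thesis using that by (auto simp: power2_eq_square abs_if split: if_splits)
    qed
    have wc: "\<omega> * (\<omega> + \<rho> x) \<le> 1/2"
    proof -
      have "\<bar>\<omega>\<bar> * \<bar>\<omega> + \<rho> x\<bar> \<le> (1/2) * 1" using w c_abs_le[of x] by (intro mult_mono) auto
      thus ?thesis by (simp add: abs_mult[symmetric])
    qed
    have "- 2 * (\<omega> + \<rho> x) * \<rho> x + 2 * (s x)\<^sup>2 + 4 * \<sigma> * s x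
        \<le> - 2 * (\<omega> + \<rho> x) * \<rho> x - 2 * (s x)\<^sup>2" using sq by simp
    \<comment> \<open>With c = \<omega> + \<rho> the left side is -2 c (c - \<omega>) - 2 s^2, and
      c^2 + s^2 = 1.\<close>
    also have "\<dots> = - 2 + 2 * (\<omega> * (\<omega> + \<rho> x))" using s_c[of x] by algebra
    also have "\<dots> \<le> -1" using wc by simp
    finally have "(- 2 * (\<omega> + \<rho> x) * \<rho> x + 2 * (s x)\<^sup>2 + 4 * \<sigma> * s x) * (cmod (h x))\<^sup>2 \<le> - 1 * (cmod (h x))\<^sup>2"
      by (intro mult_right_mono) auto
    moreover have "2 * (s x + 2 * \<sigma>) * Re (e x * cnj (h x)) \<le> 4 * (cmod (e x) * cmod (h x))"
    proof -
      have "\<bar>s x + 2 * \<sigma>\<bar> \<le> 2" using that s_abs_le[of x] by auto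
      moreover have "\<bar>Re (e x * cnj (h x))\<bar> \<le> cmod (e x) * cmod (h x)"
        using abs_Re_le_cmod[of "e x * cnj (h x)"] by (simp add: norm_mult)
      ultimately have "\<bar>s x + 2 * \<sigma>\<bar> * \<bar>Re (e x * cnj (h x))\<bar> \<le> 2 * (cmod (e x) * cmod (h x))"
        by (intro mult_mono) auto
      hence "(s x + 2 * \<sigma>) * Re (e x * cnj (h x)) \<le> 2 * (cmod (e x) * cmod (h x))"
        by (metis abs_ge_self abs_mult order_trans)
      thus ?thesis unfolding mult.assoc by linarith
    qed
    ultimately show ?thesis unfolding Ref g_def by linarith
  qed
  have si: "set_integrable lborel A (\<lambda>x. Re (f \<sigma> x))" "set_integrable lborel A g" if "A \<in> sets borel" for A \<sigma>
    unfolding set_integrable_def using that gi F(3)[of \<sigma>] by (intro integrable_mult_indicator; simp)+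
  have Re_int: "(LINT x:A|lborel. Re (f \<sigma> x)) = Re (LINT x:A|lborel. f \<sigma> x)" if "A \<in> sets borel" for A \<sigma>
    unfolding set_lebesgue_integral_def using integral_Re[OF integrable_mult_indicator[OF _ F(3)[of \<sigma>]], of A] that by simp
  have "0 \<le> (LINT x:{0..}|lborel. g x)"
  proof -
    \<comment> \<open>The boundary term vanishes because \<open>h 0 = 0\<close>; hence the zero mode
      is subtracted according to the value at 0 and not by orthogonal projection.\<close>
    have "(LINT x:{0..}|lborel. Re (f 1 x)) \<le> (LINT x:{0..}|lborel. g x)"
      by (intro set_integral_mono si bound) (auto simp: s_nonpos)
    thus ?thesis by (simp add: Re_int integral_primitive_atLeast[OF F] F_def h0)
  qed
  moreover have "0 \<le> (LINT x:{..<0}|lborel. g x)"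
  proof -
    have "(LINT x:{..<0}|lborel. Re (f (-1) x)) \<le> (LINT x:{..<0}|lborel. g x)"
      by (intro set_integral_mono si bound) (auto simp: s_nonneg)
    thus ?thesis by (simp add: Re_int integral_primitive_lessThan[OF F] F_def h0)
  qed
  ultimately have "0 \<le> (LINT x|lborel. g x)" using integral_split_at_0[OF gi] by simp
  hence le: "L2sq h \<le> 4 * (LINT x|lborel. cmod (e x) * cmod (h x))"
    unfolding g_def L2sq_def using eh L2D(2)[OF hL2] by simp
  have "L2sq h \<le> 16 * L2sq e"
  proof (cases "L2sq h = 0")
    case False
    hence pos: "L2sq h > 0" using L2sq_nonneg[of h] by simp
    have "(L2sq h)\<^sup>2 \<le> (4 * (LINT x|lborel. cmod (e x) * cmod (h x)))\<^sup>2"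
      using le pos by (intro power_mono) auto
    also have "\<dots> = 16 * (LINT x|lborel. cmod (e x) * cmod (h x))\<^sup>2" by (simp add: power_mult_distrib)
    also have "\<dots> \<le> 16 * (L2sq e * L2sq h)" using L2_Cauchy_Schwarz[OF eL2 hL2] by simp
    finally show ?thesis using pos by (simp add: power2_eq_square)
  qed (simp add: L2sq_nonneg)
  thus ?thesis
    by (intro that[of h k]) (auto simp: h_def hL2 e_def[abs_def])
qed

section \<open>From the constraints to the zero-mode component\<close>

lemma weighted_integrable:
  assumes Z: "Z \<in> L2" and c: "continuous_on UNIV w1" "continuous_on UNIV w2"
    and b: "\<And>x. \<bar>w1 x\<bar> \<le> 2" "\<And>x. \<bar>w2 x\<bar> \<le> 2"
  shows "integrable lborel (\<lambda>x. r x * (w1 x * Re (Z x) + w2 x * Im (Z x)))"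
    "\<bar>LINT x|lborel. r x * (w1 x * Re (Z x) + w2 x * Im (Z x))\<bar> \<le> 4 * (LINT x|lborel. r x * cmod (Z x))"
proof -
  have [measurable]: "w1 \<in> borel_measurable borel" "w2 \<in> borel_measurable borel" "r \<in> borel_measurable borel"
    using c continuous_soliton(3)[of UNIV] by (auto intro: borel_measurable_continuous_onI)
  have [measurable]: "Z \<in> borel_measurable borel" by (rule L2D(1)[OF Z])
  have le: "\<bar>r x * (w1 x * Re (Z x) + w2 x * Im (Z x))\<bar> \<le> 4 * (r x * cmod (Z x))" for x
  proof -
    have "\<bar>w1 x * Re (Z x)\<bar> \<le> 2 * cmod (Z x)" "\<bar>w2 x * Im (Z x)\<bar> \<le> 2 * cmod (Z x)"
      unfolding abs_mult using b[of x] abs_Re_le_cmod[of "Z x"] abs_Im_le_cmod[of "Z x"] by (intro mult_mono; simp)+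
    hence "\<bar>w1 x * Re (Z x) + w2 x * Im (Z x)\<bar> \<le> 4 * cmod (Z x)" by linarith
    from mult_left_mono[OF this, of "r x"] r_pos[of x] show ?thesis by (simp add: abs_mult)
  qed
  have i: "integrable lborel (\<lambda>x. r x * cmod (Z x))"
    using integrable_norm[OF L2_mult_integrable[OF r_L2 Z]] r_pos by (simp add: norm_mult abs_of_pos)
  show int: "integrable lborel (\<lambda>x. r x * (w1 x * Re (Z x) + w2 x * Im (Z x)))"
    by (rule Bochner_Integration.integrable_bound[of _ "\<lambda>x. 4 * (r x * cmod (Z x))"])
      (use i in \<open>auto intro!: AE_I2 order_trans[OF le]\<close>)
  have "\<bar>LINT x|lborel. r x * (w1 x * Re (Z x) + w2 x * Im (Z x))\<bar>
     \<le> (LINT x|lborel. \<bar>r x * (w1 x * Re (Z x) + w2 x * Im (Z x))\<bar>)"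
    using integral_norm_bound[of lborel "\<lambda>x. r x * (w1 x * Re (Z x) + w2 x * Im (Z x))"] by simp
  also have "\<dots> \<le> (LINT x|lborel. 4 * (r x * cmod (Z x)))"
    using int i le by (intro integral_mono) auto
  finally show "\<bar>LINT x|lborel. r x * (w1 x * Re (Z x) + w2 x * Im (Z x))\<bar> \<le> 4 * (LINT x|lborel. r x * cmod (Z x))"
    by simp
qed

text \<open>Inserting Z = h + k r into a constraint, with r^2 = \<rho>, gives a real linear equation
  for Re k and Im k whose right-hand side is controlled by \<open>h\<close>. The 16 is the square of
  the crude factor 4 from the two weights.\<close>

lemma constraint_bound:
  assumes h: "h \<in> L2" and Z: "\<And>x. Z x = h x + k * of_real (r x)"
    and c: "continuous_on UNIV w1" "continuous_on UNIV w2"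
    and b: "\<And>x. \<bar>w1 x\<bar> \<le> 2" "\<And>x. \<bar>w2 x\<bar> \<le> 2"
    and 0: "(LINT x|lborel. r x * (w1 x * Re (Z x) + w2 x * Im (Z x))) = 0"
  shows "(Re k * (LINT x|lborel. \<rho> x * w1 x) + Im k * (LINT x|lborel. \<rho> x * w2 x))\<^sup>2 \<le> 16 * N * L2sq h"
proof -
  have i: "integrable lborel (\<lambda>x. \<rho> x * w1 x)" "integrable lborel (\<lambda>x. \<rho> x * w2 x)"
    using weighted_integrable(1)[OF r_L2 c b] weighted_integrable(1)[OF L2_cmult[OF r_L2, of \<i>] c b]
    by (simp_all add: r_sq[symmetric] power2_eq_square mult_ac)
  note ih = weighted_integrable[OF h c b]
  have "r x * (w1 x * Re (Z x) + w2 x * Im (Z x)) = r x * (w1 x * Re (h x) + w2 x * Im (h x))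
     + (Re k * (\<rho> x * w1 x) + Im k * (\<rho> x * w2 x))" for x
    by (simp add: Z r_sq[symmetric] power2_eq_square algebra_simps)
  hence "(LINT x|lborel. r x * (w1 x * Re (h x) + w2 x * Im (h x))) +
    (Re k * (LINT x|lborel. \<rho> x * w1 x) + Im k * (LINT x|lborel. \<rho> x * w2 x)) = 0"
    using 0 i ih(1) by simp
  hence "\<bar>Re k * (LINT x|lborel. \<rho> x * w1 x) + Im k * (LINT x|lborel. \<rho> x * w2 x)\<bar> \<le> 4 * (LINT x|lborel. r x * cmod (h x))"
    using ih(2) by linarith
  hence "(Re k * (LINT x|lborel. \<rho> x * w1 x) + Im k * (LINT x|lborel. \<rho> x * w2 x))\<^sup>2 \<le> (4 * (LINT x|lborel. r x * cmod (h x)))\<^sup>2"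
    by (intro iffD1[OF abs_le_square_iff]) (rule order_trans[OF _ abs_ge_self])
  also have "\<dots> = 16 * (LINT x|lborel. r x * cmod (h x))\<^sup>2" by (simp add: power_mult_distrib)
  also have "\<dots> \<le> 16 * (N * L2sq h)"
    using L2_Cauchy_Schwarz[OF r_L2 h] r_pos by (simp add: L2sq_r abs_of_pos)
  finally show ?thesis by simp
qed

text \<open>The two constraints form a 2 x 2 system for \<open>k\<close>. Its off-diagonal entries
  vanish, and the lower bounds on its diagonal entries control \<open>k\<close> by \<open>h\<close>,
  which the Hardy inequality bounds. The second lower bound is relative to \<open>N\<close>, so that
  the estimate of (Im k)^2 N is free of \<open>N\<close>.\<close>

lemma coercive:
  assumes w: "\<bar>\<omega>\<bar> \<le> 1/200" and Z: "sobolev Z Z'"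
    and c: "continuous_on UNIV w1" "continuous_on UNIV w2" "continuous_on UNIV v1" "continuous_on UNIV v2"
    and b: "\<And>x. \<bar>w1 x\<bar> \<le> 2" "\<And>x. \<bar>w2 x\<bar> \<le> 2" "\<And>x. \<bar>v1 x\<bar> \<le> 2" "\<And>x. \<bar>v2 x\<bar> \<le> 2"
    and 0: "(LINT x|lborel. r x * (w1 x * Re (Z x) + w2 x * Im (Z x))) = 0"
           "(LINT x|lborel. r x * (v1 x * Re (Z x) + v2 x * Im (Z x))) = 0"
    and I: "(LINT x|lborel. \<rho> x * w2 x) = 0" "(LINT x|lborel. \<rho> x * v1 x) = 0"
           "\<bar>LINT x|lborel. \<rho> x * w1 x\<bar> \<ge> 1/20" "\<bar>LINT x|lborel. \<rho> x * v2 x\<bar> \<ge> N/2"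
  shows "L2sq Z \<le> 14000000 * L2sq (\<lambda>x. Z' x - of_real (s x) * Z x)"
proof -
  have w': "\<bar>\<omega>\<bar> \<le> 1/2" "\<omega> \<ge> - 1/2" using w by auto
  obtain k h where Zh: "\<And>x. Z x = h x + k * of_real (r x)" and h: "h \<in> L2"
    and H: "L2sq h \<le> 16 * L2sq (\<lambda>x. Z' x - of_real (s x) * Z x)"
    using hardy[OF w'(1) Z] by blast
  have N8: "N \<le> 8" by (rule N_le[OF w'(2)])
  have "9 / 100 \<le> (LINT x|lborel. 2 * \<rho> x)"
  proof (rule order_trans[OF \<rho>2_lower[OF w'(1)]], rule integral_mono[OF \<rho>2_integrable])
    show "(\<rho> x)\<^sup>2 \<le> 2 * \<rho> x" for x using \<rho>_pos[of x] \<rho>_le_2[of x] by (simp add: power2_eq_square)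
  qed (use \<rho>_integrable in simp)
  hence N0: "N > 0" by (simp add: N_def)
  have h0: "L2sq h \<ge> 0" by (rule L2sq_nonneg)
  have sq_ge: "y\<^sup>2 \<le> (LINT x|lborel. f x)\<^sup>2" if "\<bar>LINT x|lborel. f x\<bar> \<ge> y" "y \<ge> 0" for f :: "real \<Rightarrow> real" and y
    using power_mono[OF that, of 2] by simp
  have "(Re k)\<^sup>2 * (1/20)\<^sup>2 \<le> 16 * N * L2sq h"
    using constraint_bound[OF h Zh c(1,2) b(1,2) 0(1)] mult_left_mono[OF sq_ge[OF I(3)], of "(Re k)\<^sup>2"]
    by (simp add: I power_mult_distrib)
  hence k1: "(Re k)\<^sup>2 \<le> 6400 * (N * L2sq h)" by (simp add: power2_eq_square)
  have "(Im k)\<^sup>2 * (N/2)\<^sup>2 \<le> 16 * N * L2sq h"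
    using constraint_bound[OF h Zh c(3,4) b(3,4) 0(2)] mult_left_mono[OF sq_ge[OF I(4)], of "(Im k)\<^sup>2"] N0
    by (simp add: I power_mult_distrib)
  hence "N * ((Im k)\<^sup>2 * N) \<le> N * (64 * L2sq h)" by (simp add: power2_eq_square algebra_simps)
  hence k2: "(Im k)\<^sup>2 * N \<le> 64 * L2sq h" using N0 by (simp del: mult.assoc)
  have "(Re k)\<^sup>2 * N \<le> 6400 * (N * L2sq h) * N" using k1 N0 by (intro mult_right_mono) auto
  also have "\<dots> = 6400 * (N * N) * L2sq h" by simp
  also have "\<dots> \<le> 6400 * (8 * 8) * L2sq h" using N8 N0 h0 by (intro mult_right_mono mult_left_mono mult_mono) auto
  finally have k3: "(Re k)\<^sup>2 * N \<le> 409600 * L2sq h" by simp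
  have "L2sq (\<lambda>x. k * of_real (r x)) = (cmod k)\<^sup>2 * N"
    by (simp add: L2sq_def norm_mult power_mult_distrib r_sq N_def)
  hence "L2sq (\<lambda>x. k * of_real (r x)) \<le> 409664 * L2sq h"
    using k2 k3 by (simp add: cmod_power2 distrib_right)
  moreover have "Z = (\<lambda>x. h x + k * of_real (r x))" using Zh by auto
  hence "L2sq Z \<le> 2 * L2sq h + 2 * L2sq (\<lambda>x. k * of_real (r x))"
    using L2_add(2)[OF h L2_cmult[OF r_L2, of k]] by simp
  \<comment> \<open>2 (1 + 409664) = 819330, and 16 times this stays below 14000000.\<close>
  ultimately have "L2sq Z \<le> 819330 * L2sq h" by linarith
  thus ?thesis using H L2sq_nonneg[of "\<lambda>x. Z' x - of_real (s x) * Z x"] by linarith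
qed

section \<open>The two blocks of the quadratic form\<close>


text \<open>The integral is \<omega> N plus that of \<rho>^2, and 1/20 = 9/100 - 8/200; the
  threshold 1/200 is chosen for this.\<close>

lemma integral_\<rho>_c_lower:
  assumes "\<bar>\<omega>\<bar> \<le> 1/200" shows "(LINT x|lborel. \<rho> x * (\<omega> + \<rho> x)) \<ge> 1/20"
proof -
  have "(LINT x|lborel. \<rho> x * (\<omega> + \<rho> x)) = (LINT x|lborel. \<omega> * \<rho> x + (\<rho> x)\<^sup>2)"
    by (intro Bochner_Integration.integral_cong) (auto simp: power2_eq_square algebra_simps)
  also have "\<dots> = \<omega> * N + (LINT x|lborel. (\<rho> x)\<^sup>2)"
    using \<rho>_integrable \<rho>2_integrable by (simp add: N_def)
  finally have e: "(LINT x|lborel. \<rho> x * (\<omega> + \<rho> x)) = \<omega> * N + (LINT x|lborel. (\<rho> x)\<^sup>2)" .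
  have "N \<ge> 0" unfolding N_def by (intro integral_nonneg_AE AE_I2 less_imp_le \<rho>_pos)
  moreover have "N \<le> 8" using assms by (intro N_le) auto
  ultimately have "\<bar>\<omega>\<bar> * \<bar>N\<bar> \<le> (1/200) * 8" using assms by (intro mult_mono) auto
  hence "\<omega> * N \<ge> - (1/25)" by (simp add: abs_mult[symmetric])
  moreover have "(LINT x|lborel. (\<rho> x)\<^sup>2) \<ge> 9/100" using assms by (intro \<rho>2_lower) auto
  ultimately show ?thesis unfolding e by linarith
qed

text \<open>The square of \<open>cnj E\<close> has logarithmic derivative 2 i \<rho>, so multiplying
  \<open>z\<close> by it absorbs the drift term 2 i \<rho> z. In the rotated variable the second
  constraint is, at \<omega> = 0, a condition on Im Z alone, while the first one determines the real
  component; small \<omega> keeps the system invertible.\<close>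

lemma plus_coercive:
  assumes w: "\<bar>\<omega>\<bar> \<le> 1/200" and z: "sobolev z z'"
    and 0: "(LINT x|lborel. r x * Re (z x)) = 0"
           "(LINT x|lborel. r x * (s x * Re (z x) - \<rho> x * Im (z x))) = 0"
  shows "L2sq z \<le> 14000000 * L2sq (\<lambda>x. z' x + 2 * \<i> * of_real (\<rho> x) * z x - of_real (s x) * z x)"
proof -
  define B b where "B x = cnj (E x)" and "b x = cnj (- \<i> * of_real (\<rho> x) * E x)" for x
  have B: "multiplier B b" unfolding B_def[abs_def] b_def[abs_def] by (rule multiplier_cnj[OF multiplier_E])
  define Z Z' where "Z x = B x * (B x * z x)"
    and "Z' x = b x * (B x * z x) + B x * (b x * z x + B x * z' x)" for x
  have Z: "sobolev Z Z'"
    unfolding Z_def[abs_def] Z'_def[abs_def] by (intro sobolev_mult B z)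
  have EB: "E x * B x = 1" for x
    unfolding B_def complex_norm_square[symmetric] by (simp add: E_norm)
  have bB: "b x = \<i> * of_real (\<rho> x) * B x" for x by (simp add: b_def B_def)
  have zZ: "z x = Complex (\<omega> + \<rho> x) (s x) * Z x" for x
  proof -
    have "Complex (\<omega> + \<rho> x) (s x) * Z x = (E x * B x) * (E x * B x) * z x"
      unfolding E_sq[symmetric] Z_def power2_eq_square by (simp only: mult_ac)
    thus ?thesis by (simp add: EB)
  qed
  have B1: "cmod (B x) = 1" for x by (simp add: B_def E_norm)
  have cZ: "cmod (Z x) = cmod (z x)" for x by (simp add: Z_def norm_mult B1)
  have ce: "cmod (Z' x - of_real (s x) * Z x) = cmod (z' x + 2 * \<i> * of_real (\<rho> x) * z x - of_real (s x) * z x)" for x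
  proof -
    have "Z' x - of_real (s x) * Z x = B x * B x * (z' x + 2 * \<i> * of_real (\<rho> x) * z x - of_real (s x) * z x)"
      unfolding Z'_def Z_def bB by (simp add: algebra_simps)
    thus ?thesis by (simp add: norm_mult B1)
  qed
  have wc: "\<bar>\<omega> * (\<omega> + \<rho> x)\<bar> \<le> 1/2" for x
  proof -
    have "\<bar>\<omega>\<bar> * \<bar>\<omega> + \<rho> x\<bar> \<le> (1/2) * 1" using w c_abs_le[of x] by (intro mult_mono) auto
    thus ?thesis by (simp add: abs_mult[symmetric])
  qed
  have "L2sq Z \<le> 14000000 * L2sq (\<lambda>x. Z' x - of_real (s x) * Z x)"
  proof (rule coercive[OF w Z, of "\<lambda>x. \<omega> + \<rho> x" "\<lambda>x. - s x" "\<lambda>x. \<omega> * s x" "\<lambda>x. - (1 - \<omega> * (\<omega> + \<rho> x))"])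
    show "\<bar>\<omega> + \<rho> x\<bar> \<le> 2" "\<bar>- s x\<bar> \<le> 2" for x using c_abs_le[of x] s_abs_le[of x] by auto
    show "\<bar>\<omega> * s x\<bar> \<le> 2" for x
    proof -
      have "\<bar>\<omega>\<bar> * \<bar>s x\<bar> \<le> 1 * 1" using w s_abs_le[of x] by (intro mult_mono) auto
      thus ?thesis by (simp add: abs_mult)
    qed
    show "\<bar>- (1 - \<omega> * (\<omega> + \<rho> x))\<bar> \<le> 2" for x using wc[of x] by linarith
    have "r x * ((\<omega> + \<rho> x) * Re (Z x) + - s x * Im (Z x)) = r x * Re (z x)" for x
      unfolding zZ[of x] by simp
    thus "(LINT x|lborel. r x * ((\<omega> + \<rho> x) * Re (Z x) + - s x * Im (Z x))) = 0" using 0(1) by (simp only:)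
    \<comment> \<open>Put c = \<omega> + \<rho>, so \<rho> = c - \<omega>. Without the factor
      \<omega>, the Re Z terms cancel and the Im Z terms add up to -(c^2 + s^2) = -1.\<close>
    have "\<omega> * s x * Re (Z x) + - (1 - \<omega> * (\<omega> + \<rho> x)) * Im (Z x) = s x * Re (z x) - \<rho> x * Im (z x)" for x
    proof -
      have "Re (z x) = (\<omega> + \<rho> x) * Re (Z x) - s x * Im (Z x)" "Im (z x) = (\<omega> + \<rho> x) * Im (Z x) + s x * Re (Z x)"
        unfolding zZ[of x] by simp_all
      thus ?thesis using s_c[of x] by algebra
    qed
    thus "(LINT x|lborel. r x * (\<omega> * s x * Re (Z x) + - (1 - \<omega> * (\<omega> + \<rho> x)) * Im (Z x))) = 0" using 0(2) by (simp only:)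
    show "(LINT x|lborel. \<rho> x * - s x) = 0" using integral_\<rho>_s by simp
    show "(LINT x|lborel. \<rho> x * (\<omega> * s x)) = 0"
      using integral_\<rho>_s by (simp add: mult.left_commute[of _ \<omega>])
    show "\<bar>LINT x|lborel. \<rho> x * (\<omega> + \<rho> x)\<bar> \<ge> 1/20" using integral_\<rho>_c_lower[OF w] by linarith
    have "N / 2 = (LINT x|lborel. \<rho> x / 2)" by (simp add: N_def)
    also have "\<dots> \<le> (LINT x|lborel. \<rho> x * (1 - \<omega> * (\<omega> + \<rho> x)))"
    proof (rule integral_mono)
      have "integrable lborel (\<lambda>x. \<rho> x - \<omega> * \<omega> * \<rho> x - \<omega> * (\<rho> x)\<^sup>2)"
        using \<rho>_integrable \<rho>2_integrable by simp
      thus "integrable lborel (\<lambda>x. \<rho> x * (1 - \<omega> * (\<omega> + \<rho> x)))"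
        by (simp add: power2_eq_square algebra_simps)
      show "\<rho> x / 2 \<le> \<rho> x * (1 - \<omega> * (\<omega> + \<rho> x))" for x
      proof -
        have "\<rho> x * (1/2) \<le> \<rho> x * (1 - \<omega> * (\<omega> + \<rho> x))"
          using \<rho>_pos[of x] wc[of x] by (intro mult_left_mono) linarith+
        thus ?thesis by simp
      qed
    qed (use \<rho>_integrable in simp)
    finally show "N / 2 \<le> \<bar>LINT x|lborel. \<rho> x * - (1 - \<omega> * (\<omega> + \<rho> x))\<bar>"
      by (simp only: mult_minus_right Bochner_Integration.integral_minus abs_minus_cancel)
  qed (intro continuous_intros continuous_soliton)+
  thus ?thesis unfolding L2sq_def cZ ce .
qed

text \<open>The operator already has the required form. Here the derivative constraint, with weights
  \<rho> and s, determines the real component through the integral of \<rho>^2, and the first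
  constraint determines the imaginary one; so they enter \<open>coercive\<close> in exchanged
  order.\<close>

lemma minus_coercive:
  assumes w: "\<bar>\<omega>\<bar> \<le> 1/200" and z: "sobolev z z'"
    and 0: "(LINT x|lborel. r x * Im (z x)) = 0"
           "(LINT x|lborel. r x * (s x * Im (z x) + \<rho> x * Re (z x))) = 0"
  shows "L2sq z \<le> 14000000 * L2sq (\<lambda>x. z' x - of_real (s x) * z x)"
proof (rule coercive[OF w z, of "\<rho>" "s" "\<lambda>x. 0" "\<lambda>x. 1"])
  show "\<bar>\<rho> x\<bar> \<le> 2" "\<bar>s x\<bar> \<le> 2" for x using \<rho>_pos[of x] \<rho>_le_2[of x] s_abs_le[of x] by auto
  show "(LINT x|lborel. r x * (\<rho> x * Re (z x) + s x * Im (z x))) = 0" using 0(2) by (simp add: add.commute)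
  show "\<bar>LINT x|lborel. \<rho> x * \<rho> x\<bar> \<ge> 1/20"
    using w \<rho>2_lower unfolding power2_eq_square by fastforce
  have "N \<ge> 0" unfolding N_def by (intro integral_nonneg_AE AE_I2 less_imp_le \<rho>_pos)
  thus "\<bar>LINT x|lborel. \<rho> x * 1\<bar> \<ge> N / 2" by (simp add: N_def)
qed (use 0 integral_\<rho>_s in \<open>auto intro!: continuous_intros continuous_soliton\<close>)

section \<open>Squares, potentials and total derivatives in the two forms\<close>

definition e_plus where
  "e_plus z z' x = z' x + 2 * \<i> * of_real (\<rho> x) * z x - of_real (s x) * z x"
definition e_minus where
  "e_minus z z' x = z' x - of_real (s x) * z x"

lemma multiplier_measurable: "multiplier B b \<Longrightarrow> B \<in> borel_measurable borel"
  by (auto simp: multiplier_def intro: primitive_measurable)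

lemma e_L2: assumes "sobolev z z'" shows "e_plus z z' \<in> L2" "e_minus z z' \<in> L2"
proof -
  have "(\<lambda>x. of_real (\<rho> x) * z x) \<in> L2" "(\<lambda>x. of_real (s x) * z x) \<in> L2" 
    using assms multiplier_s multiplier_\<rho>
    by (auto simp: sobolev_def multiplier_def intro!: L2_bounded_mult multiplier_measurable[OF multiplier_s] multiplier_measurable[OF multiplier_\<rho>])
  thus "e_plus z z' \<in> L2" "e_minus z z' \<in> L2"
    unfolding e_plus_def[abs_def] e_minus_def[abs_def] using assms
    by (auto simp: sobolev_def mult.assoc intro!: L2_diff L2_add L2_cmult)
qed

lemma potential_integrable:
  assumes "z \<in> L2"
  shows "integrable lborel (\<lambda>x. \<rho> x * (cmod (z x))\<^sup>2)" "integrable lborel (\<lambda>x. \<rho> x * (Re (z x))\<^sup>2)"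
proof -
  have [measurable]: "z \<in> borel_measurable borel" "\<rho> \<in> borel_measurable borel"
    using assms continuous_soliton(1)[of UNIV] by (auto intro: L2D borel_measurable_continuous_onI)
  have i: "integrable lborel (\<lambda>x. 2 * (cmod (z x))\<^sup>2)" using L2D(2)[OF assms] by simp
  have *: "\<bar>\<rho> x * y\<bar> \<le> 2 * (cmod (z x))\<^sup>2" if "0 \<le> y" "y \<le> (cmod (z x))\<^sup>2" for x y
    unfolding abs_mult using \<rho>_pos[of x] \<rho>_le_2[of x] that by (intro mult_mono) auto
  have "(Re (z x))\<^sup>2 \<le> (cmod (z x))\<^sup>2" for x by (simp add: cmod_power2)
  thus "integrable lborel (\<lambda>x. \<rho> x * (cmod (z x))\<^sup>2)" "integrable lborel (\<lambda>x. \<rho> x * (Re (z x))\<^sup>2)"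
    by (auto intro!: Bochner_Integration.integrable_bound[OF i] AE_I2 order_trans[OF *])
qed

text \<open>4 |z|^2 - 12 (Re z)^2 lies between -8 |z|^2 and 4 |z|^2; with \<rho> \<le> 2 this yields
  16. The second potential is smaller and gets the same constant for uniformity.\<close>

lemma potential_bound:
  assumes "z \<in> L2"
  shows "(LINT x|lborel. 4 * \<omega> * \<rho> x * (cmod (z x))\<^sup>2 - 12 * \<omega> * \<rho> x * (Re (z x))\<^sup>2) \<ge> - 16 * \<bar>\<omega>\<bar> * L2sq z"
    "(LINT x|lborel. 4 * \<omega> * \<rho> x * (Re (z x))\<^sup>2) \<ge> - 16 * \<bar>\<omega>\<bar> * L2sq z"
proof -
  note i = potential_integrable[OF assms] L2D(2)[OF assms]
  have e: "- 16 * \<bar>\<omega>\<bar> * L2sq z = (LINT x|lborel. - (16 * \<bar>\<omega>\<bar>) * (cmod (z x))\<^sup>2)" by (simp add: L2sq_def)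
  have *: "- (16 * \<bar>\<omega>\<bar>) * (cmod (z x))\<^sup>2 \<le> \<omega> * (\<rho> x * y)" if "\<bar>y\<bar> \<le> 8 * (cmod (z x))\<^sup>2" for x y
  proof -
    have "\<bar>\<rho> x * y\<bar> \<le> 2 * (8 * (cmod (z x))\<^sup>2)"
      unfolding abs_mult using \<rho>_pos[of x] \<rho>_le_2[of x] that by (intro mult_mono) auto
    hence "\<bar>\<omega>\<bar> * \<bar>\<rho> x * y\<bar> \<le> \<bar>\<omega>\<bar> * (16 * (cmod (z x))\<^sup>2)" by (intro mult_left_mono) auto
    hence "\<bar>\<omega> * (\<rho> x * y)\<bar> \<le> 16 * \<bar>\<omega>\<bar> * (cmod (z x))\<^sup>2" unfolding abs_mult[of \<omega>] by simp
    thus ?thesis by linarith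
  qed
  have Re_le: "0 \<le> (Re (z x))\<^sup>2" "(Re (z x))\<^sup>2 \<le> (cmod (z x))\<^sup>2" for x by (auto simp: cmod_power2)
  show "(LINT x|lborel. 4 * \<omega> * \<rho> x * (cmod (z x))\<^sup>2 - 12 * \<omega> * \<rho> x * (Re (z x))\<^sup>2) \<ge> - 16 * \<bar>\<omega>\<bar> * L2sq z"
    unfolding e
  proof (rule integral_mono)
    fix x
    have "\<bar>4 * (cmod (z x))\<^sup>2 - 12 * (Re (z x))\<^sup>2\<bar> \<le> 8 * (cmod (z x))\<^sup>2" using Re_le[of x] by linarith
    from *[OF this] show "- (16 * \<bar>\<omega>\<bar>) * (cmod (z x))\<^sup>2 \<le> 4 * \<omega> * \<rho> x * (cmod (z x))\<^sup>2 - 12 * \<omega> * \<rho> x * (Re (z x))\<^sup>2"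
      by (simp add: algebra_simps)
  qed (use i in \<open>simp_all add: mult.assoc\<close>)
  show "(LINT x|lborel. 4 * \<omega> * \<rho> x * (Re (z x))\<^sup>2) \<ge> - 16 * \<bar>\<omega>\<bar> * L2sq z"
    unfolding e
  proof (rule integral_mono)
    fix x
    have "\<bar>4 * (Re (z x))\<^sup>2\<bar> \<le> 8 * (cmod (z x))\<^sup>2" using Re_le[of x] by linarith
    from *[OF this] show "- (16 * \<bar>\<omega>\<bar>) * (cmod (z x))\<^sup>2 \<le> 4 * \<omega> * \<rho> x * (Re (z x))\<^sup>2"
      by (simp only: mult_ac)
  qed (use i in \<open>simp_all add: mult.assoc\<close>)
qed

text \<open>The first integrand is the real part of the product rule for s z times
  \<open>cnj z\<close>; the second is half the imaginary part of the product rule for \<rho> z times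
  z.\<close>

lemma total_derivative_zero:
  assumes z: "sobolev z z'"
  shows "integrable lborel (\<lambda>x. 2 * s x * Re (z' x * cnj (z x)) - 2 * (\<omega> + \<rho> x) * \<rho> x * (cmod (z x))\<^sup>2)"
    "(LINT x|lborel. 2 * s x * Re (z' x * cnj (z x)) - 2 * (\<omega> + \<rho> x) * \<rho> x * (cmod (z x))\<^sup>2) = 0"
    "integrable lborel (\<lambda>x. 2 * s x * \<rho> x * (Re (z x) * Im (z x)) + \<rho> x * (Re (z' x) * Im (z x) + Re (z x) * Im (z' x)))"
    "(LINT x|lborel. 2 * s x * \<rho> x * (Re (z x) * Im (z x)) + \<rho> x * (Re (z' x) * Im (z x) + Re (z x) * Im (z' x))) = 0"
proof -
  have a: "Re ((of_real (- 2 * (\<omega> + \<rho> x) * \<rho> x) * z x + of_real (s x) * z' x) * cnj (z x) + of_real (s x) * z x * cnj (z' x))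
      = 2 * s x * Re (z' x * cnj (z x)) - 2 * (\<omega> + \<rho> x) * \<rho> x * (cmod (z x))\<^sup>2" for x
    unfolding cmod_power2 by (simp add: algebra_simps power2_eq_square)
  have i: "integrable lborel (\<lambda>x. (of_real (- 2 * (\<omega> + \<rho> x) * \<rho> x) * z x + of_real (s x) * z' x) * cnj (z x) + of_real (s x) * z x * cnj (z' x))"
    by (rule sobolev_product(3)[OF sobolev_mult[OF multiplier_s z] sobolev_cnj[OF z]])
  show "integrable lborel (\<lambda>x. 2 * s x * Re (z' x * cnj (z x)) - 2 * (\<omega> + \<rho> x) * \<rho> x * (cmod (z x))\<^sup>2)"
    using integrable_Re[OF i] unfolding a .
  show "(LINT x|lborel. 2 * s x * Re (z' x * cnj (z x)) - 2 * (\<omega> + \<rho> x) * \<rho> x * (cmod (z x))\<^sup>2) = 0"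
    using integral_Re[OF i] unfolding a sobolev_integral_0[OF sobolev_mult[OF multiplier_s z] sobolev_cnj[OF z]] by simp
  have b: "Im ((of_real (2 * s x * \<rho> x) * z x + of_real (\<rho> x) * z' x) * z x + of_real (\<rho> x) * z x * z' x)
      = 2 * (2 * s x * \<rho> x * (Re (z x) * Im (z x)) + \<rho> x * (Re (z' x) * Im (z x) + Re (z x) * Im (z' x)))" for x
    by (simp add: algebra_simps)
  have j: "integrable lborel (\<lambda>x. (of_real (2 * s x * \<rho> x) * z x + of_real (\<rho> x) * z' x) * z x + of_real (\<rho> x) * z x * z' x)"
    by (rule sobolev_product(3)[OF sobolev_mult[OF multiplier_\<rho> z] z])
  show "integrable lborel (\<lambda>x. 2 * s x * \<rho> x * (Re (z x) * Im (z x)) + \<rho> x * (Re (z' x) * Im (z x) + Re (z x) * Im (z' x)))"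
    using integrable_mult_right[OF integrable_Im[OF j], of "1/2"] unfolding b by (simp only: mult.assoc[symmetric]) simp
  show "(LINT x|lborel. 2 * s x * \<rho> x * (Re (z x) * Im (z x)) + \<rho> x * (Re (z' x) * Im (z x) + Re (z x) * Im (z' x))) = 0"
    using integral_Im[OF j] unfolding b sobolev_integral_0[OF sobolev_mult[OF multiplier_\<rho> z] z] integral_mult_right_zero
    by (simp only: zero_complex.sel mult_eq_0_iff) simp
qed

text \<open>In both forms the terms after the potential are total derivatives, namely of \<open>s \<bar>z\<bar>\<^sup>2\<close> and of
  \<open>3 \<rho> Re z Im z\<close> or \<open>- \<rho> Re z Im z\<close>, because \<open>s' = - 2 (\<omega> + \<rho>) \<rho>\<close> and \<open>\<rho>' = 2 s \<rho>\<close>.\<close>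
definition q_plus where
  "q_plus z z' x = (cmod (e_plus z z' x))\<^sup>2 + (4 * \<omega> * \<rho> x * (cmod (z x))\<^sup>2 - 12 * \<omega> * \<rho> x * (Re (z x))\<^sup>2)
    + (2 * s x * Re (z' x * cnj (z x)) - 2 * (\<omega> + \<rho> x) * \<rho> x * (cmod (z x))\<^sup>2)
    + 3 * (2 * s x * \<rho> x * (Re (z x) * Im (z x)) + \<rho> x * (Re (z' x) * Im (z x) + Re (z x) * Im (z' x)))"

definition q_minus where
  "q_minus z z' x = (cmod (e_minus z z' x))\<^sup>2 + 4 * \<omega> * \<rho> x * (Re (z x))\<^sup>2
    + (2 * s x * Re (z' x * cnj (z x)) - 2 * (\<omega> + \<rho> x) * \<rho> x * (cmod (z x))\<^sup>2)
    - (2 * s x * \<rho> x * (Re (z x) * Im (z x)) + \<rho> x * (Re (z' x) * Im (z x) + Re (z x) * Im (z' x)))"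

lemma integral_q:
  assumes z: "sobolev z z'"
  shows "integrable lborel (q_plus z z')" "integrable lborel (q_minus z z')"
    "(LINT x|lborel. q_plus z z' x) \<ge> L2sq (e_plus z z') - 16 * \<bar>\<omega>\<bar> * L2sq z"
    "(LINT x|lborel. q_minus z z' x) \<ge> L2sq (e_minus z z') - 16 * \<bar>\<omega>\<bar> * L2sq z"
proof -
  have zL2: "z \<in> L2" using z by (simp add: sobolev_def)
  note t = total_derivative_zero[OF z]
  note i = L2D(2)[OF e_L2(1)[OF z]] L2D(2)[OF e_L2(2)[OF z]]
  have p: "integrable lborel (\<lambda>x. 4 * \<omega> * \<rho> x * (cmod (z x))\<^sup>2 - 12 * \<omega> * \<rho> x * (Re (z x))\<^sup>2)"
    "integrable lborel (\<lambda>x. 4 * \<omega> * \<rho> x * (Re (z x))\<^sup>2)"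
    using potential_integrable[OF zL2] by (simp_all add: mult.assoc)
  show "integrable lborel (q_plus z z')" "integrable lborel (q_minus z z')"
    unfolding q_plus_def[abs_def] q_minus_def[abs_def]
    by (intro Bochner_Integration.integrable_add Bochner_Integration.integrable_diff integrable_mult_right i p t(1,3))+
  have sum_plus: "(LINT x|lborel. A x + B x + C x + 3 * D x) = (LINT x|lborel. A x) + (LINT x|lborel. B x)"
    and sum_minus: "(LINT x|lborel. A x + B x + C x - D x) = (LINT x|lborel. A x) + (LINT x|lborel. B x)"
    if "integrable lborel A" "integrable lborel B" "integrable lborel C" "(LINT x|lborel. C x) = 0"
      "integrable lborel D" "(LINT x|lborel. D x) = 0" for A B C D :: "real \<Rightarrow> real"
    using that by simp_all
  have "(LINT x|lborel. q_plus z z' x) = L2sq (e_plus z z') +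
     (LINT x|lborel. 4 * \<omega> * \<rho> x * (cmod (z x))\<^sup>2 - 12 * \<omega> * \<rho> x * (Re (z x))\<^sup>2)"
    unfolding q_plus_def L2sq_def by (rule sum_plus[OF i(1) p(1) t])
  thus "(LINT x|lborel. q_plus z z' x) \<ge> L2sq (e_plus z z') - 16 * \<bar>\<omega>\<bar> * L2sq z"
    using potential_bound(1)[OF zL2] by linarith
  have "(LINT x|lborel. q_minus z z' x) = L2sq (e_minus z z') + (LINT x|lborel. 4 * \<omega> * \<rho> x * (Re (z x))\<^sup>2)"
    unfolding q_minus_def L2sq_def by (rule sum_minus[OF i(2) p(2) t])
  thus "(LINT x|lborel. q_minus z z' x) \<ge> L2sq (e_minus z z') - 16 * \<bar>\<omega>\<bar> * L2sq z"
    using potential_bound(2)[OF zL2] by linarith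
qed

text \<open>z' is \<open>e_plus\<close> plus (s - 2 i \<rho>) z, or \<open>e_minus\<close> plus s z;
  both coefficients are at most 5 in modulus, and 2 * 5^2 = 50.\<close>

lemma L2sq_deriv_bound:
  assumes z: "sobolev z z'"
  shows "L2sq z' \<le> 2 * L2sq (e_plus z z') + 50 * L2sq z" "L2sq z' \<le> 2 * L2sq (e_minus z z') + 50 * L2sq z"
proof -
  have [measurable]: "\<rho> \<in> borel_measurable borel" "s \<in> borel_measurable borel" "z \<in> borel_measurable borel"
    using continuous_soliton(1,2)[of UNIV] z by (auto intro: borel_measurable_continuous_onI L2D simp: sobolev_def)
  have zL2: "z \<in> L2" using z by (simp add: sobolev_def)
  define k where "k x = (of_real (s x) - 2 * \<i> * of_real (\<rho> x)) * z x" for x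
  define l where "l x = of_real (s x) * z x" for x
  have "cmod (k x) \<le> 5 * cmod (z x)" "cmod (l x) \<le> 5 * cmod (z x)" for x
  proof -
    have "cmod (of_real (s x) - 2 * \<i> * of_real (\<rho> x)) \<le> cmod (of_real (s x)) + cmod (2 * \<i> * of_real (\<rho> x))"
      by (rule norm_triangle_ineq4)
    also have "\<dots> \<le> 1 + 2 * 2" using s_abs_le[of x] \<rho>_le_2[of x] \<rho>_pos[of x] by (simp add: norm_mult)
    finally show "cmod (k x) \<le> 5 * cmod (z x)" unfolding k_def norm_mult by (intro mult_right_mono) auto
    show "cmod (l x) \<le> 5 * cmod (z x)"
      unfolding l_def norm_mult using s_abs_le[of x] by (intro mult_right_mono) auto
  qed
  moreover have "k \<in> borel_measurable borel" "l \<in> borel_measurable borel"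
    unfolding k_def[abs_def] l_def[abs_def] by measurable
  ultimately have k: "k \<in> L2" "L2sq k \<le> 5\<^sup>2 * L2sq z" and l: "l \<in> L2" "L2sq l \<le> 5\<^sup>2 * L2sq z"
    using L2_dominated[OF zL2] by blast+
  have "z' = (\<lambda>x. e_plus z z' x + k x)" "z' = (\<lambda>x. e_minus z z' x + l x)"
    by (auto simp: e_plus_def e_minus_def k_def l_def algebra_simps)
  thus "L2sq z' \<le> 2 * L2sq (e_plus z z') + 50 * L2sq z" "L2sq z' \<le> 2 * L2sq (e_minus z z') + 50 * L2sq z"
    using L2_add(2)[OF e_L2(1)[OF z] k(1)] L2_add(2)[OF e_L2(2)[OF z] l(1)] k(2) l(2) by auto
qed

text \<open>With T the squared norm of \<open>e_plus\<close> or \<open>e_minus\<close>, coercivity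
  limits the potential to 0.224 T, so more than three quarters of T survive. The left side is at
  most (51 * 14000000 + 2) T, well below 10^10 times that remainder.\<close>

lemma block_bounds:
  assumes w: "\<bar>\<omega>\<bar> \<le> 1/10^9" and z: "sobolev z z'"
  shows "(LINT x|lborel. r x * Re (z x)) = 0 \<Longrightarrow> (LINT x|lborel. r x * (s x * Re (z x) - \<rho> x * Im (z x))) = 0
      \<Longrightarrow> L2sq z + L2sq z' \<le> 10^10 * (LINT x|lborel. q_plus z z' x)"
    "(LINT x|lborel. r x * Im (z x)) = 0 \<Longrightarrow> (LINT x|lborel. r x * (s x * Im (z x) + \<rho> x * Re (z x))) = 0
      \<Longrightarrow> L2sq z + L2sq z' \<le> 10^10 * (LINT x|lborel. q_minus z z' x)"
proof -
  have gen: "L2sq z + L2sq z' \<le> 10^10 * q"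
    if "L2sq z \<le> 14000000 * T" "T - 16 * \<bar>\<omega>\<bar> * L2sq z \<le> q" "L2sq z' \<le> 2 * T + 50 * L2sq z" for T q
  proof -
    have "16 * \<bar>\<omega>\<bar> * L2sq z \<le> 16 * (1/10^9) * L2sq z"
      using w L2sq_nonneg[of z] by (intro mult_right_mono) auto
    thus ?thesis using that L2sq_nonneg[of z] by simp
  qed
  have w': "\<bar>\<omega>\<bar> \<le> 1/200" using w by simp
  {
    assume "(LINT x|lborel. r x * Re (z x)) = 0" "(LINT x|lborel. r x * (s x * Re (z x) - \<rho> x * Im (z x))) = 0"
    from plus_coercive[OF w' z this] integral_q(3)[OF z] L2sq_deriv_bound(1)[OF z]
    show "L2sq z + L2sq z' \<le> 10^10 * (LINT x|lborel. q_plus z z' x)"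
      by (intro gen) (simp_all add: e_plus_def[abs_def])
  next
    assume "(LINT x|lborel. r x * Im (z x)) = 0" "(LINT x|lborel. r x * (s x * Im (z x) + \<rho> x * Re (z x))) = 0"
    from minus_coercive[OF w' z this] integral_q(4)[OF z] L2sq_deriv_bound(2)[OF z]
    show "L2sq z + L2sq z' \<le> 10^10 * (LINT x|lborel. q_minus z z' x)"
      by (intro gen) (simp_all add: e_minus_def[abs_def])
  }
qed

end

section \<open>The density along a ray\<close>

text \<open>Polynomials in the ray parameter \<open>t\<close>. The perturbed field with the phase \<open>E\<close> removed is \<open>y = r + t z\<close>,
  and \<open>E\<close> times \<open>y' - \<i> \<rho> y\<close> is the derivative of \<open>E y\<close>; \<open>d\<close> stands for \<open>z'\<close>.\<close>
definition charge_poly :: "real \<Rightarrow> complex \<Rightarrow> real poly" where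
  "charge_poly r z = [:r, Re z:] * [:r, Re z:] + [:0, Im z:] * [:0, Im z:]"

text \<open>Im (w \<open>cnj\<close> y) for w = y' - i \<rho> y, written through the real and
  imaginary parts of w and y; coefficients are listed by increasing power of t.\<close>

definition current_poly :: "real \<Rightarrow> real \<Rightarrow> real \<Rightarrow> complex \<Rightarrow> complex \<Rightarrow> real poly" where
  "current_poly s rho r z d =
     [:- rho * r, Im d - rho * Re z:] * [:r, Re z:] - [:r * s, Re d + rho * Im z:] * [:0, Im z:]"

definition kinetic_poly :: "real \<Rightarrow> real \<Rightarrow> real \<Rightarrow> complex \<Rightarrow> complex \<Rightarrow> real poly" where
  "kinetic_poly s rho r z d =
     [:r * s, Re d + rho * Im z:] * [:r * s, Re d + rho * Im z:]
     + [:- rho * r, Im d - rho * Re z:] * [:- rho * r, Im d - rho * Re z:]"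

text \<open>Re ((c + i s) y1 y2), the interaction term with c + i s as the square of the
  phase.\<close>

definition mixed_poly :: "real \<Rightarrow> real \<Rightarrow> real \<Rightarrow> complex \<Rightarrow> complex \<Rightarrow> real poly" where
  "mixed_poly c s r z1 z2 =
     smult c ([:r, Re z1:] * [:r, Re z2:] - [:0, Im z1:] * [:0, Im z2:])
     - smult s ([:r, Re z1:] * [:0, Im z2:] + [:0, Im z1:] * [:r, Re z2:])"

definition density_poly ::
  "real \<Rightarrow> real \<Rightarrow> real \<Rightarrow> real \<Rightarrow> complex \<Rightarrow> complex \<Rightarrow> complex \<Rightarrow> complex \<Rightarrow> real poly" where
  "density_poly c s rho r z1 d1 z2 d2 =
     kinetic_poly s rho r z1 d1 + kinetic_poly s rho r z2 d2
     + current_poly s rho r z1 d1 * (charge_poly r z1 + smult 2 (charge_poly r z2))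
     + current_poly s rho r z2 d2 * (smult 2 (charge_poly r z1) + charge_poly r z2)
     - smult 2 (mixed_poly c s r z1 z2 * (charge_poly r z1 + charge_poly r z2))
     + smult 2 (charge_poly r z1 * charge_poly r z2 * (charge_poly r z1 + charge_poly r z2))"

text \<open>Conjugating the second field reverses its current, which cancels the opposite signs of
  the two current terms: the density becomes symmetric in the indices 1 and 2. The phases cancel
  everywhere except in the product of the first field with the conjugate of the second, which
  acquires e^2.\<close>

lemma R_density_rotated:
  assumes e: "cmod e = 1" "e\<^sup>2 = Complex c s"
  shows "Re (R_density (e * y1) (e * w1) (cnj (e * y2)) (cnj (e * w2))) =
    (cmod w1)\<^sup>2 + (cmod w2)\<^sup>2 + Im (w1 * cnj y1) * ((cmod y1)\<^sup>2 + 2 * (cmod y2)\<^sup>2)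
    + Im (w2 * cnj y2) * (2 * (cmod y1)\<^sup>2 + (cmod y2)\<^sup>2)
    - 2 * Re (Complex c s * y1 * y2) * ((cmod y1)\<^sup>2 + (cmod y2)\<^sup>2)
    + 2 * (cmod y1)\<^sup>2 * (cmod y2)\<^sup>2 * ((cmod y1)\<^sup>2 + (cmod y2)\<^sup>2)"
proof -
  have ee: "e * cnj e = 1" by (simp add: complex_norm_square[symmetric] e)
  have 1: "(e * a) * cnj (e * b) = a * cnj b" for a b
    using ee by (simp add: algebra_simps)
  have 2: "cnj (e * a) * (e * b) = cnj a * b" for a b
    using 1[of b a] by (simp add: mult.commute)
  have 3: "(e * y1) * (e * y2) = Complex c s * y1 * y2" "cnj (e * y1) * cnj (e * y2) = cnj (Complex c s * y1 * y2)"
    by (simp_all add: e(2)[symmetric] power2_eq_square mult_ac)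
  have n: "cmod (e * a) = cmod a" "cmod (cnj a) = cmod a" for a by (simp_all add: norm_mult e)
  show ?thesis
    unfolding R_density_def complex_cnj_cnj n 1 2 3
    by (simp add: field_simps)
qed

lemma cmod_charge_poly: "(cmod (of_real r + of_real t * z))\<^sup>2 = poly (charge_poly r z) t"
  unfolding cmod_power2 by (simp add: charge_poly_def power2_eq_square algebra_simps)

lemma poly_density_poly:
  fixes t :: real
  assumes e: "cmod e = 1" "e\<^sup>2 = Complex c s"
    and y: "y1 = of_real r + of_real t * z1" "y2 = of_real r + of_real t * z2"
    and w: "w1 = of_real (r * s) + of_real t * d1 - \<i> * of_real rho * y1" "w2 = of_real (r * s) + of_real t * d2 - \<i> * of_real rho * y2"
  shows "Re (R_density (e * y1) (e * w1) (cnj (e * y2)) (cnj (e * w2))) = poly (density_poly c s rho r z1 d1 z2 d2) t"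
proof -
  have K: "(cmod (of_real (r * s) + of_real t * d - \<i> * of_real rho * (of_real r + of_real t * z)))\<^sup>2 = poly (kinetic_poly s rho r z d) t" for z d
    unfolding cmod_power2 by (simp add: kinetic_poly_def power2_eq_square algebra_simps)
  have J: "Im ((of_real (r * s) + of_real t * d - \<i> * of_real rho * (of_real r + of_real t * z)) * cnj (of_real r + of_real t * z)) = poly (current_poly s rho r z d) t" for z d
    by (simp add: current_poly_def algebra_simps)
  have M: "Re (Complex c s * (of_real r + of_real t * z1) * (of_real r + of_real t * z2)) = poly (mixed_poly c s r z1 z2) t"
    by (simp add: mixed_poly_def algebra_simps)
  show ?thesis
    unfolding R_density_rotated[OF e] w y cmod_charge_poly K J M density_poly_def by simp
qed

lemma coeff_mult_le_2:
  fixes p q :: "real poly"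
  shows "coeff (p * q) 0 = coeff p 0 * coeff q 0"
    "coeff (p * q) 1 = coeff p 0 * coeff q 1 + coeff p 1 * coeff q 0"
    "coeff (p * q) 2 = coeff p 0 * coeff q 2 + coeff p 1 * coeff q 1 + coeff p 2 * coeff q 0"
  by (simp_all add: coeff_mult numeral_2_eq_2)

lemma coeff_linear_le_2:
  "coeff [:a, b:] 0 = (a :: real)" "coeff [:a, b:] 1 = b" "coeff [:a, b:] 2 = 0"
  by (simp_all add: numeral_2_eq_2)

text \<open>The cross terms between (\<open>za\<close>, \<open>da\<close>) and (\<open>zb\<close>,
  \<open>db\<close>) cancel by the symmetry in the indices 1 and 2, which changes the sign of the
  second pair. Eliminating w, r^2 and s^2 in favour of c and \<open>rho\<close> brings both sides to
  a common polynomial normal form.\<close>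

lemma coeff_density_poly:
  fixes za zb da db :: complex
  assumes "r * r = rho" "c = w + rho" "s * s + c * c = 1"
  defines "z1 \<equiv> za + zb" and "z2 \<equiv> za - zb" and "d1 \<equiv> da + db" and "d2 \<equiv> da - db"
  shows "coeff (density_poly c s rho r z1 d1 z2 d2) 2 + (1 - w\<^sup>2) * coeff (charge_poly r z1 + charge_poly r z2) 2 =
    2 * ((cmod (da + 2 * \<i> * of_real rho * za - of_real s * za))\<^sup>2
      + (4 * w * rho * (cmod za)\<^sup>2 - 12 * w * rho * (Re za)\<^sup>2)
      + (2 * s * Re (da * cnj za) - 2 * (w + rho) * rho * (cmod za)\<^sup>2)
      + 3 * (2 * s * rho * (Re za * Im za) + rho * (Re da * Im za + Re za * Im da)))
    + 2 * ((cmod (db - of_real s * zb))\<^sup>2 + 4 * w * rho * (Re zb)\<^sup>2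
      + (2 * s * Re (db * cnj zb) - 2 * (w + rho) * rho * (cmod zb)\<^sup>2)
      - (2 * s * rho * (Re zb * Im zb) + rho * (Re db * Im zb + Re zb * Im db)))"
proof -
  obtain f g where za: "za = Complex f g" by (cases za)
  obtain F G where zb: "zb = Complex F G" by (cases zb)
  obtain f' g' where da: "da = Complex f' g'" by (cases da)
  obtain F' G' where db: "db = Complex F' G'" by (cases db)
  have w: "w = c - rho" using assms by simp
  \<comment> \<open>The second version of each rule catches squares inside longer products.\<close>
  have rr: "r * r = rho" "r * (r * x) = rho * x" for x using assms by (simp_all flip: mult.assoc)
  have ss: "s * s = 1 - c * c" "s * (s * x) = x - c * (c * x)" for x
    using assms(3) by (simp add: algebra_simps, metis assms(3) distrib_right mult.assoc mult_1 add_diff_cancel_right')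
  show ?thesis
    unfolding z1_def z2_def d1_def d2_def za zb da db w density_poly_def kinetic_poly_def current_poly_def charge_poly_def mixed_poly_def
      coeff_add coeff_diff coeff_smult coeff_mult_le_2 coeff_linear_le_2 cmod_power2
    by (simp add: algebra_simps power2_eq_square rr ss)
qed

section \<open>Polynomials with integrable coefficients\<close>

definition real_L2 :: "(real \<Rightarrow> real) set" where
  "real_L2 = {f. (\<lambda>x. complex_of_real (f x)) \<in> L2}"

text \<open>Components of Sobolev functions lie in this class, those of their derivatives only in
  \<open>real_L2\<close>. A product of two members stays in the class, a factor from it preserves
  \<open>real_L2\<close>, and two factors from \<open>real_L2\<close> have an integrable
  product.\<close>

definition bounded_L2 :: "(real \<Rightarrow> real) set" where
  "bounded_L2 = {f \<in> real_L2. bounded (range f)}"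

definition function_space :: "(real \<Rightarrow> real) set \<Rightarrow> bool" where
  "function_space K \<longleftrightarrow> (\<lambda>x. 0) \<in> K \<and> (\<forall>f\<in>K. \<forall>g\<in>K. (\<lambda>x. f x + g x) \<in> K) \<and> (\<forall>c. \<forall>f\<in>K. (\<lambda>x. c * f x) \<in> K)"

text \<open>The degree bound is uniform in x, so integrating an evaluation becomes a finite sum of
  coefficient integrals.\<close>

definition coeffs_in :: "(real \<Rightarrow> real) set \<Rightarrow> (real \<Rightarrow> real poly) \<Rightarrow> bool" where
  "coeffs_in K p \<longleftrightarrow> (\<forall>k. (\<lambda>x. coeff (p x) k) \<in> K) \<and> (\<exists>n. \<forall>x. degree (p x) \<le> n)"

lemma real_L2_measurable:
  assumes "f \<in> real_L2" shows "f \<in> borel_measurable borel"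
proof -
  have [measurable]: "(\<lambda>x. complex_of_real (f x)) \<in> borel_measurable borel"
    using assms by (intro L2D(1)) (simp add: real_L2_def)
  have "(\<lambda>x. Re (complex_of_real (f x))) \<in> borel_measurable borel" by measurable
  thus ?thesis by simp
qed

lemma real_L2_Re: "f \<in> L2 \<Longrightarrow> (\<lambda>x. Re (f x)) \<in> real_L2"
  unfolding real_L2_def mem_Collect_eq
  by (rule L2_dominated(1)[of f _ 1]) (use L2D(1)[of f] in \<open>auto simp: abs_Re_le_cmod\<close>)

lemma real_L2_Im: "f \<in> L2 \<Longrightarrow> (\<lambda>x. Im (f x)) \<in> real_L2"
  unfolding real_L2_def mem_Collect_eq
  by (rule L2_dominated(1)[of f _ 1]) (use L2D(1)[of f] in \<open>auto simp: abs_Im_le_cmod\<close>)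

lemma bounded_L2_Re_Im:
  assumes "f \<in> L2" "bounded (range f)"
  shows "(\<lambda>x. Re (f x)) \<in> bounded_L2" "(\<lambda>x. Im (f x)) \<in> bounded_L2"
proof -
  obtain B where B: "\<And>x. cmod (f x) \<le> B" using assms(2) by (auto simp: bounded_iff)
  have "\<bar>Re (f x)\<bar> \<le> B" "\<bar>Im (f x)\<bar> \<le> B" for x
    using order_trans[OF abs_Re_le_cmod B] order_trans[OF abs_Im_le_cmod B] by auto
  thus "(\<lambda>x. Re (f x)) \<in> bounded_L2" "(\<lambda>x. Im (f x)) \<in> bounded_L2"
    using real_L2_Re[OF assms(1)] real_L2_Im[OF assms(1)] by (auto simp: bounded_L2_def bounded_iff)
qed

lemma real_L2_bounded_mult:
  assumes f: "f \<in> real_L2" and [measurable]: "b \<in> borel_measurable borel" and b: "bounded (range b)"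
  shows "(\<lambda>x. b x * f x) \<in> real_L2"
proof -
  have "bounded (range (\<lambda>x. complex_of_real (b x)))" using b by (auto simp: bounded_iff)
  thus ?thesis
    using L2_bounded_mult[of "\<lambda>x. complex_of_real (f x)" "\<lambda>x. complex_of_real (b x)"] f by (simp add: real_L2_def)
qed

lemma bounded_L2_bounded_mult:
  assumes f: "f \<in> bounded_L2" and b: "b \<in> borel_measurable borel" "bounded (range b)"
  shows "(\<lambda>x. b x * f x) \<in> bounded_L2"
proof -
  obtain B C where "\<And>x. \<bar>b x\<bar> \<le> B" "\<And>x. \<bar>f x\<bar> \<le> C"
    using assms by (auto simp: bounded_iff bounded_L2_def)
  hence "\<bar>b x * f x\<bar> \<le> B * C" for x
    unfolding abs_mult using abs_ge_zero order_trans by (intro mult_mono) blast+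
  thus ?thesis using real_L2_bounded_mult[OF _ b, of f] f by (auto simp: bounded_L2_def bounded_iff)
qed

lemma real_L2_mult_integrable: "f \<in> real_L2 \<Longrightarrow> g \<in> real_L2 \<Longrightarrow> integrable lborel (\<lambda>x. f x * g x)"
  using L2_mult_integrable[of "\<lambda>x. complex_of_real (f x)" "\<lambda>x. complex_of_real (g x)"]
  by (simp add: real_L2_def complex_of_real_integrable_eq flip: of_real_mult)

lemma function_space_real_L2: "function_space real_L2"
  using L2_add(1)[of "\<lambda>x. complex_of_real (f x)" "\<lambda>x. complex_of_real (g x)" for f g]
    L2_cmult[of "\<lambda>x. complex_of_real (f x)" "complex_of_real c" for f c]
  by (auto simp: function_space_def real_L2_def) (simp add: L2_def)

lemma function_space_bounded_L2: "function_space bounded_L2"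
proof -
  have "bounded (range (\<lambda>x. f x + g x))" if "bounded (range f)" "bounded (range g)" for f g :: "real \<Rightarrow> real"
    using that by (rule bounded_plus_comp)
  moreover have "(\<lambda>x. c * f x) \<in> bounded_L2" if "f \<in> bounded_L2" for f c
    using that by (rule bounded_L2_bounded_mult) auto
  ultimately show ?thesis
    using function_space_real_L2 by (auto simp: function_space_def bounded_L2_def)
qed

lemma function_space_integrable: "function_space (Collect (integrable lborel))"
  by (auto simp: function_space_def)

lemma function_space_sum:
  assumes "function_space K" "\<And>i. i \<in> A \<Longrightarrow> f i \<in> K"
  shows "(\<lambda>x. \<Sum>i\<in>A. f i x) \<in> K"
  using assms(2)
proof (induction A rule: infinite_finite_induct)
  case (insert a A)
  thus ?case using assms(1) by (auto simp: function_space_def)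
qed (use assms(1) in \<open>auto simp: function_space_def\<close>)

lemma coeffs_in_mult:
  assumes p: "coeffs_in K p" and q: "coeffs_in L q" and M: "function_space M"
    and KL: "\<And>f g. f \<in> K \<Longrightarrow> g \<in> L \<Longrightarrow> (\<lambda>x. f x * g x) \<in> M"
  shows "coeffs_in M (\<lambda>x. p x * q x)"
proof -
  obtain m n where mn: "\<And>x. degree (p x) \<le> m" "\<And>x. degree (q x) \<le> n" using p q by (auto simp: coeffs_in_def)
  have "degree (p x * q x) \<le> m + n" for x using degree_mult_le[of "p x" "q x"] mn[of x] by linarith
  moreover have "(\<lambda>x. coeff (p x * q x) k) \<in> M" for k
    unfolding coeff_mult by (intro function_space_sum M KL) (use p q in \<open>auto simp: coeffs_in_def\<close>)
  ultimately show ?thesis by (auto simp: coeffs_in_def)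
qed

lemma coeffs_in_add:
  assumes p: "coeffs_in K p" and q: "coeffs_in K q" and K: "function_space K"
  shows "coeffs_in K (\<lambda>x. p x + q x)"
proof -
  obtain m n where mn: "\<And>x. degree (p x) \<le> m" "\<And>x. degree (q x) \<le> n" using p q by (auto simp: coeffs_in_def)
  have "degree (p x + q x) \<le> max m n" for x
    using mn[of x] by (intro degree_add_le) auto
  thus ?thesis using p q K by (auto simp: coeffs_in_def function_space_def)
qed

lemma coeffs_in_smult:
  assumes p: "coeffs_in K p" and c: "\<And>f. f \<in> K \<Longrightarrow> (\<lambda>x. c x * f x) \<in> K"
  shows "coeffs_in K (\<lambda>x. smult (c x) (p x))"
proof -
  obtain m where "\<And>x. degree (p x) \<le> m" using p by (auto simp: coeffs_in_def)
  hence "degree (smult (c x) (p x)) \<le> m" for x using degree_smult_le order_trans by blast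
  thus ?thesis using p c by (auto simp: coeffs_in_def)
qed

lemma coeffs_in_smult_const:
  assumes p: "coeffs_in K p" and K: "function_space K"
  shows "coeffs_in K (\<lambda>x. smult c (p x))"
  using p by (rule coeffs_in_smult) (use K in \<open>auto simp: function_space_def\<close>)

lemma coeffs_in_diff:
  assumes p: "coeffs_in K p" and q: "coeffs_in K q" and K: "function_space K"
  shows "coeffs_in K (\<lambda>x. p x - q x)"
  using coeffs_in_add[OF p coeffs_in_smult_const[OF q K, of "-1"] K] by simp

lemma coeffs_in_linear:
  assumes "f \<in> K" "g \<in> K" "function_space K"
  shows "coeffs_in K (\<lambda>x. [:f x, g x:])"
proof -
  have "(\<lambda>x. coeff [:f x, g x:] k) \<in> K" for k
  proof (cases k)
    case (Suc j)
    thus ?thesis using assms by (cases j) (auto simp: function_space_def)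
  qed (use assms in auto)
  moreover have "degree [:f x, g x:] \<le> 1" for x by (simp add: degree_pCons_le order_trans)
  ultimately show ?thesis by (auto simp: coeffs_in_def)
qed

lemma coeffs_in_mono: "coeffs_in K p \<Longrightarrow> K \<subseteq> L \<Longrightarrow> coeffs_in L p"
  by (auto simp: coeffs_in_def)

lemma poly_eq_sum_of_degree_le:
  assumes "degree (p :: real poly) \<le> n" shows "poly p t = (\<Sum>k\<le>n. coeff p k * t ^ k)"
  unfolding poly_altdef
  by (rule sum.mono_neutral_left) (use assms in \<open>auto simp: coeff_eq_0 not_le\<close>)

text \<open>Exchanging the integral with this finite sum shows that the functional is a polynomial
  along the ray, which replaces differentiation under the integral sign.\<close>

lemma integral_poly_family:
  assumes "coeffs_in (Collect (integrable lborel)) p"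
  obtains S where "\<And>t. integrable lborel (\<lambda>x. poly (p x) t)" "\<And>t. (LINT x|lborel. poly (p x) t) = poly S t"
    "\<And>k. coeff S k = (LINT x|lborel. coeff (p x) k)"
proof -
  obtain n where n: "\<And>x. degree (p x) \<le> n" using assms by (auto simp: coeffs_in_def)
  have i: "integrable lborel (\<lambda>x. coeff (p x) k)" for k using assms by (auto simp: coeffs_in_def)
  define S where "S = (\<Sum>k\<le>n. monom (LINT x|lborel. coeff (p x) k) k)"
  show ?thesis
  proof (rule that[of S])
    show "integrable lborel (\<lambda>x. poly (p x) t)" for t
      unfolding poly_eq_sum_of_degree_le[OF n] using i by auto
    show "(LINT x|lborel. poly (p x) t) = poly S t" for t
      unfolding poly_eq_sum_of_degree_le[OF n] S_def poly_sum poly_monom using i by simp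
    show "coeff S k = (LINT x|lborel. coeff (p x) k)" for k
    proof (cases "k \<le> n")
      case False
      hence "coeff (p x) k = 0" for x using n[of x] by (intro coeff_eq_0) simp
      thus ?thesis using False by (simp add: S_def coeff_sum coeff_monom)
    qed (simp add: S_def coeff_sum coeff_monom)
  qed
qed

text \<open>Polynomials are differentiable for every t, so the existence part of the predicate is
  automatic.\<close>

lemma second_variation_of_poly:
  assumes "\<And>t. F (\<lambda>x. p x + t *\<^sub>R u x) (\<lambda>x. q x + t *\<^sub>R v x) = poly S t"
  shows "has_second_variation F p q u v (2 * coeff S 2)"
  unfolding has_second_variation_def assms
proof (intro exI[of _ "poly (pderiv S)"] conjI always_eventually allI)
  have "(poly (pderiv S) has_real_derivative poly (pderiv (pderiv S)) 0) (at 0)" by (rule poly_DERIV)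
  also have "poly (pderiv (pderiv S)) 0 = 2 * coeff S 2"
    by (simp add: poly_0_coeff_0 coeff_pderiv numeral_2_eq_2)
  finally show "(poly (pderiv S) has_real_derivative 2 * coeff S 2) (at 0)" .
qed (rule poly_DERIV)

lemma charge_poly_coeffs_in:
  assumes "r \<in> bounded_L2" "(\<lambda>x. Re (z x)) \<in> bounded_L2" "(\<lambda>x. Im (z x)) \<in> bounded_L2"
  shows "coeffs_in bounded_L2 (\<lambda>x. charge_poly (r x) (z x))"
    "coeffs_in (Collect (integrable lborel)) (\<lambda>x. charge_poly (r x) (z x))"
proof -
  have z: "(\<lambda>x. 0) \<in> bounded_L2" using function_space_bounded_L2 by (simp add: function_space_def)
  note l = coeffs_in_linear[OF assms(1,2) function_space_bounded_L2] coeffs_in_linear[OF z assms(3) function_space_bounded_L2]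
  have m: "(\<lambda>x. f x * g x) \<in> bounded_L2" if "f \<in> bounded_L2" "g \<in> bounded_L2" for f g
    using that bounded_L2_bounded_mult[of g f] real_L2_measurable by (auto simp: bounded_L2_def)
  have m': "(\<lambda>x. f x * g x) \<in> Collect (integrable lborel)" if "f \<in> bounded_L2" "g \<in> bounded_L2" for f g
    using that real_L2_mult_integrable by (auto simp: bounded_L2_def)
  show "coeffs_in bounded_L2 (\<lambda>x. charge_poly (r x) (z x))"
    unfolding charge_poly_def
    by (intro coeffs_in_add coeffs_in_mult[OF l(1) l(1)] coeffs_in_mult[OF l(2) l(2)] function_space_bounded_L2 m)
  show "coeffs_in (Collect (integrable lborel)) (\<lambda>x. charge_poly (r x) (z x))"
    unfolding charge_poly_def
    by (intro coeffs_in_add coeffs_in_mult[OF l(1) l(1)] coeffs_in_mult[OF l(2) l(2)] function_space_integrable m')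
qed

text \<open>No term of the density has more than two derivative factors, so each can be grouped into
  two factors with coefficients in \<open>real_L2\<close>, the remaining ones being bounded.\<close>

lemma density_poly_coeffs_in:
  assumes r: "r \<in> bounded_L2"
    and z1: "(\<lambda>x. Re (z1 x)) \<in> bounded_L2" "(\<lambda>x. Im (z1 x)) \<in> bounded_L2"
    and z2: "(\<lambda>x. Re (z2 x)) \<in> bounded_L2" "(\<lambda>x. Im (z2 x)) \<in> bounded_L2"
    and d1: "(\<lambda>x. Re (d1 x)) \<in> real_L2" "(\<lambda>x. Im (d1 x)) \<in> real_L2"
    and d2: "(\<lambda>x. Re (d2 x)) \<in> real_L2" "(\<lambda>x. Im (d2 x)) \<in> real_L2"
    and c: "c \<in> borel_measurable borel" "bounded (range c)"
    and s: "s \<in> borel_measurable borel" "bounded (range s)"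
    and rho: "rho \<in> borel_measurable borel" "bounded (range rho)"
  shows "coeffs_in (Collect (integrable lborel)) (\<lambda>x. density_poly (c x) (s x) (rho x) (r x) (z1 x) (d1 x) (z2 x) (d2 x))"
proof -
  note fs = function_space_real_L2 function_space_bounded_L2 function_space_integrable
  have sub: "bounded_L2 \<subseteq> real_L2" by (auto simp: bounded_L2_def)
  have zb: "(\<lambda>x. 0) \<in> bounded_L2" using fs(2) by (simp add: function_space_def)
  have mb: "(\<lambda>x. f x * g x) \<in> bounded_L2" if "f \<in> bounded_L2" "g \<in> bounded_L2" for f g
    using that bounded_L2_bounded_mult[of g f] real_L2_measurable by (auto simp: bounded_L2_def)
  have m2: "(\<lambda>x. f x * g x) \<in> real_L2" if "f \<in> real_L2" "g \<in> bounded_L2" for f g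
    using that real_L2_bounded_mult[of f g] real_L2_measurable by (auto simp: bounded_L2_def mult.commute)
  have m1: "(\<lambda>x. f x * g x) \<in> Collect (integrable lborel)" if "f \<in> real_L2" "g \<in> real_L2" for f g
    using that real_L2_mult_integrable by auto
  have mul_b: "coeffs_in bounded_L2 (\<lambda>x. p x * q x)" if "coeffs_in bounded_L2 p" "coeffs_in bounded_L2 q" for p q
    by (rule coeffs_in_mult[OF that fs(2) mb])
  have mul_2: "coeffs_in real_L2 (\<lambda>x. p x * q x)" if "coeffs_in real_L2 p" "coeffs_in bounded_L2 q" for p q
    by (rule coeffs_in_mult[OF that fs(1) m2])
  have mul_1: "coeffs_in (Collect (integrable lborel)) (\<lambda>x. p x * q x)" if "coeffs_in real_L2 p" "coeffs_in real_L2 q" for p q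
    by (rule coeffs_in_mult[OF that fs(3) m1])
  have lin: "coeffs_in bounded_L2 (\<lambda>x. [:r x, Re (z x):])" "coeffs_in bounded_L2 (\<lambda>x. [:0, Im (z x):])"
      "coeffs_in real_L2 (\<lambda>x. [:r x * s x, Re (d x) + rho x * Im (z x):])"
      "coeffs_in real_L2 (\<lambda>x. [:- rho x * r x, Im (d x) - rho x * Re (z x):])"
    if z: "(\<lambda>x. Re (z x)) \<in> bounded_L2" "(\<lambda>x. Im (z x)) \<in> bounded_L2"
      and d: "(\<lambda>x. Re (d x)) \<in> real_L2" "(\<lambda>x. Im (d x)) \<in> real_L2" for z d
  proof -
    have rs: "(\<lambda>x. r x * s x) \<in> real_L2" 
      using real_L2_bounded_mult[OF _ s, of r] r sub by (auto simp: mult.commute)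
    have neg: "(\<lambda>x. - 1 * f x) \<in> real_L2" if "f \<in> real_L2" for f
      using that fs(1) unfolding function_space_def by (elim conjE) (erule allE, erule bspec)
    have add: "(\<lambda>x. f x + g x) \<in> real_L2" if "f \<in> real_L2" "g \<in> real_L2" for f g
      using that fs(1) unfolding function_space_def by simp
    have *: "(\<lambda>x. rho x * Im (z x)) \<in> real_L2" "(\<lambda>x. - 1 * (rho x * Re (z x))) \<in> real_L2" "(\<lambda>x. - 1 * (rho x * r x)) \<in> real_L2"
      by (rule neg real_L2_bounded_mult[OF _ rho] subsetD[OF sub] z r)+
    note ** = add[OF d(1) *(1)] add[OF d(2) *(2)]
    show "coeffs_in bounded_L2 (\<lambda>x. [:r x, Re (z x):])" "coeffs_in bounded_L2 (\<lambda>x. [:0, Im (z x):])"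
      "coeffs_in real_L2 (\<lambda>x. [:r x * s x, Re (d x) + rho x * Im (z x):])"
      "coeffs_in real_L2 (\<lambda>x. [:- rho x * r x, Im (d x) - rho x * Re (z x):])"
      using coeffs_in_linear[OF r z(1) fs(2)] coeffs_in_linear[OF zb z(2) fs(2)]
        coeffs_in_linear[OF rs **(1) fs(1)] coeffs_in_linear[OF *(3) **(2) fs(1)] by simp_all
  qed
  note l1 = lin[OF z1 d1] and l2 = lin[OF z2 d2]
  have N1: "coeffs_in bounded_L2 (\<lambda>x. charge_poly (r x) (z1 x))" and N2: "coeffs_in bounded_L2 (\<lambda>x. charge_poly (r x) (z2 x))"
    by (intro charge_poly_coeffs_in(1) r z1 z2)+
  have N1': "coeffs_in real_L2 (\<lambda>x. charge_poly (r x) (z1 x))" and N2': "coeffs_in real_L2 (\<lambda>x. charge_poly (r x) (z2 x))"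
    by (rule coeffs_in_mono[OF N1 sub], rule coeffs_in_mono[OF N2 sub])
  have K: "coeffs_in (Collect (integrable lborel)) (\<lambda>x. kinetic_poly (s x) (rho x) (r x) (z1 x) (d1 x))"
      "coeffs_in (Collect (integrable lborel)) (\<lambda>x. kinetic_poly (s x) (rho x) (r x) (z2 x) (d2 x))"
    unfolding kinetic_poly_def
    by (intro coeffs_in_add fs mul_1 l1 l2)+
  have J: "coeffs_in real_L2 (\<lambda>x. current_poly (s x) (rho x) (r x) (z1 x) (d1 x))"
      "coeffs_in real_L2 (\<lambda>x. current_poly (s x) (rho x) (r x) (z2 x) (d2 x))"
    unfolding current_poly_def
    by (intro coeffs_in_diff fs mul_2 l1 l2)+
  have M: "coeffs_in bounded_L2 (\<lambda>x. mixed_poly (c x) (s x) (r x) (z1 x) (z2 x))"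
    unfolding mixed_poly_def
    by (intro coeffs_in_diff coeffs_in_add coeffs_in_smult fs mul_b l1 l2)
      (assumption | rule bounded_L2_bounded_mult c s)+
  have NN: "coeffs_in real_L2 (\<lambda>x. charge_poly (r x) (z1 x) + charge_poly (r x) (z2 x))"
    by (intro coeffs_in_add N1' N2' fs)
  have s1: "coeffs_in real_L2 (\<lambda>x. charge_poly (r x) (z1 x) + smult 2 (charge_poly (r x) (z2 x)))"
    and s2: "coeffs_in real_L2 (\<lambda>x. smult 2 (charge_poly (r x) (z1 x)) + charge_poly (r x) (z2 x))"
    by (intro coeffs_in_add coeffs_in_smult_const N1' N2' fs)+
  have P: "coeffs_in real_L2 (\<lambda>x. charge_poly (r x) (z1 x) * charge_poly (r x) (z2 x))"
    by (intro mul_2 N1' N2)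
  show ?thesis
    unfolding density_poly_def
    by (intro coeffs_in_add coeffs_in_diff coeffs_in_smult_const fs K
        mul_1[OF J(1) s1] mul_1[OF J(2) s2] mul_1[OF coeffs_in_mono[OF M sub] NN] mul_1[OF P NN])
qed

section \<open>Coercivity of the second variation\<close>

context soliton
begin

lemma sobolev_U: "sobolev (U \<omega>) (\<lambda>x. Complex (s x) (- \<rho> x) * U \<omega> x)"
proof -
  have "(\<lambda>x. E x * of_real (r x)) = U \<omega>" by (auto simp: U_E mult.commute)
  moreover have "(\<lambda>x. - \<i> * of_real (\<rho> x) * E x * of_real (r x) + E x * of_real (s x * r x))
     = (\<lambda>x. Complex (s x) (- \<rho> x) * U \<omega> x)"
    by (auto simp: U_E Complex_eq algebra_simps)
  ultimately show ?thesis using sobolev_mult[OF multiplier_E sobolev_r] by simp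
qed

lemma E_cnj: "E x * cnj (E x) = 1"
  unfolding complex_norm_square[symmetric] by (simp add: E_norm)

lemma r_bounded_L2: "r \<in> bounded_L2"
  using bounded_L2_Re_Im(1)[OF r_L2 sobolev_bounded[OF sobolev_r]] by simp

lemma second_variation_bound:
  assumes w: "\<bar>\<omega>\<bar> \<le> 1/10^9" and uv: "(u, v) \<in> constrained_perturbations \<omega>"
  shows "\<exists>D. has_second_variation (Lyapunov \<omega>) (U \<omega>) (\<lambda>x. cnj (U \<omega> x)) u v D
     \<and> D \<ge> (1/(9*10^10)) * ((H1_norm u)\<^sup>2 + (H1_norm v)\<^sup>2)"
proof -
  have u: "u \<in> H1" and v: "v \<in> H1"
    and con1: "(LINT x|lborel. cnj (U \<omega> x) * u x + U \<omega> x * v x) = 0"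
    and con2: "(LINT x|lborel. cnj (vector_derivative (U \<omega>) (at x)) * u x + vector_derivative (U \<omega>) (at x) * v x) = 0"
    using uv by (auto simp: constrained_perturbations_def)
  define u' v' where "u' = weak_deriv u" and "v' = weak_deriv v"
  obtain a where a: "primitive a u'" "AE x in lborel. u x = a x" "a \<in> L2"
    using H1_representative[OF u] unfolding u'_def by blast
  obtain b where b: "primitive b v'" "AE x in lborel. v x = b x" "b \<in> L2"
    using H1_representative[OF v] unfolding v'_def by blast
  have sa: "sobolev a u'" and sb: "sobolev b v'"
    using a b H1D(2)[OF u] H1D(2)[OF v] by (auto simp: sobolev_def u'_def v'_def)
  have [measurable]: "u \<in> borel_measurable borel" "v \<in> borel_measurable borel"
      "a \<in> borel_measurable borel" "b \<in> borel_measurable borel" "u' \<in> borel_measurable borel" "v' \<in> borel_measurable borel"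
    using H1D[OF u] H1D[OF v] a(3) b(3) by (auto simp: u'_def v'_def L2D)
  have [measurable]: "U \<omega> \<in> borel_measurable borel" "s \<in> borel_measurable borel" "\<rho> \<in> borel_measurable borel"
      "r \<in> borel_measurable borel" "E \<in> borel_measurable borel"
    using continuous_soliton[of UNIV] by (auto intro: borel_measurable_continuous_onI)

  define B B' where "B x = cnj (E x)" and "B' x = cnj (- \<i> * of_real (\<rho> x) * E x)" for x
  have B: "multiplier B B'" unfolding B_def[abs_def] B'_def[abs_def] by (rule multiplier_cnj[OF multiplier_E])
  define z1 d1 z2 d2 where "z1 x = B x * a x" and "d1 x = B' x * a x + B x * u' x"
    and "z2 x = B x * cnj (b x)" and "d2 x = B' x * cnj (b x) + B x * cnj (v' x)" for x
  have s1: "sobolev z1 d1" and s2: "sobolev z2 d2"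
    unfolding z1_def[abs_def] d1_def[abs_def] z2_def[abs_def] d2_def[abs_def]
    by (intro sobolev_mult B sa sobolev_cnj sb)+
  define za da zb db where "za x = 1/2 * (z1 x + z2 x)" and "da x = 1/2 * (d1 x + d2 x)"
    and "zb x = 1/2 * (z1 x - z2 x)" and "db x = 1/2 * (d1 x - d2 x)" for x
  have sza: "sobolev za da" and szb: "sobolev zb db"
    unfolding za_def[abs_def] da_def[abs_def] zb_def[abs_def] db_def[abs_def]
    by (intro sobolev_cmult sobolev_add sobolev_diff s1 s2)+
  have z12: "z1 x = za x + zb x" "z2 x = za x - zb x" "d1 x = da x + db x" "d2 x = da x - db x" for x
    by (simp_all add: za_def zb_def da_def db_def field_simps)

  have Ez: "E x * z1 x = a x" "E x * z2 x = cnj (b x)"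
    "E x * d1 x = \<i> * of_real (\<rho> x) * a x + u' x" "E x * d2 x = \<i> * of_real (\<rho> x) * cnj (b x) + cnj (v' x)" for x
    using E_cnj[of x] unfolding z1_def z2_def d1_def d2_def B_def B'_def
    by (simp_all add: distrib_left mult.assoc[symmetric] mult.commute[of "E x" \<i>])

  have c1: "(LINT x|lborel. r x * Re (za x)) = 0" "(LINT x|lborel. r x * Im (zb x)) = 0"
  proof -
    have i: "integrable lborel (\<lambda>x. cnj (U \<omega> x) * a x + U \<omega> x * b x)"
      using sobolev_U a b by (intro Bochner_Integration.integrable_add L2_mult_integrable L2_cnj) (auto simp: sobolev_def)
    have "(LINT x|lborel. cnj (U \<omega> x) * a x + U \<omega> x * b x) = (LINT x|lborel. cnj (U \<omega> x) * u x + U \<omega> x * v x)"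
      by (intro integral_cong_AE) (use a(2) b(2) in auto)
    hence 0: "(LINT x|lborel. cnj (U \<omega> x) * a x + U \<omega> x * b x) = 0" using con1 by simp
    \<comment> \<open>Because z2 appears conjugated, the real part sees z1 + z2 and the imaginary
      part z1 - z2: each complex constraint supplies one real condition for each block.\<close>
    have "cnj (U \<omega> x) * a x + U \<omega> x * b x = of_real (r x) * (z1 x + cnj (z2 x))" for x
      by (simp add: U_E z1_def z2_def B_def algebra_simps)
    hence "Re (cnj (U \<omega> x) * a x + U \<omega> x * b x) = 2 * (r x * Re (za x))"
      "Im (cnj (U \<omega> x) * a x + U \<omega> x * b x) = 2 * (r x * Im (zb x))" for x
      by (simp_all add: z12)
    thus "(LINT x|lborel. r x * Re (za x)) = 0" "(LINT x|lborel. r x * Im (zb x)) = 0"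
      using integral_Re[OF i] integral_Im[OF i] 0 by simp_all
  qed
  have c2: "(LINT x|lborel. r x * (s x * Re (za x) - \<rho> x * Im (za x))) = 0"
    "(LINT x|lborel. r x * (s x * Im (zb x) + \<rho> x * Re (zb x))) = 0"
  proof -
    define U' where "U' x = Complex (s x) (- \<rho> x) * U \<omega> x" for x
    have vd: "vector_derivative (U \<omega>) (at x) = U' x" for x
      unfolding U'_def by (rule vector_derivative_at[OF U_deriv])
    have UL2: "U' \<in> L2" using sobolev_U by (simp add: sobolev_def U'_def[abs_def])
    have [measurable]: "U' \<in> borel_measurable borel" by (rule L2D(1)[OF UL2])
    have i: "integrable lborel (\<lambda>x. cnj (U' x) * a x + U' x * b x)"
      using UL2 a b by (intro Bochner_Integration.integrable_add L2_mult_integrable L2_cnj)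
    have "(LINT x|lborel. cnj (U' x) * a x + U' x * b x) = (LINT x|lborel. cnj (U' x) * u x + U' x * v x)"
      by (intro integral_cong_AE) (use a(2) b(2) in auto)
    hence 0: "(LINT x|lborel. cnj (U' x) * a x + U' x * b x) = 0" using con2 by (simp add: vd)
    have rot: "cnj (U' x) * a x + U' x * b x = of_real (r x) * (Complex (s x) (\<rho> x) * z1 x + cnj (Complex (s x) (\<rho> x) * z2 x))" for x
    proof -
      have "cnj (Complex (s x) (- \<rho> x)) = Complex (s x) (\<rho> x)" "cnj (Complex (s x) (\<rho> x)) = Complex (s x) (- \<rho> x)"
        by (simp_all add: complex_eq_iff)
      thus ?thesis by (simp add: U'_def U_E z1_def z2_def B_def algebra_simps)
    qed
    have "Re (cnj (U' x) * a x + U' x * b x) = 2 * (r x * (s x * Re (za x) - \<rho> x * Im (za x)))"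
      "Im (cnj (U' x) * a x + U' x * b x) = 2 * (r x * (s x * Im (zb x) + \<rho> x * Re (zb x)))" for x
      unfolding rot z12 by (simp_all add: algebra_simps)
    thus "(LINT x|lborel. r x * (s x * Re (za x) - \<rho> x * Im (za x))) = 0"
      "(LINT x|lborel. r x * (s x * Im (zb x) + \<rho> x * Re (zb x))) = 0"
      using integral_Re[OF i] integral_Im[OF i] 0 by simp_all
  qed

  define PR where "PR x = density_poly (\<omega> + \<rho> x) (s x) (\<rho> x) (r x) (z1 x) (d1 x) (z2 x) (d2 x)" for x
  define PQ where "PQ x = charge_poly (r x) (z1 x) + charge_poly (r x) (z2 x)" for x
  have L2s: "z1 \<in> L2" "z2 \<in> L2" "d1 \<in> L2" "d2 \<in> L2" using s1 s2 by (auto simp: sobolev_def)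
  note zb12 = bounded_L2_Re_Im[OF L2s(1) sobolev_bounded[OF s1]] bounded_L2_Re_Im[OF L2s(2) sobolev_bounded[OF s2]]
  have PR: "coeffs_in (Collect (integrable lborel)) PR"
    unfolding PR_def[abs_def]
  proof (intro density_poly_coeffs_in r_bounded_L2 zb12 real_L2_Re real_L2_Im L2s)
    show "bounded (range (\<lambda>x. \<omega> + \<rho> x))" "bounded (range s)" "bounded (range \<rho>)"
      using c_abs_le s_abs_le \<rho>_pos \<rho>_le_2 by (auto simp: bounded_iff abs_of_pos)
  qed measurable
  have PQ: "coeffs_in (Collect (integrable lborel)) PQ"
    unfolding PQ_def[abs_def]
    by (intro coeffs_in_add charge_poly_coeffs_in(2) r_bounded_L2 zb12 function_space_integrable)
  obtain SR where SR: "\<And>t. integrable lborel (\<lambda>x. poly (PR x) t)" "\<And>t. (LINT x|lborel. poly (PR x) t) = poly SR t"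
    "\<And>k. coeff SR k = (LINT x|lborel. coeff (PR x) k)" by (rule integral_poly_family[OF PR], rule that)
  obtain SQ where SQ: "\<And>t. integrable lborel (\<lambda>x. poly (PQ x) t)" "\<And>t. (LINT x|lborel. poly (PQ x) t) = poly SQ t"
    "\<And>k. coeff SQ k = (LINT x|lborel. coeff (PQ x) k)" by (rule integral_poly_family[OF PQ], rule that)
  define S where "S = SR + smult (1 - \<omega>\<^sup>2) SQ"

  have "Lyapunov \<omega> (\<lambda>x. U \<omega> x + t *\<^sub>R u x) (\<lambda>x. cnj (U \<omega> x) + t *\<^sub>R v x) = poly S t" for t
  proof -
    define ut vt where "ut x = U \<omega> x + t *\<^sub>R u x" and "vt x = cnj (U \<omega> x) + t *\<^sub>R v x" for x
    define U' where "U' x = Complex (s x) (- \<rho> x) * U \<omega> x" for x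
    have su: "sobolev (\<lambda>x. U \<omega> x + of_real t * a x) (\<lambda>x. U' x + of_real t * u' x)"
      unfolding U'_def by (intro sobolev_add sobolev_U sobolev_cmult sa)
    have sv: "sobolev (\<lambda>x. cnj (U \<omega> x) + of_real t * b x) (\<lambda>x. cnj (U' x) + of_real t * v' x)"
      unfolding U'_def by (intro sobolev_add sobolev_cnj sobolev_U sobolev_cmult sb)
    have [measurable]: "ut \<in> borel_measurable borel" "vt \<in> borel_measurable borel"
      unfolding ut_def[abs_def] vt_def[abs_def] by measurable
    have uta: "AE x in lborel. ut x = U \<omega> x + of_real t * a x"
      using a(2) by eventually_elim (simp add: ut_def scaleR_conv_of_real)
    have vtb: "AE x in lborel. vt x = cnj (U \<omega> x) + of_real t * b x"
      using b(2) by eventually_elim (simp add: vt_def scaleR_conv_of_real)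
    note su' = su[unfolded sobolev_def] and sv' = sv[unfolded sobolev_def]
    have mut: "ut \<in> borel_measurable borel" and mvt: "vt \<in> borel_measurable borel" by measurable
    \<comment> \<open>For each t, the chosen derivatives of the perturbed fields are replaced by
      those of the explicit representatives.\<close>
    note wu = weak_deriv_AE_eq[OF conjunct1[OF su'] conjunct1[OF conjunct2[OF su']] conjunct2[OF conjunct2[OF su']] mut uta]
      and wv = weak_deriv_AE_eq[OF conjunct1[OF sv'] conjunct1[OF conjunct2[OF sv']] conjunct2[OF conjunct2[OF sv']] mvt vtb]
    have [measurable]: "weak_deriv ut \<in> borel_measurable borel" "weak_deriv vt \<in> borel_measurable borel"
      using H1D(2)[OF wu(1)] H1D(2)[OF wv(1)] by (auto simp: L2D)
    define y1 y2 where "y1 x = of_real (r x) + of_real t * z1 x" and "y2 x = of_real (r x) + of_real t * z2 x" for x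
    define w1 w2 where "w1 x = of_real (r x * s x) + of_real t * d1 x - \<i> * of_real (\<rho> x) * y1 x"
      and "w2 x = of_real (r x * s x) + of_real t * d2 x - \<i> * of_real (\<rho> x) * y2 x" for x
    have Ey: "E x * y1 x = U \<omega> x + of_real t * a x" "cnj (E x * y2 x) = cnj (U \<omega> x) + of_real t * b x" for x
    proof -
      have "E x * y1 x = U \<omega> x + of_real t * (E x * z1 x)" "E x * y2 x = U \<omega> x + of_real t * (E x * z2 x)"
        by (simp_all add: y1_def y2_def U_E algebra_simps)
      thus "E x * y1 x = U \<omega> x + of_real t * a x" "cnj (E x * y2 x) = cnj (U \<omega> x) + of_real t * b x"
        by (simp_all add: Ez)
    qed
    have Ew: "E x * w1 x = U' x + of_real t * u' x" "cnj (E x * w2 x) = cnj (U' x) + of_real t * v' x" for x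
    proof -
      have e: "E x * w1 x = U' x + of_real t * (E x * d1 x - \<i> * of_real (\<rho> x) * (E x * z1 x))"
        "E x * w2 x = U' x + of_real t * (E x * d2 x - \<i> * of_real (\<rho> x) * (E x * z2 x))"
        by (simp_all add: w1_def w2_def y1_def y2_def U'_def U_E Complex_eq algebra_simps)
      show "E x * w1 x = U' x + of_real t * u' x" "cnj (E x * w2 x) = cnj (U' x) + of_real t * v' x"
        unfolding e Ez by simp_all
    qed
    have "R ut vt = (LINT x|lborel. poly (PR x) t)"
      unfolding R_def
    proof (rule integral_cong_AE)
      show "AE x in lborel. Re (R_density (ut x) (weak_deriv ut x) (vt x) (weak_deriv vt x)) = poly (PR x) t"
        using uta vtb wu(2) wv(2)
      proof eventually_elim
        case (elim x)
        show ?case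
          unfolding elim PR_def Ey[symmetric] Ew[symmetric]
          by (rule poly_density_poly[OF E_norm E_sq]) (simp_all add: y1_def y2_def w1_def w2_def)
      qed
      show "(\<lambda>x. poly (PR x) t) \<in> borel_measurable lborel" using SR(1) by (rule borel_measurable_integrable)
      show "(\<lambda>x. Re (R_density (ut x) (weak_deriv ut x) (vt x) (weak_deriv vt x))) \<in> borel_measurable lborel"
        unfolding R_density_def by measurable
    qed
    moreover have "Q ut vt = (LINT x|lborel. poly (PQ x) t)"
      unfolding Q_def
    proof (rule integral_cong_AE)
      show "AE x in lborel. (cmod (ut x))\<^sup>2 + (cmod (vt x))\<^sup>2 = poly (PQ x) t"
        using uta vtb
      proof eventually_elim
        case (elim x)
        have "(cmod (E x * y1 x))\<^sup>2 = poly (charge_poly (r x) (z1 x)) t" "(cmod (cnj (E x * y2 x)))\<^sup>2 = poly (charge_poly (r x) (z2 x)) t"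
          unfolding complex_mod_cnj norm_mult E_norm y1_def y2_def by (simp_all add: cmod_charge_poly)
        thus ?case unfolding elim PQ_def Ey[symmetric] by simp
      qed
      show "(\<lambda>x. poly (PQ x) t) \<in> borel_measurable lborel" using SQ(1) by (rule borel_measurable_integrable)
    qed measurable
    ultimately show ?thesis
      unfolding Lyapunov_def ut_def[abs_def, symmetric] vt_def[abs_def, symmetric] SR(2) SQ(2) S_def by simp
  qed
  hence var: "has_second_variation (Lyapunov \<omega>) (U \<omega>) (\<lambda>x. cnj (U \<omega> x)) u v (2 * coeff S 2)"
    by (rule second_variation_of_poly)

  define I where "I = (LINT x|lborel. q_plus za da x) + (LINT x|lborel. q_minus zb db x)"
  have "coeff S 2 = 2 * I"
  proof -
    have i: "integrable lborel (\<lambda>x. coeff (PR x) 2)" "integrable lborel (\<lambda>x. coeff (PQ x) 2)"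
      using PR PQ by (auto simp: coeffs_in_def)
    have "coeff S 2 = (LINT x|lborel. coeff (PR x) 2 + (1 - \<omega>\<^sup>2) * coeff (PQ x) 2)"
      using i by (simp add: S_def SR(3) SQ(3))
    also have "\<dots> = (LINT x|lborel. 2 * q_plus za da x + 2 * q_minus zb db x)"
    proof (rule Bochner_Integration.integral_cong)
      fix x
      show "coeff (PR x) 2 + (1 - \<omega>\<^sup>2) * coeff (PQ x) 2 = 2 * q_plus za da x + 2 * q_minus zb db x"
        unfolding PR_def PQ_def z12 q_plus_def q_minus_def e_plus_def e_minus_def
        by (rule coeff_density_poly) (use r_sq[of x] s_c[of x] in \<open>simp_all add: power2_eq_square\<close>)
    qed simp
    also have "\<dots> = 2 * I" using integral_q(1)[OF sza] integral_q(2)[OF szb] by (simp add: I_def)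
    finally show ?thesis .
  qed
  moreover have "(H1_norm u)\<^sup>2 + (H1_norm v)\<^sup>2 \<le> 36 * (10^10 * I)"
  proof -
    define T where "T = L2sq za + L2sq da + L2sq zb + L2sq db"
    have T: "T \<le> 10^10 * I"
      using block_bounds(1)[OF w sza c1(1) c2(1)] block_bounds(2)[OF w szb c1(2) c2(2)]
      by (simp add: T_def I_def)
    have nn: "L2sq f \<ge> 0" for f by (rule L2sq_nonneg)
    \<comment> \<open>Restoring the phase changes the derivative by -i \<rho> z, with \<rho> \<le>
      2. The left side is thus at most 9 \<open>L2sq z\<close> + 2 \<open>L2sq d\<close>, and
      recombining the blocks doubles this: 18 is 2 * 9.\<close>
    have gen: "L2sq f + L2sq f' \<le> 18 * T"
      if "z \<in> L2" "d \<in> L2" "\<And>x. cmod (f x) = cmod (z x)" "\<And>x. cmod (f' x) = cmod (d x + - (\<i> * of_real (\<rho> x) * z x))"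
        "L2sq z \<le> 2 * L2sq za + 2 * L2sq zb" "L2sq d \<le> 2 * L2sq da + 2 * L2sq db" for f f' z d
    proof -
      have [measurable]: "z \<in> borel_measurable borel" using that by (simp add: L2D)
      have k: "(\<lambda>x. - (\<i> * of_real (\<rho> x) * z x)) \<in> L2" "L2sq (\<lambda>x. - (\<i> * of_real (\<rho> x) * z x)) \<le> 2\<^sup>2 * L2sq z"
      proof -
        have "cmod (- (\<i> * of_real (\<rho> x) * z x)) \<le> 2 * cmod (z x)" for x
          using \<rho>_pos[of x] \<rho>_le_2[of x] by (simp add: norm_mult mult_right_mono)
        from L2_dominated[OF that(1) _ this]
        show "(\<lambda>x. - (\<i> * of_real (\<rho> x) * z x)) \<in> L2"
          "L2sq (\<lambda>x. - (\<i> * of_real (\<rho> x) * z x)) \<le> 2\<^sup>2 * L2sq z" by measurable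
      qed
      have "L2sq f = L2sq z" unfolding L2sq_def that(3) ..
      moreover have "L2sq f' = L2sq (\<lambda>x. d x + - (\<i> * of_real (\<rho> x) * z x))" unfolding L2sq_def that(4) ..
      ultimately show ?thesis
        using L2_add(2)[OF that(2) k(1)] k(2) that(5,6) nn[of za] nn[of zb] nn[of da] nn[of db] unfolding T_def by simp
    qed
    have dd: "L2sq z1 \<le> 2 * L2sq za + 2 * L2sq zb" "L2sq d1 \<le> 2 * L2sq da + 2 * L2sq db"
      "L2sq z2 \<le> 2 * L2sq za + 2 * L2sq zb" "L2sq d2 \<le> 2 * L2sq da + 2 * L2sq db"
    proof -
      have m: "L2sq (\<lambda>x. - f x) = L2sq f" "(\<lambda>x. - f x) \<in> L2" if "f \<in> L2" for f
        using L2_cmult[OF that, of "-1"] by (simp_all add: L2sq_def)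
      have l: "za \<in> L2" "da \<in> L2" "zb \<in> L2" "db \<in> L2" using sza szb by (auto simp: sobolev_def)
      have e: "z1 = (\<lambda>x. za x + zb x)" "d1 = (\<lambda>x. da x + db x)" "z2 = (\<lambda>x. za x + - zb x)" "d2 = (\<lambda>x. da x + - db x)"
        by (auto simp: z12)
      show "L2sq z1 \<le> 2 * L2sq za + 2 * L2sq zb" "L2sq d1 \<le> 2 * L2sq da + 2 * L2sq db"
        "L2sq z2 \<le> 2 * L2sq za + 2 * L2sq zb" "L2sq d2 \<le> 2 * L2sq da + 2 * L2sq db"
        unfolding e using L2_add(2)[OF l(1,3)] L2_add(2)[OF l(2,4)]
          L2_add(2)[OF l(1) m(2)[OF l(3)]] L2_add(2)[OF l(2) m(2)[OF l(4)]] m(1)[OF l(3)] m(1)[OF l(4)] by simp_all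
    qed
    have cE: "cmod (f) = cmod (E x * f)" for f x by (simp add: norm_mult E_norm)
    have "L2sq a + L2sq u' \<le> 18 * T"
    proof (rule gen[OF L2s(1,3) _ _ dd(1,2)])
      show "cmod (a x) = cmod (z1 x)" for x unfolding Ez(1)[symmetric] by (rule cE[symmetric])
      have "E x * (d1 x + - (\<i> * of_real (\<rho> x) * z1 x)) = u' x" for x
        using Ez(1,3)[of x] by (simp add: algebra_simps)
      thus "cmod (u' x) = cmod (d1 x + - (\<i> * of_real (\<rho> x) * z1 x))" for x by (metis cE)
    qed
    moreover have "L2sq b + L2sq v' \<le> 18 * T"
    proof (rule gen[OF L2s(2,4) _ _ dd(3,4)])
      show "cmod (b x) = cmod (z2 x)" for x by (metis cE Ez(2) complex_mod_cnj)
      have "E x * (d2 x + - (\<i> * of_real (\<rho> x) * z2 x)) = cnj (v' x)" for x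
        using Ez(2,4)[of x] by (simp add: algebra_simps)
      thus "cmod (v' x) = cmod (d2 x + - (\<i> * of_real (\<rho> x) * z2 x))" for x by (metis cE complex_mod_cnj)
    qed
    moreover have "(H1_norm u)\<^sup>2 = L2sq a + L2sq u'"
    proof -
      have "(LINT x|lborel. (cmod (u x))\<^sup>2) = L2sq a"
        unfolding L2sq_def by (intro integral_cong_AE) (use a(2) in auto)
      thus ?thesis unfolding H1_norm_def u'_def[symmetric] L2sq_def[of u', symmetric] using nn by simp
    qed
    moreover have "(H1_norm v)\<^sup>2 = L2sq b + L2sq v'"
    proof -
      have "(LINT x|lborel. (cmod (v x))\<^sup>2) = L2sq b"
        unfolding L2sq_def by (intro integral_cong_AE) (use b(2) in auto)
      thus ?thesis unfolding H1_norm_def v'_def[symmetric] L2sq_def[of v', symmetric] using nn by simp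
    qed
    ultimately show ?thesis using T by linarith
  qed
  \<comment> \<open>The second variation is 4 I and the squared norms are at most 36 * 10^10 I, so
    the factor is 4 / (36 * 10^10).\<close>
  ultimately have "2 * coeff S 2 \<ge> (1/(9*10^10)) * ((H1_norm u)\<^sup>2 + (H1_norm v)\<^sup>2)" by simp
  with var show ?thesis by blast
qed

end

theorem theorem3:
  shows "\<exists>\<omega>\<^sub>0::real. 0 < \<omega>\<^sub>0 \<and> \<omega>\<^sub>0 \<le> 1 \<and>
           (\<forall>\<omega>::real. - \<omega>\<^sub>0 < \<omega> \<and> \<omega> < \<omega>\<^sub>0 \<longrightarrow>
              strictly_convex_at (Lyapunov \<omega>) (U \<omega>) (\<lambda>x. cnj (U \<omega> x))
                (constrained_perturbations \<omega>))"
proof (intro exI[of _ "1/10^9"] conjI allI impI)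
  fix \<omega> :: real assume \<omega>: "- (1/10^9) < \<omega> \<and> \<omega> < 1/10^9"
  hence w: "\<bar>\<omega>\<bar> \<le> 1/10^9" by linarith
  interpret soliton \<omega> by standard (use \<omega> in simp_all)
  show "strictly_convex_at (Lyapunov \<omega>) (U \<omega>) (\<lambda>x. cnj (U \<omega> x)) (constrained_perturbations \<omega>)"
    unfolding strictly_convex_at_def
    using second_variation_bound[OF w] by (intro exI[of _ "1/(9*10^10)"]) auto
qed simp_all

end
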